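(* Let $(\Lambda,d)$ be a $k$-graph. Suppose there is an $\mathbf{n}=(n_1,\ldots,n_k)\in\mathbb{N}^k$ with $n_i\neq0$ for $1\leq i\leq k$ such that the $1$-graph with vertices $\Lambda^0$ and edges $\Lambda^{\mathbf{n}}$ has the strong double-cycle property. Let $(S^{(1)},\ldots,S^{(k)},\rho)$ be a finitely correlated, isometric, fully coisometric representation of the product system $E(\Lambda)$, generating a WOT-closed algebra $\mathfrak{S}$. Then $\mathfrak{S}$ contains the projection onto its minimal cyclic coinvariant subspace.
   Context: $k$-graphs. A $k$-graph $(\Lambda,d)$ is a countable small category $\Lambda$ with a degree functor $d:\Lambda\to\mathbb N^k$ ($\mathbb N=\{0,1,\dots\}$) with the factorization property: if $d(\lambda)=\mathbf m+\mathbf n$ there are unique $\mu,\nu\in\Lambda$ with $\lambda=\mu\nu$, $d(\mu)=\mathbf m$, $d(\nu)=\mathbf n$. $\Lambda^{\mathbf n}=d^{-1}(\mathbf n)$; $\Lambda^0$ is the set of vertices; $s,r:\Lambda\to\Lambda^0$ are the source and range maps. Directed graphs. A path is a finite sequence of edges $e_k\cdots e_1$ with $r(e_i)=s(e_{i+1})$, from $s(e_1)$ to $r(e_k)$; a cycle is a path with $s(e_1)=r(e_k)$. A vertex lies on a double-cycle if it lies on two distinct minimal cycles. A graph has the strong double-cycle property if from every vertex there is a path to a vertex lying on a double-cycle. Correspondences. All $C^*$-algebras and their representations are unital (standing convention; so $\Lambda^0$ is finite). For a graph with vertex set $V$ and edge set $X$, let $\mathcal A=C_0(V)$ and let $E$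 be the set of $\xi:X\to\mathbb C$ with $v\mapsto\sum_{s(e)=v}|\xi(e)|^2$ finite-valued and vanishing at infinity; $E$ is a $C^*$-correspondence over $\mathcal A$ with $\langle\xi,\eta\rangle(v)=\sum_{s(e)=v}\overline{\xi(e)}\eta(e)$, $(a\xi)(e)=a(r(e))\xi(e)$, $(\xi a)(e)=\xi(e)a(s(e))$. The product system $E(\Lambda)$ over $\mathbb N^k$ with coefficient algebra $\mathcal A=C_0(\Lambda^0)$ has fibres $E_i$ ($1\le i\le k$) the correspondence of the graph $(\Lambda^0,\Lambda^{\mathbf e_i})$, $\mathbf e_i$ the standard generators of $\mathbb N^k$, with isomorphisms $t_{i,j}:E_i\otimes E_j\to E_j\otimes E_i$ (interior tensor products) determined by $t_{i,j}(\delta_\lambda\otimes\delta_\mu)=\delta_{\mu'}\otimes\delta_{\lambda'}$ whenever $s(\lambda)=r(\mu)$ and $\lambda\mu=\mu'\lambda'$ with $\lambda,\lambda'\in\Lambda^{\mathbf e_i}$, $\mu,\mu'\in\Lambda^{\mathbf e_j}$ ($t_{i,i}$ is the identity); the fibre over $\mathbf n$ is $E(\mathbf n)=E_1^{n_1}\otimes\cdots\otimes E_k^{n_k}$, which is the correspondence of the graph $(\Lambda^0,\Lambda^{\mathbf n})$. Representations. A representation $(A,\sigma)$ of a $C^*$-correspondence $F$ over $\mathcal A$ on $\mathcal V$ is a completely contractive linear map $A:F\to\mathcal B(\mathcal V)$ and a unital representation $\sigma$ of $\mathcal A$ with $A(a\xi b)=\sigma(a)A(\xi)\sigma(b)$.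 $F\otimes_\sigma\mathcal V$ is the Hausdorff completion of the algebraic tensor product for $\langle\xi_1\otimes h_1,\xi_2\otimes h_2\rangle=\langle h_1,\sigma(\langle\xi_1,\xi_2\rangle)h_2\rangle$; $\tilde A(\xi\otimes h)=A(\xi)h$. $(A,\sigma)$ is isometric if $A(\xi)^*A(\eta)=\sigma(\langle\xi,\eta\rangle)$, fully coisometric if $\tilde A\tilde A^*=I$. $(S,\rho)$ on $\mathcal H\supseteq\mathcal V$ dilates $(A,\sigma)$ if $\mathcal V$ reduces $\rho$ with $\rho(a)|_{\mathcal V}=\sigma(a)$, $\mathcal V^\perp$ is invariant under all $S(\xi)$, and $P_{\mathcal V}S(\xi)|_{\mathcal V}=A(\xi)$. A representation $(A^{(1)},\dots,A^{(k)},\sigma)$ of $E(\Lambda)$ on $\mathcal V$ consists of representations $(A^{(i)},\sigma)$ of $E_i$ with $\tilde A^{(i)}(I_{E_i}\otimes\tilde A^{(j)})=\tilde A^{(j)}(I_{E_j}\otimes\tilde A^{(i)})(t_{i,j}\otimes I_{\mathcal V})$ for all $i,j$; it is isometric (fully coisometric) if each $(A^{(i)},\sigma)$ is. $(S^{(1)},\dots,S^{(k)},\rho)$ on $\mathcal H\supseteq\mathcal V$ dilates it if each $(S^{(i)},\rho)$ dilates $(A^{(i)},\sigma)$; the dilation is minimal if $\mathcal H$ is the closed span of all vectors $Xv$, where $v\in\mathcal V$ and $X$ is a (possibly empty) finite product of operators of the form $S^{(i)}(\xi)$, $\xi\in E_i$. An isometric representation is finitely correlated if it is the minimal isometric dilation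 of a representation on a non-zero finite dimensional subspace. $\mathfrak S$ is the WOT-closure of the algebra generated by $I$, all $S^{(i)}(\xi_i)$ ($\xi_i\in E_i$) and all $\rho(a)$. A minimal cyclic coinvariant subspace for $\mathfrak S$ is a closed $\mathfrak S^*$-invariant subspace whose image under $\mathfrak S$ has closed span $\mathcal H$ and which has no proper $\mathfrak S^*$-invariant subspace with this property (for a finitely correlated, fully coisometric representation it exists and is unique). *)

theory Defs
  imports "HOL-Analysis.Analysis"
begin

section \<open>Complex Hilbert spaces\<close>

text \<open>Inner products are conjugate-linear in the first and linear in the second variable.\<close>

class complex_hilbert_space = banach +
  fixes cscale :: "complex \<Rightarrow> 'a \<Rightarrow> 'a" (infixr "*\<^sub>C" 75)
    and cinner :: "'a \<Rightarrow> 'a \<Rightarrow> complex"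
  assumes cscale_add_right: "a *\<^sub>C (x + y) = a *\<^sub>C x + a *\<^sub>C y"
    and cscale_add_left: "(a + b) *\<^sub>C x = a *\<^sub>C x + b *\<^sub>C x"
    and cscale_cscale: "a *\<^sub>C (b *\<^sub>C x) = (a * b) *\<^sub>C x"
    and cscale_of_real: "complex_of_real r *\<^sub>C x = r *\<^sub>R x"
    and cinner_commute: "cinner x y = cnj (cinner y x)"
    and cinner_add_right: "cinner x (y + z) = cinner x y + cinner x z"
    and cinner_cscale_right: "cinner x (a *\<^sub>C y) = a * cinner x y"
    and cinner_self: "cinner x x = complex_of_real ((norm x)\<^sup>2)"

global_interpretation complex_vector:
  vector_space "cscale :: complex \<Rightarrow> 'a \<Rightarrow> 'a::complex_hilbert_space"
proof
  fix x :: 'a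
  show "1 *\<^sub>C x = x"
    using cscale_of_real[of 1 x] by simp
qed (simp_all add: cscale_add_right cscale_add_left cscale_cscale)

definition closed_csubspace :: "'h::complex_hilbert_space set \<Rightarrow> bool" where
  "closed_csubspace V \<longleftrightarrow> complex_vector.subspace V \<and> closed V"

definition closed_cspan :: "'h::complex_hilbert_space set \<Rightarrow> 'h set" where
  "closed_cspan B = closure (complex_vector.span B)"

definition finite_dim :: "'h::complex_hilbert_space set \<Rightarrow> bool" where
  "finite_dim V \<longleftrightarrow> (\<exists>B. finite B \<and> V = complex_vector.span B)"

definition orth_compl :: "'h::complex_hilbert_space set \<Rightarrow> 'h set" where
  "orth_compl V = {x. \<forall>y\<in>V. cinner y x = 0}"

definition orth_proj :: "'h::complex_hilbert_space set \<Rightarrow> 'h \<Rightarrow> 'h" where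
  "orth_proj V x = (THE y. y \<in> V \<and> x - y \<in> orth_compl V)"

text \<open>An operator on a closed subspace \<open>V\<close> is represented by a function on the whole space of
  which only the values on \<open>V\<close> matter; equations between such operators are accordingly
  stated pointwise on \<open>V\<close>.\<close>

definition bounded_op_on :: "'h::complex_hilbert_space set \<Rightarrow> ('h \<Rightarrow> 'h) \<Rightarrow> bool" where
  "bounded_op_on V T \<longleftrightarrow>
     T ` V \<subseteq> V \<and>
     (\<forall>x\<in>V. \<forall>y\<in>V. T (x + y) = T x + T y) \<and>
     (\<forall>c. \<forall>x\<in>V. T (c *\<^sub>C x) = c *\<^sub>C T x) \<and>
     (\<exists>K. \<forall>x\<in>V. norm (T x) \<le> K * norm x)"

definition adj_on :: "'h::complex_hilbert_space set \<Rightarrow> ('h \<Rightarrow> 'h) \<Rightarrow> 'h \<Rightarrow> 'h" where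
  "adj_on V T y = (THE z. z \<in> V \<and> (\<forall>x\<in>V. cinner x z = cinner (T x) y))"

definition wot :: "('h::complex_hilbert_space \<Rightarrow> 'h) topology" where
  "wot = topology_generated_by
     {{T. bounded_op_on UNIV T \<and> cinner x (T y) \<in> U} |x y U. open U}"

inductive_set generated_algebra ::
  "('h::complex_hilbert_space \<Rightarrow> 'h) set \<Rightarrow> ('h \<Rightarrow> 'h) set" for X where
  gen: "T \<in> X \<Longrightarrow> T \<in> generated_algebra X"
| add: "\<lbrakk>S \<in> generated_algebra X; T \<in> generated_algebra X\<rbrakk>
    \<Longrightarrow> (\<lambda>x. S x + T x) \<in> generated_algebra X"
| scale: "T \<in> generated_algebra X \<Longrightarrow> (\<lambda>x. c *\<^sub>C T x) \<in> generated_algebra X"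
| comp: "\<lbrakk>S \<in> generated_algebra X; T \<in> generated_algebra X\<rbrakk>
    \<Longrightarrow> S \<circ> T \<in> generated_algebra X"

definition cyclic_coinvariant ::
  "('h::complex_hilbert_space \<Rightarrow> 'h) set \<Rightarrow> 'h set \<Rightarrow> bool" where
  "cyclic_coinvariant \<SS> M \<longleftrightarrow>
     closed_csubspace M \<and>
     (\<forall>T\<in>\<SS>. adj_on UNIV T ` M \<subseteq> M) \<and>
     closed_cspan {T x |T x. T \<in> \<SS> \<and> x \<in> M} = UNIV"

definition minimal_cyclic_coinvariant ::
  "('h::complex_hilbert_space \<Rightarrow> 'h) set \<Rightarrow> 'h set \<Rightarrow> bool" where
  "minimal_cyclic_coinvariant \<SS> M \<longleftrightarrow>
     cyclic_coinvariant \<SS> M \<and> (\<forall>N. N \<subset> M \<longrightarrow> \<not> cyclic_coinvariant \<SS> N)"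


section \<open>Directed graphs\<close>

text \<open>Paths are lists of edges in the order in which they are traversed, i.e. the path
  \<open>e\<^sub>k \<dots> e\<^sub>1\<close> is the list \<open>[e\<^sub>1, \<dots>, e\<^sub>k]\<close>.\<close>

fun gpath :: "'e set \<Rightarrow> ('e \<Rightarrow> 'v) \<Rightarrow> ('e \<Rightarrow> 'v) \<Rightarrow> 'v \<Rightarrow> 'e list \<Rightarrow> 'v \<Rightarrow> bool" where
  "gpath X s r u [] v \<longleftrightarrow> u = v"
| "gpath X s r u (e # es) v \<longleftrightarrow> e \<in> X \<and> s e = u \<and> gpath X s r (r e) es v"

definition gcycle :: "'e set \<Rightarrow> ('e \<Rightarrow> 'v) \<Rightarrow> ('e \<Rightarrow> 'v) \<Rightarrow> 'v \<Rightarrow> 'e list \<Rightarrow> bool" where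
  "gcycle X s r v c \<longleftrightarrow> c \<noteq> [] \<and> gpath X s r v c v"

text \<open>Minimal: no proper segment is again a cycle.\<close>

definition minimal_gcycle :: "'e set \<Rightarrow> ('e \<Rightarrow> 'v) \<Rightarrow> ('e \<Rightarrow> 'v) \<Rightarrow> 'v \<Rightarrow> 'e list \<Rightarrow> bool" where
  "minimal_gcycle X s r v c \<longleftrightarrow>
     gcycle X s r v c \<and>
     (\<forall>as bs cs w. c = as @ bs @ cs \<and> gcycle X s r w bs \<longrightarrow> as = [] \<and> cs = [])"

text \<open>The cycles are based at \<open>v\<close>, so the rotations of one cycle do not count as distinct.\<close>

definition on_double_cycle :: "'e set \<Rightarrow> ('e \<Rightarrow> 'v) \<Rightarrow> ('e \<Rightarrow> 'v) \<Rightarrow> 'v \<Rightarrow> bool" where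
  "on_double_cycle X s r v \<longleftrightarrow>
     (\<exists>c c'. c \<noteq> c' \<and> minimal_gcycle X s r v c \<and> minimal_gcycle X s r v c')"

definition strong_double_cycle_property ::
  "'v set \<Rightarrow> 'e set \<Rightarrow> ('e \<Rightarrow> 'v) \<Rightarrow> ('e \<Rightarrow> 'v) \<Rightarrow> bool" where
  "strong_double_cycle_property V X s r \<longleftrightarrow>
     (\<forall>u\<in>V. \<exists>v\<in>V. (\<exists>p. gpath X s r u p v) \<and> on_double_cycle X s r v)"


section \<open>Higher-rank graphs\<close>

text \<open>A small category is given by its morphisms alone, objects being identified with their
  identity morphisms; \<open>cmp G \<lambda> \<mu>\<close> is meaningful when \<open>src G \<lambda> = rng G \<mu>\<close>.  The rank \<open>k\<close> is the
  cardinality of the index type \<open>'k\<close>.\<close>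

record ('a, 'k) kgraph =
  mor :: "'a set"
  src :: "'a \<Rightarrow> 'a"
  rng :: "'a \<Rightarrow> 'a"
  cmp :: "'a \<Rightarrow> 'a \<Rightarrow> 'a"
  deg :: "'a \<Rightarrow> nat ^ 'k"

definition small_category :: "('a, 'k::finite) kgraph \<Rightarrow> bool" where
  "small_category G \<longleftrightarrow>
     (\<forall>x\<in>mor G. src G x \<in> mor G \<and> rng G x \<in> mor G \<and>
        src G (src G x) = src G x \<and> rng G (src G x) = src G x \<and>
        src G (rng G x) = rng G x \<and> rng G (rng G x) = rng G x \<and>
        cmp G x (src G x) = x \<and> cmp G (rng G x) x = x) \<and>
     (\<forall>x\<in>mor G. \<forall>y\<in>mor G. src G x = rng G y \<longrightarrow>
        cmp G x y \<in> mor G \<and> src G (cmp G x y) = src G y \<and> rng G (cmp G x y) = rng G x) \<and>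
     (\<forall>x\<in>mor G. \<forall>y\<in>mor G. \<forall>z\<in>mor G. src G x = rng G y \<and> src G y = rng G z \<longrightarrow>
        cmp G (cmp G x y) z = cmp G x (cmp G y z))"

definition is_kgraph :: "('a, 'k::finite) kgraph \<Rightarrow> bool" where
  "is_kgraph G \<longleftrightarrow>
     small_category G \<and> countable (mor G) \<and>
     (\<forall>x\<in>mor G. deg G (src G x) = 0 \<and> deg G (rng G x) = 0) \<and>
     (\<forall>x\<in>mor G. \<forall>y\<in>mor G. src G x = rng G y \<longrightarrow> deg G (cmp G x y) = deg G x + deg G y) \<and>
     (\<forall>x\<in>mor G. \<forall>m n. deg G x = m + n \<longrightarrow>
        (\<exists>!p. fst p \<in> mor G \<and> snd p \<in> mor G \<and> src G (fst p) = rng G (snd p) \<and>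
              x = cmp G (fst p) (snd p) \<and> deg G (fst p) = m \<and> deg G (snd p) = n))"

definition paths_of_degree :: "('a, 'k::finite) kgraph \<Rightarrow> nat ^ 'k \<Rightarrow> 'a set" where
  "paths_of_degree G n = {x \<in> mor G. deg G x = n}"

abbreviation vertices :: "('a, 'k::finite) kgraph \<Rightarrow> 'a set" where
  "vertices G \<equiv> paths_of_degree G 0"


section \<open>Correspondences\<close>

text \<open>\<open>C\<^sub>0\<close> of a discrete space; functions are extended by zero.\<close>

definition C0 :: "'v set \<Rightarrow> ('v \<Rightarrow> complex) set" where
  "C0 V = {f. (\<forall>v. v \<notin> V \<longrightarrow> f v = 0) \<and> (\<forall>\<epsilon>>0. finite {v \<in> V. \<epsilon> \<le> cmod (f v)})}"

definition sup_norm :: "('v \<Rightarrow> complex) \<Rightarrow> real" where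
  "sup_norm f = (SUP v. cmod (f v))"

text \<open>The data of a correspondence from an algebra of functions on \<open>'u\<close> to an algebra of functions
  on \<open>'w\<close>.\<close>

record ('u, 'w, 'f) corr =
  carr :: "'f set"
  cplus :: "'f \<Rightarrow> 'f \<Rightarrow> 'f"
  cmult :: "complex \<Rightarrow> 'f \<Rightarrow> 'f"
  inn :: "'f \<Rightarrow> 'f \<Rightarrow> ('w \<Rightarrow> complex)"
  lact :: "('u \<Rightarrow> complex) \<Rightarrow> 'f \<Rightarrow> 'f"
  ract :: "'f \<Rightarrow> ('w \<Rightarrow> complex) \<Rightarrow> 'f"

definition graph_corr ::
  "'v set \<Rightarrow> 'e set \<Rightarrow> ('e \<Rightarrow> 'v) \<Rightarrow> ('e \<Rightarrow> 'v) \<Rightarrow> ('v, 'v, 'e \<Rightarrow> complex) corr" where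
  "graph_corr V X s r = \<lparr>
     carr = {\<xi>. (\<forall>e. e \<notin> X \<longrightarrow> \<xi> e = 0) \<and>
               (\<forall>v\<in>V. (\<lambda>e. (cmod (\<xi> e))\<^sup>2) summable_on {e \<in> X. s e = v}) \<and>
               (\<lambda>v. if v \<in> V then complex_of_real (\<Sum>\<^sub>\<infinity>e\<in>{e \<in> X. s e = v}. (cmod (\<xi> e))\<^sup>2) else 0)
                 \<in> C0 V},
     cplus = (\<lambda>\<xi> \<eta> e. \<xi> e + \<eta> e),
     cmult = (\<lambda>c \<xi> e. c * \<xi> e),
     inn = (\<lambda>\<xi> \<eta> v. if v \<in> V then \<Sum>\<^sub>\<infinity>e\<in>{e \<in> X. s e = v}. cnj (\<xi> e) * \<eta> e else 0),
     lact = (\<lambda>a \<xi> e. a (r e) * \<xi> e),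
     ract = (\<lambda>\<xi> a e. \<xi> e * a (s e)) \<rparr>"

text \<open>A Hilbert space \<open>V\<close> with a representation \<open>\<sigma>\<close> is a correspondence to the complex numbers,
  i.e. to the functions on a one-point space.\<close>

definition hilbert_corr ::
  "'h::complex_hilbert_space set \<Rightarrow> (('u \<Rightarrow> complex) \<Rightarrow> 'h \<Rightarrow> 'h) \<Rightarrow> ('u, unit, 'h) corr" where
  "hilbert_corr V \<sigma> = \<lparr>
     carr = V,
     cplus = (+),
     cmult = (*\<^sub>C),
     inn = (\<lambda>h k _. cinner h k),
     lact = \<sigma>,
     ract = (\<lambda>h b. b () *\<^sub>C h) \<rparr>"


subsection \<open>Interior tensor products\<close>

text \<open>The list \<open>[(\<xi>\<^sub>1, g\<^sub>1), \<dots>, (\<xi>\<^sub>n, g\<^sub>n)]\<close> stands for the sum of the \<open>\<xi>\<^sub>i \<otimes> g\<^sub>i\<close> in the algebraic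
  tensor product.  Different lists may denote the same algebraic tensor, but their difference then
  has length zero, so they are identified in the Hausdorff completion, whose elements are
  the classes of Cauchy sequences of lists modulo null sequences.\<close>

definition alg_tensors :: "('u, 'v, 'f) corr \<Rightarrow> ('v, 'w, 'g) corr \<Rightarrow> ('f \<times> 'g) list set" where
  "alg_tensors F G = {z. set z \<subseteq> carr F \<times> carr G}"

definition alg_inn ::
  "('u, 'v, 'f) corr \<Rightarrow> ('v, 'w, 'g) corr \<Rightarrow> ('f \<times> 'g) list \<Rightarrow> ('f \<times> 'g) list \<Rightarrow> 'w \<Rightarrow> complex"
  where
  "alg_inn F G z w v =
     (\<Sum>(\<xi>, g)\<leftarrow>z. \<Sum>(\<eta>, k)\<leftarrow>w. inn G g (lact G (inn F \<xi> \<eta>) k) v)"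

definition alg_dist ::
  "('u, 'v, 'f) corr \<Rightarrow> ('v, 'w, 'g) corr \<Rightarrow> ('f \<times> 'g) list \<Rightarrow> ('f \<times> 'g) list \<Rightarrow> real" where
  "alg_dist F G z w =
     (let y = z @ map (map_prod (cmult F (-1)) id) w in sqrt (sup_norm (alg_inn F G y y)))"

type_synonym ('f, 'g) tensor = "(nat \<Rightarrow> ('f \<times> 'g) list) set"

definition tensor_cauchy ::
  "('u, 'v, 'f) corr \<Rightarrow> ('v, 'w, 'g) corr \<Rightarrow> (nat \<Rightarrow> ('f \<times> 'g) list) set" where
  "tensor_cauchy F G =
     {x. (\<forall>n. x n \<in> alg_tensors F G) \<and>
         (\<forall>\<epsilon>>0. \<exists>N. \<forall>m\<ge>N. \<forall>n\<ge>N. alg_dist F G (x m) (x n) < \<epsilon>)}"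

definition tensor_rel ::
  "('u, 'v, 'f) corr \<Rightarrow> ('v, 'w, 'g) corr \<Rightarrow>
   ((nat \<Rightarrow> ('f \<times> 'g) list) \<times> (nat \<Rightarrow> ('f \<times> 'g) list)) set" where
  "tensor_rel F G =
     {(x, y). x \<in> tensor_cauchy F G \<and> y \<in> tensor_cauchy F G \<and>
              (\<lambda>n. alg_dist F G (x n) (y n)) \<longlonglongrightarrow> 0}"

definition tensor_class ::
  "('u, 'v, 'f) corr \<Rightarrow> ('v, 'w, 'g) corr \<Rightarrow> (nat \<Rightarrow> ('f \<times> 'g) list) \<Rightarrow> ('f, 'g) tensor" where
  "tensor_class F G x = tensor_rel F G `` {x}"

definition tensor_seq :: "('f, 'g) tensor \<Rightarrow> nat \<Rightarrow> ('f \<times> 'g) list" where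
  "tensor_seq X = (SOME x. x \<in> X)"

definition elem_tensor ::
  "('u, 'v, 'f) corr \<Rightarrow> ('v, 'w, 'g) corr \<Rightarrow> 'f \<Rightarrow> 'g \<Rightarrow> ('f, 'g) tensor" where
  "elem_tensor F G \<xi> g = tensor_class F G (\<lambda>_. [(\<xi>, g)])"

text \<open>The map \<open>S \<otimes> T\<close> into the interior tensor product of \<open>F\<close> and \<open>G\<close>.\<close>

definition tensor_map ::
  "('u, 'v, 'f) corr \<Rightarrow> ('v, 'w, 'g) corr \<Rightarrow> ('f' \<Rightarrow> 'f) \<Rightarrow> ('g' \<Rightarrow> 'g) \<Rightarrow>
   ('f', 'g') tensor \<Rightarrow> ('f, 'g) tensor" where
  "tensor_map F G S T X = tensor_class F G (\<lambda>n. map (map_prod S T) (tensor_seq X n))"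

definition interior_tensor ::
  "('u, 'v, 'f) corr \<Rightarrow> ('v, 'w, 'g) corr \<Rightarrow> ('u, 'w, ('f, 'g) tensor) corr" where
  "interior_tensor F G = \<lparr>
     carr = tensor_cauchy F G // tensor_rel F G,
     cplus = (\<lambda>X Y. tensor_class F G (\<lambda>n. tensor_seq X n @ tensor_seq Y n)),
     cmult = (\<lambda>c. tensor_map F G (cmult F c) id),
     inn = (\<lambda>X Y v. lim (\<lambda>n. alg_inn F G (tensor_seq X n) (tensor_seq Y n) v)),
     lact = (\<lambda>a. tensor_map F G (lact F a) id),
     ract = (\<lambda>X b. tensor_map F G id (\<lambda>g. ract G g b) X) \<rparr>"

text \<open>The canonical identification of \<open>(F \<otimes> G) \<otimes> K\<close> with \<open>F \<otimes> (G \<otimes> K)\<close>, specified through inner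
  products with the total set of vectors \<open>\<xi> \<otimes> \<eta> \<otimes> h\<close>.\<close>

definition tensor_assoc ::
  "('t, 'u, 'f) corr \<Rightarrow> ('u, 'v, 'g) corr \<Rightarrow> ('v, 'w, 'h) corr \<Rightarrow>
   (('f, 'g) tensor, 'h) tensor \<Rightarrow> ('f, ('g, 'h) tensor) tensor" where
  "tensor_assoc F G K X =
     (THE Y. Y \<in> carr (interior_tensor F (interior_tensor G K)) \<and>
        (\<forall>\<xi>\<in>carr F. \<forall>\<eta>\<in>carr G. \<forall>h\<in>carr K.
           inn (interior_tensor F (interior_tensor G K))
             (elem_tensor F (interior_tensor G K) \<xi> (elem_tensor G K \<eta> h)) Y =
           inn (interior_tensor (interior_tensor F G) K)
             (elem_tensor (interior_tensor F G) K (elem_tensor F G \<xi> \<eta>) h) X))"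

definition corr_iso ::
  "'v set \<Rightarrow> ('v, 'v, 'f) corr \<Rightarrow> ('v, 'v, 'g) corr \<Rightarrow> ('f \<Rightarrow> 'g) \<Rightarrow> bool" where
  "corr_iso V F G t \<longleftrightarrow>
     bij_betw t (carr F) (carr G) \<and>
     (\<forall>\<xi>\<in>carr F. \<forall>\<eta>\<in>carr F. t (cplus F \<xi> \<eta>) = cplus G (t \<xi>) (t \<eta>)) \<and>
     (\<forall>c. \<forall>\<xi>\<in>carr F. t (cmult F c \<xi>) = cmult G c (t \<xi>)) \<and>
     (\<forall>\<xi>\<in>carr F. \<forall>\<eta>\<in>carr F. inn G (t \<xi>) (t \<eta>) = inn F \<xi> \<eta>) \<and>
     (\<forall>a\<in>C0 V. \<forall>\<xi>\<in>carr F. t (lact F a \<xi>) = lact G a (t \<xi>)) \<and>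
     (\<forall>a\<in>C0 V. \<forall>\<xi>\<in>carr F. t (ract F \<xi> a) = ract G (t \<xi>) a)"


subsection \<open>Representations of a correspondence\<close>

definition algebra_rep ::
  "'v set \<Rightarrow> 'h::complex_hilbert_space set \<Rightarrow> (('v \<Rightarrow> complex) \<Rightarrow> 'h \<Rightarrow> 'h) \<Rightarrow> bool" where
  "algebra_rep \<Omega> V \<sigma> \<longleftrightarrow>
     (\<forall>a\<in>C0 \<Omega>. bounded_op_on V (\<sigma> a)) \<and>
     (\<forall>a\<in>C0 \<Omega>. \<forall>b\<in>C0 \<Omega>. \<forall>h\<in>V. \<sigma> (\<lambda>v. a v + b v) h = \<sigma> a h + \<sigma> b h) \<and>
     (\<forall>c. \<forall>a\<in>C0 \<Omega>. \<forall>h\<in>V. \<sigma> (\<lambda>v. c * a v) h = c *\<^sub>C \<sigma> a h) \<and>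
     (\<forall>a\<in>C0 \<Omega>. \<forall>b\<in>C0 \<Omega>. \<forall>h\<in>V. \<sigma> (\<lambda>v. a v * b v) h = \<sigma> a (\<sigma> b h)) \<and>
     (\<forall>a\<in>C0 \<Omega>. \<forall>h\<in>V. \<sigma> (\<lambda>v. cnj (a v)) h = adj_on V (\<sigma> a) h) \<and>
     (\<forall>h\<in>V. \<sigma> (\<lambda>v. if v \<in> \<Omega> then 1 else 0) h = h)"

text \<open>Operator norm of a scalar matrix, and the matrix norms of the operator space structure of a
  correspondence: the square of the norm of \<open>(\<xi> i j)\<close> is the norm of the matrix over \<open>C0 V\<close>
  with entries \<open>\<Sum>l. \<langle>\<xi> l i, \<xi> l j\<rangle>\<close>.\<close>

definition matrix_norm :: "nat \<Rightarrow> (nat \<Rightarrow> nat \<Rightarrow> complex) \<Rightarrow> real" where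
  "matrix_norm n M =
     (SUP x\<in>{x. (\<Sum>j<n. (cmod (x j))\<^sup>2) \<le> 1}. sqrt (\<Sum>i<n. (cmod (\<Sum>j<n. M i j * x j))\<^sup>2))"

definition corr_matrix_norm ::
  "('u, 'w, 'f) corr \<Rightarrow> nat \<Rightarrow> (nat \<Rightarrow> nat \<Rightarrow> 'f) \<Rightarrow> real" where
  "corr_matrix_norm F n \<xi> =
     sqrt (SUP v. matrix_norm n (\<lambda>i j. \<Sum>l<n. inn F (\<xi> l i) (\<xi> l j) v))"

definition completely_contractive ::
  "('u, 'w, 'f) corr \<Rightarrow> 'h::complex_hilbert_space set \<Rightarrow> ('f \<Rightarrow> 'h \<Rightarrow> 'h) \<Rightarrow> bool" where
  "completely_contractive F V A \<longleftrightarrow>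
     (\<forall>n \<xi> h. (\<forall>i<n. \<forall>j<n. \<xi> i j \<in> carr F) \<and> (\<forall>j<n. h j \<in> V) \<longrightarrow>
        sqrt (\<Sum>i<n. (norm (\<Sum>j<n. A (\<xi> i j) (h j)))\<^sup>2)
          \<le> corr_matrix_norm F n \<xi> * sqrt (\<Sum>j<n. (norm (h j))\<^sup>2))"

definition corr_rep ::
  "'v set \<Rightarrow> ('v, 'v, 'f) corr \<Rightarrow> 'h::complex_hilbert_space set \<Rightarrow>
   ('f \<Rightarrow> 'h \<Rightarrow> 'h) \<Rightarrow> (('v \<Rightarrow> complex) \<Rightarrow> 'h \<Rightarrow> 'h) \<Rightarrow> bool" where
  "corr_rep \<Omega> F V A \<sigma> \<longleftrightarrow>
     algebra_rep \<Omega> V \<sigma> \<and>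
     (\<forall>\<xi>\<in>carr F. bounded_op_on V (A \<xi>)) \<and>
     (\<forall>\<xi>\<in>carr F. \<forall>\<eta>\<in>carr F. \<forall>h\<in>V. A (cplus F \<xi> \<eta>) h = A \<xi> h + A \<eta> h) \<and>
     (\<forall>c. \<forall>\<xi>\<in>carr F. \<forall>h\<in>V. A (cmult F c \<xi>) h = c *\<^sub>C A \<xi> h) \<and>
     completely_contractive F V A \<and>
     (\<forall>a\<in>C0 \<Omega>. \<forall>b\<in>C0 \<Omega>. \<forall>\<xi>\<in>carr F. \<forall>h\<in>V.
        A (lact F a (ract F \<xi> b)) h = \<sigma> a (A \<xi> (\<sigma> b h)))"

text \<open>The map \<open>\<xi> \<otimes> h \<mapsto> A \<xi> h\<close> on the completed tensor product, and its adjoint.\<close>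

definition tilde ::
  "('f \<Rightarrow> 'h \<Rightarrow> 'h) \<Rightarrow> ('f, 'h::complex_hilbert_space) tensor \<Rightarrow> 'h" where
  "tilde A X = lim (\<lambda>n. \<Sum>(\<xi>, h)\<leftarrow>tensor_seq X n. A \<xi> h)"

definition tilde_adj ::
  "('v, 'v, 'f) corr \<Rightarrow> 'h::complex_hilbert_space set \<Rightarrow> ('f \<Rightarrow> 'h \<Rightarrow> 'h) \<Rightarrow>
   (('v \<Rightarrow> complex) \<Rightarrow> 'h \<Rightarrow> 'h) \<Rightarrow> 'h \<Rightarrow> ('f, 'h) tensor" where
  "tilde_adj F V A \<sigma> h =
     (let K = interior_tensor F (hilbert_corr V \<sigma>) in
      THE X. X \<in> carr K \<and> (\<forall>Y\<in>carr K. inn K Y X () = cinner (tilde A Y) h))"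

definition isometric_corr_rep ::
  "('v, 'v, 'f) corr \<Rightarrow> 'h::complex_hilbert_space set \<Rightarrow> ('f \<Rightarrow> 'h \<Rightarrow> 'h) \<Rightarrow>
   (('v \<Rightarrow> complex) \<Rightarrow> 'h \<Rightarrow> 'h) \<Rightarrow> bool" where
  "isometric_corr_rep F V A \<sigma> \<longleftrightarrow>
     (\<forall>\<xi>\<in>carr F. \<forall>\<eta>\<in>carr F. \<forall>h\<in>V. adj_on V (A \<xi>) (A \<eta> h) = \<sigma> (inn F \<xi> \<eta>) h)"

definition fully_coisometric_corr_rep ::
  "('v, 'v, 'f) corr \<Rightarrow> 'h::complex_hilbert_space set \<Rightarrow> ('f \<Rightarrow> 'h \<Rightarrow> 'h) \<Rightarrow>
   (('v \<Rightarrow> complex) \<Rightarrow> 'h \<Rightarrow> 'h) \<Rightarrow> bool" where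
  "fully_coisometric_corr_rep F V A \<sigma> \<longleftrightarrow> (\<forall>h\<in>V. tilde A (tilde_adj F V A \<sigma> h) = h)"

definition corr_dilates ::
  "'v set \<Rightarrow> ('v, 'v, 'f) corr \<Rightarrow>
   ('f \<Rightarrow> 'h \<Rightarrow> 'h) \<Rightarrow> (('v \<Rightarrow> complex) \<Rightarrow> 'h \<Rightarrow> 'h) \<Rightarrow>
   'h::complex_hilbert_space set \<Rightarrow>
   ('f \<Rightarrow> 'h \<Rightarrow> 'h) \<Rightarrow> (('v \<Rightarrow> complex) \<Rightarrow> 'h \<Rightarrow> 'h) \<Rightarrow> bool" where
  "corr_dilates \<Omega> F S \<rho> V A \<sigma> \<longleftrightarrow>
     (\<forall>a\<in>C0 \<Omega>. \<rho> a ` V \<subseteq> V \<and> \<rho> a ` orth_compl V \<subseteq> orth_compl V \<and> (\<forall>h\<in>V. \<rho> a h = \<sigma> a h)) \<and>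
     (\<forall>\<xi>\<in>carr F. S \<xi> ` orth_compl V \<subseteq> orth_compl V \<and>
        (\<forall>h\<in>V. orth_proj V (S \<xi> h) = A \<xi> h))"


section \<open>The product system of a higher-rank graph and its representations\<close>

abbreviation fibre ::
  "('a, 'k::finite) kgraph \<Rightarrow> 'k \<Rightarrow> ('a, 'a, 'a \<Rightarrow> complex) corr" where
  "fibre G i \<equiv> graph_corr (vertices G) (paths_of_degree G (axis i 1)) (src G) (rng G)"

definition delta :: "'e \<Rightarrow> 'e \<Rightarrow> complex" where
  "delta x = (\<lambda>y. if y = x then 1 else 0)"

type_synonym 'a fibre_tensor = "('a \<Rightarrow> complex, 'a \<Rightarrow> complex) tensor"

text \<open>The isomorphisms \<open>t i j\<close> of the product system; they are uniquely determined on the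
  interior tensor products, which are the closed spans of the \<open>\<delta> \<lambda> \<otimes> \<delta> \<mu>\<close>.\<close>

definition product_system_isos ::
  "('a, 'k::finite) kgraph \<Rightarrow> ('k \<Rightarrow> 'k \<Rightarrow> 'a fibre_tensor \<Rightarrow> 'a fibre_tensor) \<Rightarrow> bool" where
  "product_system_isos G t \<longleftrightarrow>
     (\<forall>i j.
        corr_iso (vertices G) (interior_tensor (fibre G i) (fibre G j))
          (interior_tensor (fibre G j) (fibre G i)) (t i j) \<and>
        (\<forall>x\<in>paths_of_degree G (axis i 1). \<forall>x'\<in>paths_of_degree G (axis i 1).
         \<forall>y\<in>paths_of_degree G (axis j 1). \<forall>y'\<in>paths_of_degree G (axis j 1).
           src G x = rng G y \<and> src G y' = rng G x' \<and> cmp G x y = cmp G y' x' \<longrightarrow>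
           t i j (elem_tensor (fibre G i) (fibre G j) (delta x) (delta y)) =
             elem_tensor (fibre G j) (fibre G i) (delta y') (delta x'))) \<and>
     (\<forall>i. \<forall>X\<in>carr (interior_tensor (fibre G i) (fibre G i)). t i i X = X)"

text \<open>The map \<open>\<xi> \<otimes> \<eta> \<otimes> h \<mapsto> A \<xi> (B \<eta> h)\<close>, i.e. \<open>tilde A \<circ> (I \<otimes> tilde B)\<close>, on \<open>(F \<otimes> G) \<otimes> V\<close>.\<close>

definition tilde2 ::
  "('v, 'v, 'f) corr \<Rightarrow> ('v, 'v, 'g) corr \<Rightarrow> 'h::complex_hilbert_space set \<Rightarrow>
   (('v \<Rightarrow> complex) \<Rightarrow> 'h \<Rightarrow> 'h) \<Rightarrow> ('f \<Rightarrow> 'h \<Rightarrow> 'h) \<Rightarrow> ('g \<Rightarrow> 'h \<Rightarrow> 'h) \<Rightarrow>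
   (('f, 'g) tensor, 'h) tensor \<Rightarrow> 'h" where
  "tilde2 F G V \<sigma> A B X =
     tilde A (tensor_map F (hilbert_corr V \<sigma>) id (tilde B)
       (tensor_assoc F G (hilbert_corr V \<sigma>) X))"

definition system_rep ::
  "('a, 'k::finite) kgraph \<Rightarrow> ('k \<Rightarrow> 'k \<Rightarrow> 'a fibre_tensor \<Rightarrow> 'a fibre_tensor) \<Rightarrow>
   'h::complex_hilbert_space set \<Rightarrow>
   ('k \<Rightarrow> ('a \<Rightarrow> complex) \<Rightarrow> 'h \<Rightarrow> 'h) \<Rightarrow> (('a \<Rightarrow> complex) \<Rightarrow> 'h \<Rightarrow> 'h) \<Rightarrow> bool" where
  "system_rep G t V A \<sigma> \<longleftrightarrow>
     (\<forall>i. corr_rep (vertices G) (fibre G i) V (A i) \<sigma>) \<and>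
     (\<forall>i j. \<forall>X\<in>carr (interior_tensor (interior_tensor (fibre G i) (fibre G j)) (hilbert_corr V \<sigma>)).
        tilde2 (fibre G i) (fibre G j) V \<sigma> (A i) (A j) X =
        tilde2 (fibre G j) (fibre G i) V \<sigma> (A j) (A i)
          (tensor_map (interior_tensor (fibre G j) (fibre G i)) (hilbert_corr V \<sigma>) (t i j) id X))"

definition isometric_rep ::
  "('a, 'k::finite) kgraph \<Rightarrow> 'h::complex_hilbert_space set \<Rightarrow>
   ('k \<Rightarrow> ('a \<Rightarrow> complex) \<Rightarrow> 'h \<Rightarrow> 'h) \<Rightarrow> (('a \<Rightarrow> complex) \<Rightarrow> 'h \<Rightarrow> 'h) \<Rightarrow> bool" where
  "isometric_rep G V A \<sigma> \<longleftrightarrow> (\<forall>i. isometric_corr_rep (fibre G i) V (A i) \<sigma>)"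

definition fully_coisometric_rep ::
  "('a, 'k::finite) kgraph \<Rightarrow> 'h::complex_hilbert_space set \<Rightarrow>
   ('k \<Rightarrow> ('a \<Rightarrow> complex) \<Rightarrow> 'h \<Rightarrow> 'h) \<Rightarrow> (('a \<Rightarrow> complex) \<Rightarrow> 'h \<Rightarrow> 'h) \<Rightarrow> bool" where
  "fully_coisometric_rep G V A \<sigma> \<longleftrightarrow> (\<forall>i. fully_coisometric_corr_rep (fibre G i) V (A i) \<sigma>)"

definition system_dilates ::
  "('a, 'k::finite) kgraph \<Rightarrow>
   ('k \<Rightarrow> ('a \<Rightarrow> complex) \<Rightarrow> 'h \<Rightarrow> 'h) \<Rightarrow> (('a \<Rightarrow> complex) \<Rightarrow> 'h \<Rightarrow> 'h) \<Rightarrow>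
   'h::complex_hilbert_space set \<Rightarrow>
   ('k \<Rightarrow> ('a \<Rightarrow> complex) \<Rightarrow> 'h \<Rightarrow> 'h) \<Rightarrow> (('a \<Rightarrow> complex) \<Rightarrow> 'h \<Rightarrow> 'h) \<Rightarrow> bool" where
  "system_dilates G S \<rho> V A \<sigma> \<longleftrightarrow>
     (\<forall>i. corr_dilates (vertices G) (fibre G i) (S i) \<rho> V (A i) \<sigma>)"

definition minimal_dilation_space ::
  "('a, 'k::finite) kgraph \<Rightarrow> ('k \<Rightarrow> ('a \<Rightarrow> complex) \<Rightarrow> 'h \<Rightarrow> 'h) \<Rightarrow>
   'h::complex_hilbert_space set \<Rightarrow> bool" where
  "minimal_dilation_space G S V \<longleftrightarrow>
     closed_cspan {foldr (\<circ>) Xs id v |Xs v.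
       set Xs \<subseteq> {S i \<xi> |i \<xi>. \<xi> \<in> carr (fibre G i)} \<and> v \<in> V} = UNIV"

definition finitely_correlated ::
  "('a, 'k::finite) kgraph \<Rightarrow> ('k \<Rightarrow> 'k \<Rightarrow> 'a fibre_tensor \<Rightarrow> 'a fibre_tensor) \<Rightarrow>
   ('k \<Rightarrow> ('a \<Rightarrow> complex) \<Rightarrow> 'h::complex_hilbert_space \<Rightarrow> 'h) \<Rightarrow>
   (('a \<Rightarrow> complex) \<Rightarrow> 'h \<Rightarrow> 'h) \<Rightarrow> bool" where
  "finitely_correlated G t S \<rho> \<longleftrightarrow>
     (\<exists>V A \<sigma>. finite_dim V \<and> V \<noteq> {0} \<and> system_rep G t V A \<sigma> \<and>
        system_dilates G S \<rho> V A \<sigma> \<and> minimal_dilation_space G S V)"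

definition rep_wot_algebra ::
  "('a, 'k::finite) kgraph \<Rightarrow> ('k \<Rightarrow> ('a \<Rightarrow> complex) \<Rightarrow> 'h \<Rightarrow> 'h) \<Rightarrow>
   (('a \<Rightarrow> complex) \<Rightarrow> 'h::complex_hilbert_space \<Rightarrow> 'h) \<Rightarrow> ('h \<Rightarrow> 'h) set" where
  "rep_wot_algebra G S \<rho> =
     wot closure_of generated_algebra
       ({id} \<union> {S i \<xi> |i \<xi>. \<xi> \<in> carr (fibre G i)} \<union> {\<rho> a |a. a \<in> C0 (vertices G)})"

end

theory Submission
  imports Defs
begin

text \<open>
  Write \<open>S\<^sub>e\<close> for the operator of an edge \<open>e\<close> of degree \<open>e\<^sub>i\<close> (an edge of colour \<open>i\<close>) and \<open>P\<^sub>v\<close> for the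
  projection of a vertex \<open>v\<close>.  Isometry says that \<open>S\<^sub>e\<^sup>* S\<^sub>e = P\<^bsub>s(e)\<^esub>\<close> and that edges of one colour have
  orthogonal ranges, full coisometry says that these ranges span \<open>H\<close>, and the isomorphisms \<open>t\<^sub>i\<^sub>j\<close> say
  that \<open>S\<^sub>e S\<^sub>f = S\<^bsub>f'\<^esub> S\<^bsub>e'\<^esub>\<close> whenever \<open>e f = f' e'\<close>.  The argument is carried out from these relations
  (locale \<open>edge_system\<close>), which pass from \<open>H\<close> to every direct sum of copies of \<open>H\<close>.

  A closed subspace is coinvariant if all \<open>S\<^sub>e\<^sup>*\<close> and \<open>P\<^sub>v\<close> map it into itself, and the orbit span of \<open>M\<close>
  is the closed span of all products of the \<open>S\<^sub>e\<close> applied to \<open>M\<close>.  The heart of the matter is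
  \<open>coinvariant_subset_orbit_span_Int\<close>: if \<open>M\<close> is finite-dimensional and coinvariant, then every
  coinvariant \<open>L\<close> inside the orbit span of \<open>M\<close> lies in the orbit span of \<open>L \<inter> M\<close>.  Indeed, a vector \<open>y\<close>
  of \<open>L\<close> is close to a finite combination \<open>w\<close> of vectors \<open>S\<^bsub>e\<^esub> \<cdots> S\<^bsub>f\<^esub> m\<close>.  Stripping sufficiently many
  edges of suitable colours off \<open>w\<close> by adjoints leads into \<open>M\<close>, while the same operation keeps \<open>y\<close>
  inside \<open>L\<close>.  As \<open>y = \<Sum>\<^sub>e S\<^sub>e S\<^sub>e\<^sup>* y\<close> with orthogonal summands for each colour, \<open>y\<close> is reassembled from
  vectors of \<open>L\<close> which are near \<open>M\<close> in the square mean, and since \<open>M\<close> is finite-dimensional, vectors of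
  \<open>L\<close> near \<open>M\<close> are near \<open>L \<inter> M\<close>.

  It follows that the intersection of a finite-dimensional cyclic coinvariant subspace with any cyclic
  coinvariant subspace is again cyclic.  Hence a finite-dimensional cyclic coinvariant subspace \<open>M\<close> of
  least dimension is contained in all cyclic coinvariant subspaces, and it is the one and only minimal
  one.

  The projection onto \<open>M\<close> lies in the algebra as soon as, for all tuples \<open>x\<close> in \<open>H\<^sup>n\<close>, the tuple
  \<open>P\<^sub>M x\<close> is a limit of tuples \<open>T x\<close> with \<open>T\<close> in the generated algebra.  The orthogonal complement of
  these limits is a coinvariant subspace of \<open>H\<^sup>n\<close>, so it suffices that the projection onto \<open>M\<^sup>n\<close> maps each
  coinvariant \<open>L \<subseteq> H\<^sup>n\<close> into itself (\<open>orth_proj_slices_coinvariant\<close>).  Put \<open>N = L \<inter> M\<^sup>n\<close>, and let \<open>K\<close> be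
  its orbit span, a reducing subspace which contains \<open>L\<close>.  Then \<open>N + (1 - P\<^sub>K) M\<^sup>n\<close> is finite-dimensional
  and coinvariant, and its orbit span is \<open>H\<^sup>n\<close>; since \<open>M\<close> is least, it contains \<open>M\<^sup>n\<close>, which means that
  \<open>P\<^sub>K\<close> maps \<open>M\<^sup>n\<close> into \<open>N\<close>.  So for \<open>y \<in> L\<close> the vector \<open>z\<close> which \<open>y\<close> projects to in \<open>M\<^sup>n\<close> differs from
  \<open>P\<^sub>K z \<in> N\<close> by a vector of \<open>M\<^sup>n\<close> orthogonal to \<open>K\<close>, hence to \<open>y\<close> and thus to \<open>z\<close> and \<open>P\<^sub>K z\<close>; so
  \<open>z = P\<^sub>K z \<in> N \<subseteq> L\<close>.

  The relations between the \<open>S\<^sub>e\<close> have to be extracted from identities between maps on completed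
  interior tensor products.  Isometry helps once more: \<open>\<xi> \<otimes> h \<mapsto> S(\<xi>) h\<close> embeds the tensor product
  isometrically into \<open>H\<close>, and similarly for threefold products, so that each tensor may be replaced by
  the vector which it represents (locale \<open>tensor_realisation\<close>).
\<close>

section \<open>Complex inner products\<close>

lemma cinner_add_left: "cinner (x + y) z = cinner x z + cinner (y::'h::complex_hilbert_space) z"
  by (metis cinner_add_right cinner_commute complex_cnj_add)

lemma cinner_cscale_left: "cinner (a *\<^sub>C x) y = cnj a * cinner x (y::'h::complex_hilbert_space)"
  by (metis cinner_cscale_right cinner_commute complex_cnj_mult)

lemma scaleR_cscale: "r *\<^sub>R x = complex_of_real r *\<^sub>C (x::'h::complex_hilbert_space)"
  by (simp add: cscale_of_real)

lemma cinner_zero [simp]: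
  "cinner 0 x = 0" "cinner x 0 = 0" for x :: "'h::complex_hilbert_space"
  using cinner_add_left[of 0 0 x] cinner_add_right[of x 0 0] by auto

lemma cinner_minus [simp]:
  "cinner (- x) y = - cinner x y" "cinner x (- y) = - cinner x y" for x :: "'h::complex_hilbert_space"
  using cinner_add_left[of x "-x" y] cinner_add_right[of x y "-y"]
  by (simp_all add: eq_neg_iff_add_eq_0 add.commute)

lemma cinner_diff:
  "cinner (x - y) z = cinner x z - cinner y z" "cinner x (y - z) = cinner x y - cinner x z"
  for x :: "'h::complex_hilbert_space"
  using cinner_add_left[of x "-y" z] cinner_add_right[of x y "-z"] by simp_all

lemma cinner_sum_right: "cinner x (\<Sum>i\<in>I. f i) = (\<Sum>i\<in>I. cinner x (f i :: 'h::complex_hilbert_space))"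
  by (induction I rule: infinite_finite_induct) (auto simp: cinner_add_right)

lemma cinner_self_eq_0_iff [simp]: "cinner x x = 0 \<longleftrightarrow> x = (0::'h::complex_hilbert_space)"
  by (simp add: cinner_self)

lemma norm_sq_cinner: "(norm x)\<^sup>2 = Re (cinner x (x::'h::complex_hilbert_space))"
  by (simp add: cinner_self)

lemma norm_cscale [simp]: "norm (c *\<^sub>C x) = cmod c * norm (x::'h::complex_hilbert_space)"
proof -
  have "complex_of_real ((norm (c *\<^sub>C x))\<^sup>2) = cnj c * c * complex_of_real ((norm x)\<^sup>2)"
    by (simp only: cinner_self[symmetric] cinner_cscale_left cinner_cscale_right mult.assoc mult.left_commute)
  also have "\<dots> = complex_of_real ((cmod c * norm x)\<^sup>2)"
    by (simp add: power_mult_distrib complex_norm_square mult.commute flip: of_real_power)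
  finally have "(norm (c *\<^sub>C x))\<^sup>2 = (cmod c * norm x)\<^sup>2"
    using of_real_eq_iff by blast
  thus ?thesis by (simp add: power2_eq_iff_nonneg)
qed

lemma norm_add_sq:
  "(norm (x + y))\<^sup>2 = (norm x)\<^sup>2 + (norm y)\<^sup>2 + 2 * Re (cinner x (y::'h::complex_hilbert_space))"
proof -
  have "Re (cinner y x) = Re (cinner x y)" by (subst cinner_commute) simp
  thus ?thesis by (simp add: norm_sq_cinner cinner_add_left cinner_add_right)
qed

lemma norm_diff_sq:
  "(norm (x - y))\<^sup>2 = (norm x)\<^sup>2 + (norm y)\<^sup>2 - 2 * Re (cinner x (y::'h::complex_hilbert_space))"
  using norm_add_sq[of x "-y"] by simp

lemma cinner_cauchy_schwarz: "cmod (cinner x y) \<le> norm x * norm (y::'h::complex_hilbert_space)"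
proof (cases "y = 0")
  case False
  define n where "n = (norm y)\<^sup>2"
  have n: "n > 0" using False by (simp add: n_def)
  define t where "t = cinner y x / complex_of_real n"
  have "cinner x (t *\<^sub>C y) = complex_of_real ((cmod (cinner x y))\<^sup>2 / n)"
    using cinner_commute[of y x] unfolding t_def cinner_cscale_right
    by (simp add: complex_norm_square mult.commute del: of_real_power)
  hence "(norm (x - t *\<^sub>C y))\<^sup>2 = (norm x)\<^sup>2 + (cmod t)\<^sup>2 * n - 2 * ((cmod (cinner x y))\<^sup>2 / n)"
    by (simp add: norm_diff_sq power_mult_distrib n_def)
  also have "(cmod t)\<^sup>2 * n = (cmod (cinner x y))\<^sup>2 / n"
    using n cinner_commute[of y x] by (simp add: t_def norm_divide power_divide power2_eq_square)
  finally have "(cmod (cinner x y))\<^sup>2 / n \<le> (norm x)\<^sup>2" by (smt (verit) zero_le_power2)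
  hence "(cmod (cinner x y))\<^sup>2 \<le> (norm x * norm y)\<^sup>2"
    using n by (simp add: divide_simps n_def power_mult_distrib)
  thus ?thesis by (rule power2_le_imp_le) simp
qed simp

text \<open>Applied with \<open>y\<close> the image of \<open>x\<close> under a self-adjoint idempotent, which is therefore a
  contraction.\<close>
lemma norm_le_if_cinner_eq:
  assumes "cinner y y = cinner x (y::'h::complex_hilbert_space)" shows "norm y \<le> norm x"
proof (cases "y = 0")
  case False
  have "complex_of_real ((norm y)\<^sup>2) = cinner x y" using assms by (simp only: cinner_self)
  hence "cmod (complex_of_real ((norm y)\<^sup>2)) \<le> norm x * norm y" by (simp only: cinner_cauchy_schwarz)
  thus ?thesis using False by (simp add: norm_mult power2_eq_square)
qed simp

lemma bounded_bilinear_cinner: "bounded_bilinear (cinner :: 'h::complex_hilbert_space \<Rightarrow> 'h \<Rightarrow> complex)"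
  by standard (auto simp: cinner_add_left cinner_add_right scaleR_cscale cinner_cscale_left
      cinner_cscale_right scaleR_conv_of_real intro!: exI[of _ 1] cinner_cauchy_schwarz)

lemma bounded_bilinear_cscale: "bounded_bilinear (cscale :: complex \<Rightarrow> 'h::complex_hilbert_space \<Rightarrow> 'h)"
  by standard (auto simp: cscale_add_left cscale_add_right scaleR_cscale cscale_cscale
      scaleR_conv_of_real mult.commute intro!: exI[of _ 1])

lemmas tendsto_cinner = bounded_bilinear.tendsto[OF bounded_bilinear_cinner]
lemmas tendsto_cscale = bounded_bilinear.tendsto[OF bounded_bilinear_cscale]
lemmas continuous_on_cinner = bounded_bilinear.continuous_on[OF bounded_bilinear_cinner]

lemma cinner_ext: "(\<And>x. cinner x y = cinner x z) \<Longrightarrow> y = (z::'h::complex_hilbert_space)"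
  by (metis cinner_diff(2) cinner_self_eq_0_iff eq_iff_diff_eq_0)


section \<open>Closed subspaces\<close>

abbreviation bop :: "('h::complex_hilbert_space \<Rightarrow> 'h) \<Rightarrow> bool" where
  "bop \<equiv> bounded_op_on UNIV"

lemma bop_add: "bop T \<Longrightarrow> T (x + y) = T x + T y"
  and bop_cscale: "bop T \<Longrightarrow> T (c *\<^sub>C x) = c *\<^sub>C T x"
  by (auto simp: bounded_op_on_def)

lemma bop_bounded_linear: "bop T \<Longrightarrow> bounded_linear T"
proof -
  assume T: "bop T"
  then obtain K where "\<forall>x. norm (T x) \<le> K * norm x" by (auto simp: bounded_op_on_def)
  with T show "bounded_linear T"
    by (intro bounded_linear_intro[of T K]) (auto simp: bop_add bop_cscale scaleR_cscale mult.commute)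
qed

lemma bop_linear: "bop T \<Longrightarrow> linear T"
  by (rule bounded_linear.linear[OF bop_bounded_linear])

lemmas bop_zero = linear_0[OF bop_linear]
  and bop_diff = linear_diff[OF bop_linear]

lemma bopI:
  assumes "\<And>x y. T (x + y) = T x + T y" "\<And>c x. T (c *\<^sub>C x) = c *\<^sub>C T x" "\<And>x. norm (T x) \<le> K * norm x"
  shows "bop T"
  using assms by (auto simp: bounded_op_on_def)

lemma bop_bound: "bop T \<Longrightarrow> \<exists>K\<ge>0. \<forall>x. norm (T x) \<le> K * norm x"
  using bounded_linear.nonneg_bounded[OF bop_bounded_linear] by (metis mult.commute)

lemma closed_csubspaceD:
  assumes "closed_csubspace V"
  shows "complex_vector.subspace V" "closed V" "0 \<in> V"
    "\<And>x y. x \<in> V \<Longrightarrow> y \<in> V \<Longrightarrow> x + y \<in> V" "\<And>x y. x \<in> V \<Longrightarrow> y \<in> V \<Longrightarrow> x - y \<in> V"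
    "\<And>c x. x \<in> V \<Longrightarrow> c *\<^sub>C x \<in> V"
  using assms complex_vector.subspace_0 complex_vector.subspace_add complex_vector.subspace_diff
    complex_vector.subspace_scale by (auto simp: closed_csubspace_def)

lemma closure_subspace:
  assumes "complex_vector.subspace (V :: 'h::complex_hilbert_space set)"
  shows "complex_vector.subspace (closure V)"
proof (rule complex_vector.subspaceI)
  show "0 \<in> closure V" using complex_vector.subspace_0[OF assms] closure_subset by blast
next
  fix x y assume "x \<in> closure V" "y \<in> closure V"
  then obtain f g where "\<And>n. f n \<in> V" "f \<longlonglongrightarrow> x" "\<And>n. g n \<in> V" "g \<longlonglongrightarrow> y"
    by (meson closure_sequential)
  hence "(\<lambda>n. f n + g n) \<longlonglongrightarrow> x + y" "\<And>n. f n + g n \<in> V"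
    using complex_vector.subspace_add[OF assms] by (auto intro: tendsto_add)
  thus "x + y \<in> closure V" by (meson closure_sequential)
next
  fix c x assume "x \<in> closure V"
  then obtain f where "\<And>n. f n \<in> V" "f \<longlonglongrightarrow> x" by (meson closure_sequential)
  hence "(\<lambda>n. c *\<^sub>C f n) \<longlonglongrightarrow> c *\<^sub>C x" "\<And>n. c *\<^sub>C f n \<in> V"
    using complex_vector.subspace_scale[OF assms] by (auto intro: tendsto_cscale)
  thus "c *\<^sub>C x \<in> closure V" by (meson closure_sequential)
qed

lemma closed_cspan_closed_csubspace: "closed_csubspace (closed_cspan B)"
  by (simp add: closed_cspan_def closed_csubspace_def closure_subspace complex_vector.subspace_span)

lemma closed_cspan_superset: "B \<subseteq> closed_cspan B"
  unfolding closed_cspan_def using closure_subset complex_vector.span_superset by blast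

lemma closed_cspan_minimal: "closed_csubspace V \<Longrightarrow> B \<subseteq> V \<Longrightarrow> closed_cspan B \<subseteq> V"
  unfolding closed_cspan_def closed_csubspace_def
  by (intro closure_minimal complex_vector.span_minimal) auto

lemma closed_csubspace_Int:
  "closed_csubspace V \<Longrightarrow> closed_csubspace W \<Longrightarrow> closed_csubspace (V \<inter> W)"
  by (auto simp: closed_csubspace_def complex_vector.subspace_inter)

lemma closed_csubspace_vimage:
  assumes "bounded_linear f" "\<And>c x. f (c *\<^sub>C x) = c *\<^sub>C f x" "closed_csubspace V"
  shows "closed_csubspace {x. f x \<in> V}"
proof -
  have "closed (f -` V)"
    using assms by (intro closed_vimage) (auto simp: closed_csubspace_def linear_continuous_on)
  moreover have "linear f" using assms(1) by (rule bounded_linear.linear)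
  ultimately show ?thesis
    using assms closed_csubspaceD[OF assms(3)]
    by (auto simp: closed_csubspace_def vimage_def linear_0 linear_add intro!: complex_vector.subspaceI)
qed

lemma closed_csubspace_vimage_bop:
  "bop T \<Longrightarrow> closed_csubspace V \<Longrightarrow> closed_csubspace {x. T x \<in> V}"
  by (rule closed_csubspace_vimage) (auto simp: bop_bounded_linear bop_cscale)

lemma bop_image_closed_cspan:
  assumes "bop T" "closed_csubspace V" "\<And>x. x \<in> B \<Longrightarrow> T x \<in> V" "x \<in> closed_cspan B"
  shows "T x \<in> V"
  using closed_cspan_minimal[OF closed_csubspace_vimage_bop[OF assms(1,2)], of B] assms(3,4) by auto

lemma orth_compl_closed_csubspace: "closed_csubspace (orth_compl V)"
proof -
  have "orth_compl V = (\<Inter>y\<in>V. {x. cinner y x = 0})" by (auto simp: orth_compl_def)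
  moreover have "closed {x. cinner y x = 0}" for y :: 'a
    by (intro closed_Collect_eq continuous_on_cinner continuous_intros)
  ultimately have "closed (orth_compl V)" by auto
  thus ?thesis
    by (auto simp: closed_csubspace_def orth_compl_def cinner_add_right cinner_cscale_right
        intro!: complex_vector.subspaceI)
qed


section \<open>Orthogonal projections and adjoints\<close>

text \<open>A minimising sequence for the distance from \<open>x\<close> is Cauchy by the parallelogram law.  Moving its
  limit \<open>y\<close> in the direction of a vector \<open>w\<close> of \<open>V\<close> cannot decrease the distance, which makes \<open>x - y\<close>
  orthogonal to \<open>w\<close>.\<close>
lemma orth_proj_exists:
  fixes V :: "'h::complex_hilbert_space set"
  assumes V: "closed_csubspace V"
  shows "\<exists>y\<in>V. x - y \<in> orth_compl V"
proof -
  define d where "d = infdist x V"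
  have ne: "V \<noteq> {}" using closed_csubspaceD(3)[OF V] by auto
  have d_le: "d \<le> norm (x - v)" if "v \<in> V" for v
    using infdist_le[OF that, of x] by (simp add: d_def dist_norm)
  have d0: "d \<ge> 0" by (simp add: d_def infdist_nonneg)
  have "\<exists>v\<in>V. norm (x - v) < d + inverse (Suc n)" for n
  proof -
    have "(INF v\<in>V. dist x v) < d + inverse (Suc n)"
      using ne by (simp add: d_def infdist_def)
    thus ?thesis using ne
      by (subst (asm) cINF_less_iff) (auto simp: dist_norm intro!: bdd_belowI2[where m = 0])
  qed
  then obtain v where v: "\<And>n. v n \<in> V" "\<And>n. norm (x - v n) < d + inverse (Suc n)" by metis
  have par: "(norm (v m - v n))\<^sup>2 \<le> 2 * (norm (x - v m))\<^sup>2 + 2 * (norm (x - v n))\<^sup>2 - 4 * d\<^sup>2" for m n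
  proof -
    let ?a = "x - v m" and ?b = "x - v n"
    have 1: "(norm (?b - ?a))\<^sup>2 + (norm (?b + ?a))\<^sup>2 = 2 * (norm ?a)\<^sup>2 + 2 * (norm ?b)\<^sup>2"
      using norm_add_sq[of ?b ?a] norm_diff_sq[of ?b ?a] by linarith
    have "?b + ?a = 2 *\<^sub>R (x - (1/2) *\<^sub>R (v m + v n))" by (simp add: algebra_simps scaleR_2)
    hence 2: "norm (?b + ?a) = 2 * norm (x - (1/2) *\<^sub>R (v m + v n))" by simp
    have "(1/2) *\<^sub>R (v m + v n) \<in> V"
      unfolding scaleR_cscale using v(1) closed_csubspaceD[OF V] by blast
    hence "d \<le> norm (x - (1/2) *\<^sub>R (v m + v n))" by (rule d_le)
    hence "4 * d\<^sup>2 \<le> (norm (?b + ?a))\<^sup>2" using d0 by (simp add: 2 power_mult_distrib power_mono)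
    thus ?thesis using 1 by (simp add: algebra_simps)
  qed
  have lim: "(\<lambda>n. norm (x - v n)) \<longlonglongrightarrow> d"
  proof (rule tendsto_sandwich[of "\<lambda>_. d" _ _ "\<lambda>n. d + inverse (Suc n)"])
    show "(\<lambda>n. d + inverse (real (Suc n))) \<longlonglongrightarrow> d"
      using tendsto_add[OF tendsto_const LIMSEQ_inverse_real_of_nat, of d] by simp
  next
    show "\<forall>\<^sub>F n in sequentially. norm (x - v n) \<le> d + inverse (real (Suc n))"
      by (intro always_eventually allI less_imp_le v(2))
  qed (use v(1) d_le in auto)
  have "Cauchy v"
  proof (rule metric_CauchyI)
    fix e :: real assume e: "e > 0"
    have "(\<lambda>n. 2 * (norm (x - v n))\<^sup>2 - 2 * d\<^sup>2) \<longlonglongrightarrow> 2 * d\<^sup>2 - 2 * d\<^sup>2"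
      by (intro tendsto_intros lim)
    hence "\<forall>\<^sub>F n in sequentially. 2 * (norm (x - v n))\<^sup>2 - 2 * d\<^sup>2 < e\<^sup>2 / 2"
      by (rule order_tendstoD) (use e in auto)
    then obtain N where N: "\<And>n. n \<ge> N \<Longrightarrow> 2 * (norm (x - v n))\<^sup>2 - 2 * d\<^sup>2 < e\<^sup>2 / 2"
      by (auto simp: eventually_sequentially)
    show "\<exists>M. \<forall>m\<ge>M. \<forall>n\<ge>M. dist (v m) (v n) < e"
    proof (intro exI[of _ N] allI impI)
      fix m n assume "m \<ge> N" "n \<ge> N"
      hence "(norm (v m - v n))\<^sup>2 < e\<^sup>2" using N[of m] N[of n] par[of m n] by linarith
      thus "dist (v m) (v n) < e" using e by (simp add: dist_norm power2_less_imp_less)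
    qed
  qed
  then obtain y where y: "v \<longlonglongrightarrow> y" using Cauchy_convergent convergent_def by blast
  have yV: "y \<in> V" using closed_sequentially[OF closed_csubspaceD(2)[OF V]] v(1) y by blast
  have "(\<lambda>n. norm (x - v n)) \<longlonglongrightarrow> norm (x - y)" by (intro tendsto_intros y)
  hence yd: "norm (x - y) = d" using lim LIMSEQ_unique by blast
  have "cinner w (x - y) = 0" if w: "w \<in> V" for w
  proof (cases "w = 0")
    case False
    define c where "c = cinner w (x - y) / complex_of_real ((norm w)\<^sup>2)"
    have n: "(norm w)\<^sup>2 > 0" using False by simp
    have "cinner (x - y) (c *\<^sub>C w) = complex_of_real ((cmod (cinner w (x - y)))\<^sup>2 / (norm w)\<^sup>2)"
      using cinner_commute[of "x - y" w] unfolding c_def cinner_cscale_right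
      by (simp add: complex_norm_square mult.commute del: of_real_power)
    hence "Re (cinner (x - y) (c *\<^sub>C w)) = (cmod (cinner w (x - y)))\<^sup>2 / (norm w)\<^sup>2"
      by (simp only: Re_complex_of_real)
    moreover have "(norm (c *\<^sub>C w))\<^sup>2 = (cmod (cinner w (x - y)))\<^sup>2 / (norm w)\<^sup>2"
      using n by (simp add: c_def norm_divide norm_mult power_mult_distrib power_divide power2_eq_square)
    ultimately have "(norm (x - y - c *\<^sub>C w))\<^sup>2 = d\<^sup>2 - (cmod (cinner w (x - y)))\<^sup>2 / (norm w)\<^sup>2"
      by (simp add: norm_diff_sq yd)
    moreover have "d \<le> norm (x - (y + c *\<^sub>C w))"
      using closed_csubspaceD[OF V] w yV by (intro d_le) auto
    hence "d\<^sup>2 \<le> (norm (x - y - c *\<^sub>C w))\<^sup>2"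
      using d0 by (intro power_mono) (auto simp: algebra_simps)
    ultimately have "(cmod (cinner w (x - y)))\<^sup>2 / (norm w)\<^sup>2 \<le> 0" by linarith
    thus ?thesis using n by (simp add: divide_le_0_iff)
  qed simp
  thus ?thesis using yV by (auto simp: orth_compl_def)
qed

lemma orth_proj_unique:
  assumes "closed_csubspace V" "y \<in> V" "x - y \<in> orth_compl V"
  shows "orth_proj V x = y"
  unfolding orth_proj_def
proof (rule the_equality)
  fix z assume z: "z \<in> V \<and> x - z \<in> orth_compl V"
  have "z - y \<in> V" using closed_csubspaceD[OF assms(1)] z assms(2) by blast
  hence "cinner (z - y) ((x - y) - (x - z)) = 0"
    using z assms(3) by (simp add: orth_compl_def cinner_diff(2))
  thus "z = y" by simp
qed (use assms in auto)

lemma orth_proj: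
  assumes "closed_csubspace V"
  shows "orth_proj V x \<in> V" "x - orth_proj V x \<in> orth_compl V"
  using orth_proj_exists[OF assms, of x] orth_proj_unique[OF assms, of _ x] by auto

lemma orth_proj_cinner:
  assumes "closed_csubspace V"
  shows "y \<in> V \<Longrightarrow> cinner y (orth_proj V x) = cinner y x"
    and "y \<in> V \<Longrightarrow> cinner (orth_proj V x) y = cinner x y"
    and "cinner (orth_proj V x) z = cinner x (orth_proj V z)"
proof -
  show 1: "cinner y (orth_proj V x) = cinner y x" if "y \<in> V" for x y
    using orth_proj(2)[OF assms, of x] that by (auto simp: orth_compl_def cinner_diff)
  show 2: "cinner (orth_proj V x) y = cinner x y" if "y \<in> V" for x y
    using 1[OF that] cinner_commute by metis
  show "cinner (orth_proj V x) z = cinner x (orth_proj V z)"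
    using 1 2 orth_proj(1)[OF assms] by metis
qed

lemma orth_proj_id: "closed_csubspace V \<Longrightarrow> x \<in> V \<Longrightarrow> orth_proj V x = x"
  by (rule orth_proj_unique) (auto simp: orth_compl_def)

lemma orth_proj_compl: "closed_csubspace V \<Longrightarrow> x \<in> orth_compl V \<Longrightarrow> orth_proj V x = 0"
  by (rule orth_proj_unique) (auto simp: closed_csubspaceD)

lemma orth_proj_add: "closed_csubspace V \<Longrightarrow> orth_proj V (x + y) = orth_proj V x + orth_proj V y"
  and orth_proj_cscale: "closed_csubspace V \<Longrightarrow> orth_proj V (c *\<^sub>C x) = c *\<^sub>C orth_proj V x"
  by (rule cinner_ext, simp add: orth_proj_cinner(3)[symmetric] cinner_add_right cinner_cscale_right)+

lemma norm_orth_proj_pythagoras: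
  assumes "closed_csubspace V" "v \<in> V"
  shows "(norm (x - v))\<^sup>2 = (norm (x - orth_proj V x))\<^sup>2 + (norm (orth_proj V x - v))\<^sup>2"
proof -
  have "orth_proj V x - v \<in> V" by (intro closed_csubspaceD(5)[OF assms(1)] orth_proj(1) assms)
  hence "cinner (orth_proj V x - v) (x - orth_proj V x) = 0"
    using orth_proj(2)[OF assms(1), of x] by (auto simp: orth_compl_def)
  hence "cinner (x - orth_proj V x) (orth_proj V x - v) = 0" by (metis cinner_commute complex_cnj_zero)
  thus ?thesis using norm_add_sq[of "x - orth_proj V x" "orth_proj V x - v"] by simp
qed

lemma orth_proj_nearest:
  assumes "closed_csubspace V" "v \<in> V"
  shows "norm (x - orth_proj V x) \<le> norm (x - v)"
  by (rule power2_le_imp_le) (use norm_orth_proj_pythagoras[OF assms, of x] in auto)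

lemma orth_proj_norm_le: "closed_csubspace V \<Longrightarrow> norm (orth_proj V x) \<le> norm x"
  by (rule power2_le_imp_le) (use norm_orth_proj_pythagoras[of V 0 x] in \<open>auto simp: closed_csubspaceD\<close>)

lemma bop_orth_proj: "closed_csubspace V \<Longrightarrow> bop (orth_proj V)"
  by (rule bopI[of _ 1]) (auto simp: orth_proj_add orth_proj_cscale orth_proj_norm_le)

lemma orth_compl_orth_compl: "closed_csubspace V \<Longrightarrow> orth_compl (orth_compl V) = V"
proof (intro equalityI subsetI)
  fix x assume V: "closed_csubspace V" and x: "x \<in> orth_compl (orth_compl V)"
  have 1: "cinner (x - orth_proj V x) x = 0"
    using x orth_proj(2)[OF V, of x] by (auto simp: orth_compl_def)
  have "cinner (x - orth_proj V x) (orth_proj V x) = 0"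
    using orth_proj[OF V, of x] by (subst cinner_commute) (auto simp: orth_compl_def)
  with 1 have "cinner (x - orth_proj V x) (x - orth_proj V x) = 0"
    by (simp only: cinner_diff(2)) simp
  thus "x \<in> V" using orth_proj(1)[OF V, of x] by simp
next
  fix x assume "x \<in> V"
  thus "x \<in> orth_compl (orth_compl V)"
    unfolding orth_compl_def by (auto simp: cinner_commute[of _ x])
qed

lemma orth_compl_invariant:
  assumes "\<And>x y. cinner (T x) y = cinner x (T' y)" "\<And>x. x \<in> V \<Longrightarrow> T x \<in> V" "y \<in> orth_compl V"
  shows "T' y \<in> orth_compl V"
  using assms(2,3) by (simp add: orth_compl_def flip: assms(1))

lemma closed_csubspace_eq_UNIV:
  assumes "closed_csubspace V" "\<And>x. x \<in> orth_compl V \<Longrightarrow> x = 0"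
  shows "V = UNIV"
  using assms orth_proj[OF assms(1)] by (metis UNIV_eq_I eq_iff_diff_eq_0)

text \<open>If \<open>w\<close> is orthogonal to the kernel of \<open>f\<close> and \<open>f w \<noteq> 0\<close>, then \<open>f x w - f w x\<close> lies in the kernel;
  pairing it with \<open>w\<close> expresses \<open>f x\<close> by the inner product of \<open>w\<close> and \<open>x\<close>.\<close>
lemma riesz:
  fixes f :: "'h::complex_hilbert_space \<Rightarrow> complex"
  assumes "bounded_linear f" "\<And>c x. f (c *\<^sub>C x) = c * f x"
  shows "\<exists>z. \<forall>x. f x = cinner z x"
proof (cases "\<forall>x. f x = 0")
  case False
  then obtain u where u: "f u \<noteq> 0" by blast
  let ?N = "{x. f x = 0}"
  have lin: "linear f" by (rule bounded_linear.linear) fact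
  have "closed ?N"
    using assms by (intro closed_Collect_eq continuous_intros) (auto simp: linear_continuous_on)
  hence N: "closed_csubspace ?N"
    using lin assms(2) by (auto simp: closed_csubspace_def linear_0 linear_add intro!: complex_vector.subspaceI)
  define w where "w = u - orth_proj ?N u"
  have w: "w \<in> orth_compl ?N" using orth_proj(2)[OF N] by (simp add: w_def)
  have fw: "f w = f u" using orth_proj(1)[OF N, of u] lin by (simp add: w_def linear_diff)
  have w0: "w \<noteq> 0" using fw u lin by (auto simp: linear_0)
  define z where "z = (cnj (f w) / complex_of_real ((norm w)\<^sup>2)) *\<^sub>C w"
  have "f x = cinner z x" for x
  proof -
    have "f x *\<^sub>C w - f w *\<^sub>C x \<in> ?N" using lin by (simp add: linear_diff assms(2))
    hence "cinner (f x *\<^sub>C w - f w *\<^sub>C x) w = 0" using w by (auto simp: orth_compl_def)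
    hence "cinner w (f x *\<^sub>C w - f w *\<^sub>C x) = 0" by (metis cinner_commute complex_cnj_zero)
    hence "f x * complex_of_real ((norm w)\<^sup>2) = f w * cinner w x"
      by (simp add: cinner_diff cinner_cscale_right cinner_self)
    thus ?thesis using w0 by (simp add: z_def cinner_cscale_left divide_simps)
  qed
  thus ?thesis by blast
next
  case True thus ?thesis by (intro exI[of _ 0]) simp
qed

text \<open>The description by \<open>THE\<close> in \<open>adj_on\<close> is meaningful for bounded operators, by the representation
  of bounded functionals.\<close>
lemma adj_on_UNIV:
  assumes "bop T"
  shows "cinner x (adj_on UNIV T y) = cinner (T x) y"
proof -
  have "bounded_linear (\<lambda>x. cinner y (T x))"
    by (rule bounded_linear_compose[OF bounded_bilinear.bounded_linear_right[OF bounded_bilinear_cinner]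
          bop_bounded_linear[OF assms]])
  then obtain z where "\<forall>x. cinner y (T x) = cinner z x"
    using riesz[of "\<lambda>x. cinner y (T x)"] bop_cscale[OF assms] by (auto simp: cinner_cscale_right)
  hence z: "\<forall>x. cinner x z = cinner (T x) y" by (metis cinner_commute)
  hence "adj_on UNIV T y = z"
    unfolding adj_on_def by (intro the_equality) (auto intro: cinner_ext)
  thus ?thesis using z by simp
qed

lemma adj_on_UNIV_eqI:
  assumes "bop T" "\<And>x y. cinner (T x) y = cinner x (T' y)"
  shows "adj_on UNIV T = T'"
  by (rule ext, rule cinner_ext) (metis adj_on_UNIV assms)

lemma bop_adjoint:
  assumes "bop T" "\<And>x y. cinner (T x) y = cinner x (T' y)"
  shows "bop T'"
proof -
  obtain K where K: "K \<ge> 0" "\<And>x. norm (T x) \<le> K * norm x" using bop_bound[OF assms(1)] by blast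
  have "norm (T' y) \<le> K * norm y" for y
  proof (cases "T' y = 0")
    case False
    have "complex_of_real ((norm (T' y))\<^sup>2) = cinner (T (T' y)) y" by (simp add: assms(2) cinner_self)
    hence "cmod (complex_of_real ((norm (T' y))\<^sup>2)) \<le> norm (T (T' y)) * norm y"
      by (simp only: cinner_cauchy_schwarz)
    also have "\<dots> \<le> K * norm (T' y) * norm y" by (intro mult_right_mono K) auto
    finally have "norm (T' y) * norm (T' y) \<le> norm (T' y) * (K * norm y)"
      by (simp add: norm_mult power2_eq_square mult_ac)
    thus ?thesis using False by simp
  qed (use K in simp)
  moreover have "T' (x + y) = T' x + T' y" "T' (c *\<^sub>C x) = c *\<^sub>C T' x" for c x y
    by (rule cinner_ext, simp add: assms(2)[symmetric] cinner_add_right cinner_cscale_right)+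
  ultimately show ?thesis by (intro bopI)
qed


section \<open>Finite-dimensional subspaces\<close>

text \<open>If \<open>b\<close> is not in \<open>Z\<close>, its component \<open>u\<close> orthogonal to \<open>Z\<close> reads off the coefficient of \<open>b\<close> in an
  element of \<open>Z + \<complex>b\<close>.  So \<open>Z + \<complex>b\<close> is the preimage of \<open>Z\<close> under the bounded operator which
  subtracts the multiple of \<open>b\<close> with this coefficient.\<close>
lemma closed_csubspace_add_line:
  fixes Z :: "'h::complex_hilbert_space set"
  assumes Z: "closed_csubspace Z"
  shows "closed_csubspace {x. \<exists>c. x - c *\<^sub>C b \<in> Z}"
proof (cases "b \<in> Z")
  case True
  have "(\<exists>c. x - c *\<^sub>C b \<in> Z) \<longleftrightarrow> x \<in> Z" for x
  proof
    assume "\<exists>c. x - c *\<^sub>C b \<in> Z"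
    then obtain c where "x - c *\<^sub>C b \<in> Z" by blast
    hence "(x - c *\<^sub>C b) + c *\<^sub>C b \<in> Z" using True closed_csubspaceD[OF Z] by blast
    thus "x \<in> Z" by simp
  qed (auto intro!: exI[of _ 0])
  thus ?thesis using Z by simp
next
  case False
  define u where "u = b - orth_proj Z b"
  have u0: "u \<noteq> 0" using False orth_proj(1)[OF Z, of b] by (auto simp: u_def)
  have uZ: "cinner u z = 0" if "z \<in> Z" for z
    using orth_proj(2)[OF Z, of b] that cinner_commute[of u z] by (simp add: u_def orth_compl_def)
  have ub: "cinner u b = cinner u u"
    using uZ[OF orth_proj(1)[OF Z, of b]] by (simp add: u_def cinner_diff)
  define f where "f x = x - (cinner u x / cinner u u) *\<^sub>C b" for x
  have "bounded_linear f"
    unfolding f_def divide_inverse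
    by (intro bounded_linear_sub bounded_linear_ident
        bounded_linear_compose[OF bounded_bilinear.bounded_linear_left[OF bounded_bilinear_cscale]]
        bounded_linear_mult_const bounded_bilinear.bounded_linear_right[OF bounded_bilinear_cinner])
  hence "closed_csubspace {x. f x \<in> Z}"
    by (rule closed_csubspace_vimage)
      (use Z in \<open>auto simp: f_def cinner_cscale_right cscale_cscale complex_vector.scale_right_diff_distrib\<close>)
  moreover have "(\<exists>c. x - c *\<^sub>C b \<in> Z) \<longleftrightarrow> f x \<in> Z" for x
  proof
    assume "\<exists>c. x - c *\<^sub>C b \<in> Z"
    then obtain c where c: "x - c *\<^sub>C b \<in> Z" by blast
    have "cinner u x = c * cinner u u"
      using uZ[OF c] by (simp add: cinner_diff cinner_cscale_right ub)
    thus "f x \<in> Z" using c u0 by (simp add: f_def)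
  qed (auto simp: f_def)
  ultimately show ?thesis by simp
qed

lemma closed_csubspace_add_span:
  fixes Z :: "'h::complex_hilbert_space set"
  assumes "finite B" "closed_csubspace Z"
  shows "closed_csubspace {z + m |z m. z \<in> Z \<and> m \<in> complex_vector.span B}"
  using assms
proof (induction B)
  case (insert b B)
  let ?W = "{z + m |z m. z \<in> Z \<and> m \<in> complex_vector.span B}"
  have "{z + m |z m. z \<in> Z \<and> m \<in> complex_vector.span (insert b B)} = {x. \<exists>c. x - c *\<^sub>C b \<in> ?W}"
  proof (intro equalityI subsetI)
    fix x assume "x \<in> {z + m |z m. z \<in> Z \<and> m \<in> complex_vector.span (insert b B)}"
    then obtain z m k where "x = z + m" "z \<in> Z" "m - k *\<^sub>C b \<in> complex_vector.span B"
      by (auto simp: complex_vector.span_insert)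
    hence "x - k *\<^sub>C b = z + (m - k *\<^sub>C b)" "z \<in> Z" "m - k *\<^sub>C b \<in> complex_vector.span B" by auto
    thus "x \<in> {x. \<exists>c. x - c *\<^sub>C b \<in> ?W}" by blast
  next
    fix x assume "x \<in> {x. \<exists>c. x - c *\<^sub>C b \<in> ?W}"
    then obtain c z m where c: "x - c *\<^sub>C b = z + m" "z \<in> Z" "m \<in> complex_vector.span B" by blast
    hence "x = z + (m + c *\<^sub>C b)" by (simp add: algebra_simps)
    moreover have "m + c *\<^sub>C b \<in> complex_vector.span (insert b B)"
      using c by (auto simp: complex_vector.span_insert intro!: exI[of _ c])
    ultimately show "x \<in> {z + m |z m. z \<in> Z \<and> m \<in> complex_vector.span (insert b B)}" using c by blast
  qed
  thus ?case using closed_csubspace_add_line[OF insert.IH[OF insert.prems], of b] by argo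
qed simp

lemma closed_csubspace_zero: "closed_csubspace {0 :: 'h::complex_hilbert_space}"
  by (simp add: closed_csubspace_def)

lemma finite_dim_closed_csubspace:
  "finite_dim M \<Longrightarrow> closed_csubspace (M :: 'h::complex_hilbert_space set)"
  using closed_csubspace_add_span[OF _ closed_csubspace_zero] unfolding finite_dim_def by force

lemma finite_dim_subspace:
  assumes "finite_dim M" "complex_vector.subspace N" "N \<subseteq> M"
  shows "finite_dim N"
    and "N \<noteq> M \<Longrightarrow> complex_vector.dim N < complex_vector.dim M"
proof -
  obtain B where B: "finite B" "M = complex_vector.span B" using assms(1) by (auto simp: finite_dim_def)
  have basis: "\<exists>C. finite C \<and> C \<subseteq> K \<and> complex_vector.independent C \<and> K = complex_vector.span C
      \<and> card C = complex_vector.dim K" if "complex_vector.subspace K" "K \<subseteq> M" for K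
  proof -
    obtain C where C: "C \<subseteq> K" "complex_vector.independent C" "K \<subseteq> complex_vector.span C"
        "card C = complex_vector.dim K"
      using complex_vector.basis_exists[of K] by blast
    moreover have "finite C"
      using complex_vector.independent_span_bound[OF B(1) C(2)] C(1) that(2) B(2) by blast
    ultimately show ?thesis using complex_vector.span_minimal[OF C(1) that(1)] by blast
  qed
  obtain C where C: "finite C" "complex_vector.independent C" "N = complex_vector.span C"
      "card C = complex_vector.dim N"
    using basis[OF assms(2,3)] by blast
  thus "finite_dim N" by (auto simp: finite_dim_def)
  obtain D where D: "finite D" "M = complex_vector.span D" "card D = complex_vector.dim M"
    using basis[of M] B(2) complex_vector.subspace_span by blast
  assume "N \<noteq> M"
  then obtain m where m: "m \<in> M" "m \<notin> N" using assms(3) by blast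
  have "m \<notin> C" using m(2) C(3) complex_vector.span_base by blast
  have "complex_vector.independent (insert m C)"
    using C m by (simp add: complex_vector.independent_insert)
  moreover have "insert m C \<subseteq> complex_vector.span D"
    using m(1) assms(3) C(3) D(2) complex_vector.span_superset[of C] by blast
  ultimately have "card (insert m C) \<le> card D"
    using complex_vector.independent_span_bound[OF D(1)] by blast
  thus "complex_vector.dim N < complex_vector.dim M"
    using C(1,4) D(3) \<open>m \<notin> C\<close> by simp
qed

text \<open>Vectors of \<open>M\<close> near \<open>L\<close> are near \<open>L \<inter> M\<close>, at a linear rate.  By induction on a spanning set:
  a new vector \<open>b\<close> in \<open>L + span B\<close> can be replaced by a vector of \<open>L\<close>, which does not change the
  distance from \<open>L\<close>; otherwise its component \<open>u\<close> orthogonal to \<open>L + span B\<close> is non-zero, and the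
  coefficient of \<open>b\<close> in \<open>m\<close> is bounded by a multiple of the distance of \<open>m\<close> from \<open>L\<close>.\<close>
lemma finite_dim_positive_angle:
  fixes L :: "'h::complex_hilbert_space set"
  assumes L: "closed_csubspace L" and M: "finite_dim M"
  shows "\<exists>C\<ge>0. \<forall>m\<in>M. \<exists>n\<in>L \<inter> M. \<forall>l\<in>L. norm (m - n) \<le> C * norm (m - l)"
proof -
  have "\<exists>C\<ge>0. \<forall>m\<in>complex_vector.span B. \<exists>n\<in>L \<inter> complex_vector.span B.
          \<forall>l\<in>L. norm (m - n) \<le> C * norm (m - l)" if "finite B" for B
    using that
  proof (induction B)
    case empty
    show ?case using closed_csubspaceD(3)[OF L] by (auto intro!: exI[of _ 0])
  next
    case (insert b B)
    let ?M = "complex_vector.span B" and ?M' = "complex_vector.span (insert b B)"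
    have sub: "?M \<subseteq> ?M'" by (rule complex_vector.span_mono) auto
    obtain C where C: "C \<ge> 0" and
        CP: "\<And>m. m \<in> ?M \<Longrightarrow> \<exists>n\<in>L \<inter> ?M. \<forall>l\<in>L. norm (m - n) \<le> C * norm (m - l)"
      using insert.IH by blast
    define W where "W = {z + m |z m. z \<in> L \<and> m \<in> ?M}"
    have W: "closed_csubspace W"
      unfolding W_def by (rule closed_csubspace_add_span[OF insert.hyps(1) L])
    show ?case
    proof (cases "b \<in> W")
      case True
      then obtain l' m' where b: "b = l' + m'" "l' \<in> L" "m' \<in> ?M" by (auto simp: W_def)
      have l': "l' \<in> ?M'"
      proof -
        have "l' = b - m'" using b by simp
        thus ?thesis
          using complex_vector.span_diff[OF complex_vector.span_base[of b] subsetD[OF sub b(3)]] by simp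
      qed
      show ?thesis
      proof (intro exI[of _ C] conjI ballI C)
        fix m assume "m \<in> ?M'"
        then obtain k where k: "m - k *\<^sub>C b \<in> ?M" by (auto simp: complex_vector.span_insert)
        have "m - k *\<^sub>C l' = (m - k *\<^sub>C b) + k *\<^sub>C m'" by (simp add: b(1) algebra_simps cscale_add_right)
        hence "m - k *\<^sub>C l' \<in> ?M" using k b(3) complex_vector.span_add complex_vector.span_scale by metis
        from CP[OF this] obtain n where n: "n \<in> L \<inter> ?M"
            "\<And>l. l \<in> L \<Longrightarrow> norm (m - k *\<^sub>C l' - n) \<le> C * norm (m - k *\<^sub>C l' - l)" by blast
        show "\<exists>n\<in>L \<inter> ?M'. \<forall>l\<in>L. norm (m - n) \<le> C * norm (m - l)"
        proof (intro bexI[of _ "k *\<^sub>C l' + n"] ballI)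
          show "k *\<^sub>C l' + n \<in> L \<inter> ?M'"
            using n(1) b(2) l' sub closed_csubspaceD[OF L] complex_vector.span_add complex_vector.span_scale
            by (meson IntD1 IntD2 IntI subsetD)
          fix l assume "l \<in> L"
          hence "l - k *\<^sub>C l' \<in> L" using b(2) closed_csubspaceD[OF L] by blast
          from n(2)[OF this] show "norm (m - (k *\<^sub>C l' + n)) \<le> C * norm (m - l)"
            by (simp add: algebra_simps)
        qed
      qed
    next
      case False
      define u where "u = b - orth_proj W b"
      have u0: "norm u > 0" using False orth_proj(1)[OF W, of b] by (auto simp: u_def)
      have uW: "cinner u z = 0" if "z \<in> W" for z
        using orth_proj(2)[OF W, of b] that cinner_commute[of u z] by (simp add: u_def orth_compl_def)
      have ub: "cinner u b = cinner u u"
        using uW[OF orth_proj(1)[OF W, of b]] by (simp add: u_def cinner_diff)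
      \<comment> \<open>\<open>norm b / norm u\<close> times the distance bounds \<open>k *\<^sub>C b\<close>, which enters directly and through \<open>C\<close>\<close>
      define D where "D = C * (1 + norm b / norm u) + norm b / norm u"
      have coef: "cmod k * norm u \<le> norm (m - l)" if "m - k *\<^sub>C b \<in> ?M" "l \<in> L" for m k l
      proof -
        have "(- l) + (m - k *\<^sub>C b) \<in> W"
          using that(1) closed_csubspaceD(6)[OF L that(2), of "-1"] unfolding W_def
          by (intro CollectI exI conjI refl) simp_all
        hence "cinner u (- l + (m - k *\<^sub>C b)) = 0" by (rule uW)
        hence "cinner u (m - l) = k * complex_of_real ((norm u)\<^sup>2)"
          by (simp add: cinner_diff cinner_add_right cinner_cscale_right ub cinner_self algebra_simps)
        hence "cmod k * norm u * norm u = cmod (cinner u (m - l))"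
          by (simp add: norm_mult power2_eq_square mult_ac)
        also have "\<dots> \<le> norm (m - l) * norm u" by (subst mult.commute) (rule cinner_cauchy_schwarz)
        finally show ?thesis using u0 by simp
      qed
      show ?thesis
      proof (intro exI[of _ D] conjI ballI)
        show "D \<ge> 0" using C u0 by (simp add: D_def)
        fix m assume "m \<in> ?M'"
        then obtain k where k: "m - k *\<^sub>C b \<in> ?M" by (auto simp: complex_vector.span_insert)
        from CP[OF this] obtain n where n: "n \<in> L \<inter> ?M"
            "\<And>l. l \<in> L \<Longrightarrow> norm (m - k *\<^sub>C b - n) \<le> C * norm (m - k *\<^sub>C b - l)" by blast
        show "\<exists>n\<in>L \<inter> ?M'. \<forall>l\<in>L. norm (m - n) \<le> D * norm (m - l)"
        proof (intro bexI[of _ n] ballI)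
          show "n \<in> L \<inter> ?M'" using n(1) sub by blast
          fix l assume l: "l \<in> L"
          let ?r = "norm (m - l)"
          have kb: "norm (k *\<^sub>C b) \<le> norm b / norm u * ?r"
            using coef[OF k l] u0 mult_right_mono[OF coef[OF k l], of "norm b / norm u"] by (simp add: mult_ac)
          have "norm (m - k *\<^sub>C b - l) \<le> ?r + norm (k *\<^sub>C b)"
            using norm_triangle_ineq4[of "m - l" "k *\<^sub>C b"] by (simp add: algebra_simps)
          also have "\<dots> \<le> (1 + norm b / norm u) * ?r" using kb by (simp add: algebra_simps)
          finally have "norm (m - k *\<^sub>C b - n) \<le> C * ((1 + norm b / norm u) * ?r)"
            using n(2)[OF l] C by (meson mult_left_mono order_trans)
          moreover have "norm (m - n) \<le> norm (m - k *\<^sub>C b - n) + norm (k *\<^sub>C b)"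
            using norm_triangle_ineq[of "m - k *\<^sub>C b - n" "k *\<^sub>C b"] by (simp add: algebra_simps)
          ultimately show "norm (m - n) \<le> D * ?r" using kb by (simp add: D_def algebra_simps)
        qed
      qed
    qed
  qed
  thus ?thesis using M by (auto simp: finite_dim_def)
qed


section \<open>Coinvariant subspaces of commuting row isometries\<close>

text \<open>The relations satisfied by the operators \<open>S i e\<close> of the edges \<open>e\<close> of colour \<open>i\<close> and by the vertex
  projections \<open>P v\<close> of an isometric and fully coisometric representation.  The graph enters only
  through the existence of suitable edges and vertices, so that the same sets of edges and vertices
  serve for an ampliation.\<close>
locale edge_system =
  fixes E :: "'k \<Rightarrow> 'e set"
    and S Sa :: "'k \<Rightarrow> 'e \<Rightarrow> 'h::complex_hilbert_space \<Rightarrow> 'h"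
    and V :: "'v set"
    and P :: "'v \<Rightarrow> 'h \<Rightarrow> 'h"
  assumes bop_S: "e \<in> E i \<Longrightarrow> bop (S i e)"
    and S_adjoint: "e \<in> E i \<Longrightarrow> cinner (S i e x) y = cinner x (Sa i e y)"
    and bop_P: "v \<in> V \<Longrightarrow> bop (P v)"
    and P_selfadjoint: "v \<in> V \<Longrightarrow> cinner (P v x) y = cinner x (P v y)"
    and P_idem: "v \<in> V \<Longrightarrow> P v (P v x) = P v x"
    and Sa_S_same: "e \<in> E i \<Longrightarrow> \<exists>v\<in>V. \<forall>x. Sa i e (S i e x) = P v x"
    and Sa_S_diff: "e \<in> E i \<Longrightarrow> f \<in> E i \<Longrightarrow> e \<noteq> f \<Longrightarrow> Sa i e (S i f x) = 0"
    and P_S: "v \<in> V \<Longrightarrow> e \<in> E i \<Longrightarrow> (\<forall>x. P v (S i e x) = S i e x) \<or> (\<forall>x. P v (S i e x) = 0)"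
    and S_total: "closed_cspan {S i e x |e x. e \<in> E i} = UNIV"
    and S_commute: "e \<in> E i \<Longrightarrow> f \<in> E j \<Longrightarrow> (\<forall>x. S i e (S j f x) = 0) \<or>
      (\<exists>f'\<in>E j. \<exists>e'\<in>E i. \<forall>x. S i e (S j f x) = S j f' (S i e' x))"
begin

lemma bop_Sa: "e \<in> E i \<Longrightarrow> bop (Sa i e)"
  by (rule bop_adjoint[of "S i e"]) (auto simp: bop_S S_adjoint)

lemma norm_P_le: "v \<in> V \<Longrightarrow> norm (P v x) \<le> norm x"
  by (rule norm_le_if_cinner_eq) (simp add: P_selfadjoint P_idem)

lemma norm_S_le: assumes "e \<in> E i" shows "norm (S i e x) \<le> norm x"
proof -
  obtain v where v: "v \<in> V" "\<And>x. Sa i e (S i e x) = P v x" using Sa_S_same[OF assms] by blast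
  have "complex_of_real ((norm (S i e x))\<^sup>2) = complex_of_real ((norm (P v x))\<^sup>2)"
    using assms v by (simp add: S_adjoint P_selfadjoint P_idem del: of_real_power flip: cinner_self)
  hence "norm (S i e x) = norm (P v x)" using of_real_eq_iff power2_eq_iff_nonneg norm_ge_zero by metis
  thus ?thesis using norm_P_le v(1) by simp
qed

text \<open>\<open>S i e\<close> vanishes on the kernel of its initial projection, so it is a partial isometry.\<close>
lemma S_Sa_S: assumes "e \<in> E i" shows "S i e (Sa i e (S i e x)) = S i e x"
proof -
  obtain v where v: "v \<in> V" "\<And>x. Sa i e (S i e x) = P v x" using Sa_S_same[OF assms] by blast
  have "cinner (S i e (P v x - x)) (S i e (P v x - x)) = 0"
    using assms v by (simp add: S_adjoint bop_diff[OF bop_P] P_idem)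
  hence "S i e (P v x - x) = 0" by simp
  thus ?thesis using v assms by (simp add: bop_diff[OF bop_S])
qed

lemma Sa_S_Sa: assumes "e \<in> E i" shows "Sa i e (S i e (Sa i e x)) = Sa i e x"
proof (rule cinner_ext)
  fix y
  have "cinner y (Sa i e (S i e (Sa i e x))) = cinner (S i e (Sa i e (S i e y))) x"
    using assms by (metis S_adjoint cinner_commute)
  thus "cinner y (Sa i e (S i e (Sa i e x))) = cinner y (Sa i e x)"
    using assms by (simp add: S_Sa_S S_adjoint)
qed

lemma S_sum_orth:
  assumes "finite F" "F \<subseteq> E i"
  shows "(norm (\<Sum>e\<in>F. S i e (x e)))\<^sup>2 = (\<Sum>e\<in>F. (norm (S i e (x e)))\<^sup>2)"
  using assms
proof (induction F)
  case (insert e F)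
  have "cinner (S i e (x e)) (\<Sum>f\<in>F. S i f (x f)) = 0"
    unfolding cinner_sum_right
  proof (intro sum.neutral ballI)
    fix f assume "f \<in> F"
    hence "e \<in> E i" "f \<in> E i" "e \<noteq> f" using insert by auto
    thus "cinner (S i e (x e)) (S i f (x f)) = 0" by (simp add: S_adjoint Sa_S_diff)
  qed
  thus ?case using insert by (simp add: norm_add_sq)
qed simp

lemma norm_S_sum_le:
  assumes "finite F" "F \<subseteq> E i"
  shows "(norm (\<Sum>e\<in>F. S i e (x e)))\<^sup>2 \<le> (\<Sum>e\<in>F. (norm (x e))\<^sup>2)"
  unfolding S_sum_orth[OF assms] using assms(2) by (intro sum_mono power_mono norm_S_le) auto

text \<open>The finite sum is the orthogonal projection of \<open>y\<close> onto the span of the ranges of the \<open>S i e\<close>.\<close>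
lemma S_Bessel:
  assumes "finite F" "F \<subseteq> E i"
  shows "(norm (y - (\<Sum>e\<in>F. S i e (Sa i e y))))\<^sup>2 = (norm y)\<^sup>2 - (\<Sum>e\<in>F. (norm (Sa i e y))\<^sup>2)"
proof -
  have 1: "complex_of_real ((norm (S i e (Sa i e y)))\<^sup>2) = complex_of_real ((norm (Sa i e y))\<^sup>2)"
    if "e \<in> F" for e
    using assms(2) that unfolding cinner_self[symmetric] by (subst S_adjoint) (auto simp: Sa_S_Sa)
  have "cinner y (S i e (Sa i e y)) = complex_of_real ((norm (Sa i e y))\<^sup>2)" if "e \<in> F" for e
    using assms(2) that by (subst cinner_commute, subst S_adjoint) (auto simp: cinner_self)
  hence "Re (cinner y (\<Sum>e\<in>F. S i e (Sa i e y))) = (\<Sum>e\<in>F. (norm (Sa i e y))\<^sup>2)"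
    by (simp add: cinner_sum_right)
  moreover have "(norm (\<Sum>e\<in>F. S i e (Sa i e y)))\<^sup>2 = (\<Sum>e\<in>F. (norm (Sa i e y))\<^sup>2)"
    unfolding S_sum_orth[OF assms] using 1 of_real_eq_iff by (intro sum.cong) blast+
  ultimately show ?thesis by (simp add: norm_diff_sq)
qed

lemma S_Bessel_le:
  assumes "finite F" "F \<subseteq> E i"
  shows "(\<Sum>e\<in>F. (norm (Sa i e y))\<^sup>2) \<le> (norm y)\<^sup>2"
    and "norm (y - (\<Sum>e\<in>F. S i e (Sa i e y))) \<le> norm y"
proof -
  show "(\<Sum>e\<in>F. (norm (Sa i e y))\<^sup>2) \<le> (norm y)\<^sup>2"
    using S_Bessel[OF assms, of y] zero_le_power2 by (metis diff_ge_0_iff_ge)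
  have "(norm (y - (\<Sum>e\<in>F. S i e (Sa i e y))))\<^sup>2 \<le> (norm y)\<^sup>2"
    unfolding S_Bessel[OF assms] by (simp add: sum_nonneg)
  thus "norm (y - (\<Sum>e\<in>F. S i e (Sa i e y))) \<le> norm y" by (rule power2_le_imp_le) simp
qed

text \<open>The partial sums are contractive in \<open>y\<close> and eventually constant on the dense span of the ranges.\<close>
lemma S_expansion:
  assumes "\<delta> > 0"
  shows "\<exists>F. finite F \<and> F \<subseteq> E i \<and> norm (y - (\<Sum>e\<in>F. S i e (Sa i e y))) < \<delta>"
proof -
  define Q where "Q F z = (\<Sum>e\<in>F. S i e (Sa i e z))" for F z
  let ?Z = "{z. \<exists>F. finite F \<and> F \<subseteq> E i \<and> (\<forall>F'. finite F' \<and> F' \<subseteq> E i \<and> F \<subseteq> F' \<longrightarrow> Q F' z = z)}"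
  have lin: "Q F (x + y) = Q F x + Q F y" "Q F (c *\<^sub>C x) = c *\<^sub>C Q F x" "Q F (x - y) = Q F x - Q F y"
    if "F \<subseteq> E i" for F x y c
    using that unfolding Q_def
    by (auto simp: bop_add[OF bop_S] bop_add[OF bop_Sa] bop_cscale[OF bop_S] bop_cscale[OF bop_Sa]
        bop_diff[OF bop_S] bop_diff[OF bop_Sa] subset_iff complex_vector.scale_sum_right
        simp flip: sum.distrib sum_subtractf intro!: sum.cong)
  have "complex_vector.subspace ?Z"
  proof (rule complex_vector.subspaceI)
    show "0 \<in> ?Z"
      by (auto simp: Q_def bop_zero[OF bop_S] bop_zero[OF bop_Sa] subset_iff intro!: sum.neutral)
  next
    fix x y assume "x \<in> ?Z" "y \<in> ?Z"
    from \<open>x \<in> ?Z\<close> obtain F where "finite F" "F \<subseteq> E i"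
      "\<forall>F'. finite F' \<and> F' \<subseteq> E i \<and> F \<subseteq> F' \<longrightarrow> Q F' x = x" by auto
    moreover from \<open>y \<in> ?Z\<close> obtain G where "finite G" "G \<subseteq> E i"
      "\<forall>F'. finite F' \<and> F' \<subseteq> E i \<and> G \<subseteq> F' \<longrightarrow> Q F' y = y" by auto
    ultimately show "x + y \<in> ?Z" by (intro CollectI exI[of _ "F \<union> G"]) (auto simp: lin)
  next
    fix c x assume "x \<in> ?Z"
    then obtain F where "finite F" "F \<subseteq> E i" "\<forall>F'. finite F' \<and> F' \<subseteq> E i \<and> F \<subseteq> F' \<longrightarrow> Q F' x = x"
      by auto
    thus "c *\<^sub>C x \<in> ?Z" by (intro CollectI exI[of _ F]) (auto simp: lin)
  qed
  moreover have "{S i e x |e x. e \<in> E i} \<subseteq> ?Z"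
  proof safe
    fix e x assume e: "e \<in> E i"
    have "Q F' (S i e x) = S i e x" if "finite F'" "F' \<subseteq> E i" "{e} \<subseteq> F'" for F'
    proof -
      have "Q F' (S i e x) = (\<Sum>f\<in>F'. if f = e then S i e x else 0)"
        unfolding Q_def using that e
        by (intro sum.cong) (auto simp: S_Sa_S Sa_S_diff bop_zero[OF bop_S] subset_iff)
      thus ?thesis using that by simp
    qed
    thus "\<exists>F. finite F \<and> F \<subseteq> E i \<and> (\<forall>F'. finite F' \<and> F' \<subseteq> E i \<and> F \<subseteq> F' \<longrightarrow> Q F' (S i e x) = S i e x)"
      using e by (intro exI[of _ "{e}"]) auto
  qed
  ultimately have sub: "complex_vector.span {S i e x |e x. e \<in> E i} \<subseteq> ?Z"
    by (rule complex_vector.span_minimal[rotated])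
  have "y \<in> closure (complex_vector.span {S i e x |e x. e \<in> E i})"
    using S_total[of i] unfolding closed_cspan_def by simp
  then obtain z where "z \<in> complex_vector.span {S i e x |e x. e \<in> E i}" and yz: "dist z y < \<delta>"
    using assms by (auto simp: closure_approachable)
  then obtain F where F: "finite F" "F \<subseteq> E i" "Q F z = z" using sub by blast
  have "norm (y - Q F y) = norm ((y - z) - Q F (y - z))" using F by (simp add: lin)
  also have "\<dots> \<le> norm (y - z)" unfolding Q_def by (rule S_Bessel_le(2)[OF F(1,2)])
  also have "\<dots> < \<delta>" using yz by (simp add: dist_norm norm_minus_commute)
  finally show ?thesis using F unfolding Q_def by blast
qed

definition coinvariant :: "'h set \<Rightarrow> bool" where
  "coinvariant L \<longleftrightarrow> closed_csubspace L \<and> (\<forall>i. \<forall>e\<in>E i. \<forall>x\<in>L. Sa i e x \<in> L) \<and> (\<forall>v\<in>V. \<forall>x\<in>L. P v x \<in> L)"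

definition invariant :: "'h set \<Rightarrow> bool" where
  "invariant K \<longleftrightarrow> closed_csubspace K \<and> (\<forall>i. \<forall>e\<in>E i. \<forall>x\<in>K. S i e x \<in> K)"

text \<open>The vectors \<open>S\<^sub>e \<cdots> S\<^sub>f m\<close> whose edges have the prescribed list of colours.  Zero is always
  admitted, because interchanging two colours can only be done for products which do not vanish.\<close>
fun word_vectors :: "'h set \<Rightarrow> 'k list \<Rightarrow> 'h set" where
  "word_vectors M [] = M"
| "word_vectors M (i # c) = insert 0 {S i e x |e x. e \<in> E i \<and> x \<in> word_vectors M c}"

definition orbit_span :: "'h set \<Rightarrow> 'h set" where
  "orbit_span M = closed_cspan (\<Union>c. word_vectors M c)"

lemma coinvariantD:
  assumes "coinvariant L"
  shows "closed_csubspace L" "e \<in> E i \<Longrightarrow> x \<in> L \<Longrightarrow> Sa i e x \<in> L" "v \<in> V \<Longrightarrow> x \<in> L \<Longrightarrow> P v x \<in> L"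
  using assms by (auto simp: coinvariant_def)

lemma coinvariant_Int: "coinvariant L \<Longrightarrow> coinvariant M \<Longrightarrow> coinvariant (L \<inter> M)"
  by (auto simp: coinvariant_def closed_csubspace_Int)

lemma closed_csubspace_orbit_span: "closed_csubspace (orbit_span M)"
  by (simp add: orbit_span_def closed_cspan_closed_csubspace)

lemma word_vectors_subset_orbit_span: "word_vectors M c \<subseteq> orbit_span M"
  unfolding orbit_span_def using closed_cspan_superset[of "\<Union>c. word_vectors M c"] by blast

lemma subset_orbit_span: "M \<subseteq> orbit_span M"
  using word_vectors_subset_orbit_span[of M "[]"] by simp

lemma invariant_orbit_span: "invariant (orbit_span M)"
  unfolding invariant_def
proof (intro conjI allI ballI)
  fix i e x assume e: "e \<in> E i" and x: "x \<in> orbit_span M"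
  show "S i e x \<in> orbit_span M"
  proof (rule bop_image_closed_cspan[OF bop_S[OF e] closed_csubspace_orbit_span _ x[unfolded orbit_span_def]])
    fix x assume "x \<in> (\<Union>c. word_vectors M c)"
    then obtain c where "x \<in> word_vectors M c" by blast
    hence "S i e x \<in> word_vectors M (i # c)" using e by auto
    thus "S i e x \<in> orbit_span M" using word_vectors_subset_orbit_span by blast
  qed
qed (rule closed_csubspace_orbit_span)

lemma orbit_span_least: assumes "invariant K" "M \<subseteq> K" shows "orbit_span M \<subseteq> K"
  unfolding orbit_span_def
proof (rule closed_cspan_minimal)
  have "word_vectors M c \<subseteq> K" for c
    by (induction c) (use assms in \<open>auto simp: invariant_def closed_csubspaceD\<close>)
  thus "(\<Union>c. word_vectors M c) \<subseteq> K" by blast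
qed (use assms in \<open>simp add: invariant_def\<close>)

lemma zero_word_vectors: "0 \<in> M \<Longrightarrow> 0 \<in> word_vectors M c"
  by (cases c) auto

text \<open>\<open>P v\<close> either fixes the leading edge of a word or annihilates it.\<close>
lemma P_word_vectors:
  assumes "coinvariant M" "v \<in> V" "x \<in> word_vectors M c" shows "P v x \<in> word_vectors M c"
proof (cases c)
  case (Cons i c')
  show ?thesis
  proof (cases "x = 0")
    case False
    then obtain e y where "x = S i e y" "e \<in> E i" "y \<in> word_vectors M c'" using assms(3) Cons by auto
    thus ?thesis using P_S[OF assms(2), of e i] Cons by auto
  qed (use assms Cons bop_zero[OF bop_P] in auto)
qed (use assms coinvariantD in auto)

lemma word_vectors_swap: "word_vectors M (i # j # c) \<subseteq> word_vectors M (j # i # c)"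
proof
  fix x assume x: "x \<in> word_vectors M (i # j # c)"
  show "x \<in> word_vectors M (j # i # c)"
  proof (cases "x = 0")
    case False
    then obtain e y where e: "e \<in> E i" "x = S i e y" "y \<in> word_vectors M (j # c)" using x by auto
    hence "y \<noteq> 0" using False bop_zero[OF bop_S] by auto
    then obtain f z where f: "f \<in> E j" "y = S j f z" "z \<in> word_vectors M c" using e(3) by auto
    then obtain f' e' where f': "f' \<in> E j" "e' \<in> E i" "S i e (S j f z) = S j f' (S i e' z)"
      using S_commute[OF e(1) f(1)] False e(2) by auto
    have "S i e' z \<in> word_vectors M (i # c)" using f' f by auto
    thus ?thesis unfolding e(2) f(2) f'(3) using f'(1) by (subst word_vectors.simps) blast
  qed auto
qed

lemma word_vectors_Cons_mono:
  "word_vectors M c \<subseteq> word_vectors M d \<Longrightarrow> word_vectors M (i # c) \<subseteq> word_vectors M (i # d)"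
  by auto

text \<open>Edges of different colours commute up to a change of edges, so any colour of a word may be
  brought to the front; this is where the factorization property acts.\<close>
lemma word_vectors_move:
  assumes "i \<in> set c" shows "word_vectors M c \<subseteq> word_vectors M (i # remove1 i c)"
  using assms
proof (induction c)
  case (Cons j c)
  show ?case
  proof (cases "j = i")
    case False
    hence "word_vectors M (j # c) \<subseteq> word_vectors M (j # i # remove1 i c)"
      using Cons by (intro word_vectors_Cons_mono) auto
    also have "\<dots> \<subseteq> word_vectors M (i # j # remove1 i c)" by (rule word_vectors_swap)
    finally show ?thesis using False by simp
  qed simp
qed simp

text \<open>The adjoint of an edge cancels a leading edge of the same colour up to a vertex projection,
  which \<open>M\<close> and the remaining word absorb.\<close>
lemma Sa_word_vectors:
  assumes "coinvariant M" "e \<in> E i" "x \<in> word_vectors M (i # c)"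
  shows "Sa i e x \<in> word_vectors M c"
proof -
  have 0: "0 \<in> word_vectors M c"
    using assms(1) by (simp add: zero_word_vectors closed_csubspaceD coinvariantD(1))
  consider "x = 0" | f y where "f \<in> E i" "x = S i f y" "y \<in> word_vectors M c" using assms(3) by auto
  thus ?thesis
  proof cases
    case 1 thus ?thesis using 0 bop_zero[OF bop_Sa[OF assms(2)]] by simp
  next
    case 2
    show ?thesis
    proof (cases "e = f")
      case True
      obtain v where "v \<in> V" "\<And>x. Sa i e (S i e x) = P v x" using Sa_S_same[OF assms(2)] by blast
      thus ?thesis using True 2 P_word_vectors[OF assms(1)] by auto
    qed (use 2 0 Sa_S_diff assms in auto)
  qed
qed

text \<open>A vector \<open>m\<close> of \<open>M\<close> is the limit of the sums of \<open>S i e (Sa i e m)\<close>, and \<open>Sa i e m\<close> is again in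
  \<open>M\<close>.  So words may be prolonged on the right by any colours.\<close>
lemma word_vectors_extend:
  assumes "coinvariant M" shows "word_vectors M c \<subseteq> closed_cspan (word_vectors M (c @ d))"
proof -
  have step: "word_vectors M c \<subseteq> closed_cspan (word_vectors M (c @ [i]))" for c i
  proof (induction c)
    case Nil
    let ?W = "closed_cspan (word_vectors M [i])"
    show ?case
    proof
      fix m assume m: "m \<in> word_vectors M []"
      have "\<exists>y\<in>?W. dist y m < \<delta>" if \<delta>: "\<delta> > 0" for \<delta>
      proof -
        obtain F where F: "finite F" "F \<subseteq> E i" "norm (m - (\<Sum>e\<in>F. S i e (Sa i e m))) < \<delta>"
          using S_expansion[OF \<delta>] by blast
        have "(\<Sum>e\<in>F. S i e (Sa i e m)) \<in> ?W"
        proof (rule complex_vector.subspace_sum)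
          show "complex_vector.subspace ?W" using closed_cspan_closed_csubspace closed_csubspaceD(1) by blast
          fix e assume "e \<in> F"
          hence "e \<in> E i" "Sa i e m \<in> M" using F m coinvariantD(2)[OF assms] by auto
          hence "S i e (Sa i e m) \<in> word_vectors M [i]" by auto
          thus "S i e (Sa i e m) \<in> ?W" using closed_cspan_superset by blast
        qed
        thus ?thesis using F(3) by (auto simp: dist_norm norm_minus_commute intro: bexI)
      qed
      hence "m \<in> closure ?W" by (simp add: closure_approachable)
      thus "m \<in> closed_cspan (word_vectors M ([] @ [i]))"
        using closed_csubspaceD(2)[OF closed_cspan_closed_csubspace, of "word_vectors M [i]"]
        by (simp only: closure_closed append_Nil)
    qed
  next
    case (Cons j c)
    let ?W = "closed_cspan (word_vectors M ((j # c) @ [i]))"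
    show ?case
    proof
      fix x assume x: "x \<in> word_vectors M (j # c)"
      show "x \<in> ?W"
      proof (cases "x = 0")
        case False
        then obtain e y where e: "e \<in> E j" "x = S j e y" "y \<in> word_vectors M c" using x by auto
        show ?thesis unfolding e(2)
        proof (rule bop_image_closed_cspan[OF bop_S[OF e(1)] closed_cspan_closed_csubspace])
          show "y \<in> closed_cspan (word_vectors M (c @ [i]))" using Cons.IH e(3) by blast
          fix z assume "z \<in> word_vectors M (c @ [i])"
          hence "S j e z \<in> word_vectors M ((j # c) @ [i])" using e(1) by auto
          thus "S j e z \<in> ?W" using closed_cspan_superset by blast
        qed
      qed (simp add: closed_csubspaceD(3)[OF closed_cspan_closed_csubspace])
    qed
  qed
  show ?thesis
  proof (induction d rule: rev_induct)
    case (snoc i d)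
    thus ?case
      using closed_cspan_minimal[OF closed_cspan_closed_csubspace step[of "c @ d" i]] by force
  qed (simp add: closed_cspan_superset)
qed

text \<open>Before applying the adjoint of an edge of colour \<open>i\<close>, prolong the word by the colour \<open>i\<close> and move
  this colour to the front.  Together with \<open>invariant_orbit_span\<close> this makes the orbit span of a
  coinvariant subspace reducing.\<close>
lemma coinvariant_orbit_span: assumes "coinvariant M" shows "coinvariant (orbit_span M)"
  unfolding coinvariant_def
proof (intro conjI allI ballI)
  fix i e x assume e: "e \<in> E i" and x: "x \<in> orbit_span M"
  show "Sa i e x \<in> orbit_span M"
  proof (rule bop_image_closed_cspan[OF bop_Sa[OF e] closed_csubspace_orbit_span _ x[unfolded orbit_span_def]])
    fix x assume "x \<in> (\<Union>c. word_vectors M c)"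
    then obtain c where "x \<in> word_vectors M c" by blast
    hence "x \<in> closed_cspan (word_vectors M (c @ [i]))" using word_vectors_extend[OF assms] by blast
    thus "Sa i e x \<in> orbit_span M"
    proof (rule bop_image_closed_cspan[OF bop_Sa[OF e] closed_csubspace_orbit_span, rotated])
      fix x assume "x \<in> word_vectors M (c @ [i])"
      hence "x \<in> word_vectors M (i # remove1 i (c @ [i]))" using word_vectors_move[of i "c @ [i]"] by auto
      thus "Sa i e x \<in> orbit_span M" using Sa_word_vectors[OF assms e] word_vectors_subset_orbit_span by blast
    qed
  qed
next
  fix v x assume v: "v \<in> V" and x: "x \<in> orbit_span M"
  show "P v x \<in> orbit_span M"
    by (rule bop_image_closed_cspan[OF bop_P[OF v] closed_csubspace_orbit_span _ x[unfolded orbit_span_def]])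
      (use P_word_vectors[OF assms v] word_vectors_subset_orbit_span in blast)
qed (rule closed_csubspace_orbit_span)

lemma coinvariant_orth_compl:
  assumes "invariant K" "\<And>v x. v \<in> V \<Longrightarrow> x \<in> K \<Longrightarrow> P v x \<in> K"
  shows "coinvariant (orth_compl K)"
  unfolding coinvariant_def
proof (intro conjI allI ballI)
  fix i e x assume "e \<in> E i" "x \<in> orth_compl K"
  thus "Sa i e x \<in> orth_compl K"
    using assms(1) by (elim orth_compl_invariant[of "S i e", rotated 2]) (auto simp: S_adjoint invariant_def)
next
  fix v x assume "v \<in> V" "x \<in> orth_compl K"
  thus "P v x \<in> orth_compl K"
    using assms(2) by (elim orth_compl_invariant[of "P v", rotated 2]) (auto simp: P_selfadjoint)
qed (rule orth_compl_closed_csubspace)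


text \<open>Every way of removing edges of the colours \<open>p\<close> from \<open>w\<close> by adjoints ends in \<open>M\<close>.\<close>
fun stripped_into :: "'h set \<Rightarrow> 'k list \<Rightarrow> 'h \<Rightarrow> bool" where
  "stripped_into M [] w \<longleftrightarrow> w \<in> M"
| "stripped_into M (i # p) w \<longleftrightarrow> (\<forall>e\<in>E i. stripped_into M p (Sa i e w))"

lemma closed_csubspace_stripped_into:
  "closed_csubspace M \<Longrightarrow> closed_csubspace {w. stripped_into M p w}"
proof (induction p)
  case (Cons i p)
  have "closed_csubspace (\<Inter>e\<in>E i. {w. Sa i e w \<in> {w. stripped_into M p w}})"
    using closed_csubspace_vimage_bop[OF bop_Sa Cons.IH[OF Cons.prems]]
    by (auto simp: closed_csubspace_def intro!: complex_vector.subspace_Inter)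
  moreover have "(\<Inter>e\<in>E i. {w. Sa i e w \<in> {w. stripped_into M p w}}) = {w. stripped_into M (i # p) w}"
    by auto
  ultimately show ?case by simp
next
  case Nil
  have "{w. stripped_into M [] w} = M" by auto
  with Nil show ?case by simp
qed

lemma word_vectors_stripped:
  assumes "coinvariant M" "mset c = mset p"
  shows "x \<in> word_vectors M c \<Longrightarrow> stripped_into M p x"
  using assms(2)
proof (induction p arbitrary: c x)
  case (Cons i p)
  have i: "i \<in> set c" using Cons.prems(2) by (metis list.set_intros(1) set_mset_mset)
  have ms: "mset (remove1 i c) = mset p" using Cons.prems(2) by simp
  have "x \<in> word_vectors M (i # remove1 i c)" using word_vectors_move[OF i] Cons.prems(1) by blast
  thus ?case using Sa_word_vectors[OF assms(1)] Cons.IH[OF _ ms] by (auto simp del: word_vectors.simps)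
qed simp

text \<open>The claim is strengthened to all \<open>p\<close> whose colours contain, with multiplicity, a certain list \<open>c\<close>
  of colours; in this form it is inherited by sums, since the lists for the two summands can be
  appended.\<close>
lemma span_words_stripped:
  assumes M: "coinvariant M" and w: "w \<in> complex_vector.span (\<Union>c. word_vectors M c)"
  shows "\<exists>p. stripped_into M p w"
proof -
  let ?Y = "{w. \<exists>c. \<forall>p. mset c \<subseteq># mset p \<longrightarrow> stripped_into M p w}"
  note sub = closed_csubspaceD[OF closed_csubspace_stripped_into[OF coinvariantD(1)[OF M]]]
  have "complex_vector.subspace ?Y"
  proof (rule complex_vector.subspaceI)
    show "0 \<in> ?Y" using sub(3) by auto
  next
    fix x y assume "x \<in> ?Y" "y \<in> ?Y"
    then obtain c d where c: "\<And>p. mset c \<subseteq># mset p \<Longrightarrow> stripped_into M p x"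
      "\<And>p. mset d \<subseteq># mset p \<Longrightarrow> stripped_into M p y" by blast
    have "stripped_into M p (x + y)" if "mset (c @ d) \<subseteq># mset p" for p
      using c[of p] sub(4)[of x p y] that
      by (metis mem_Collect_eq mset_append mset_subset_eq_add_left mset_subset_eq_add_right subset_mset.order_trans)
    thus "x + y \<in> ?Y" by blast
  next
    fix a x assume "x \<in> ?Y"
    thus "a *\<^sub>C x \<in> ?Y" using sub(6) by blast
  qed
  moreover have "(\<Union>c. word_vectors M c) \<subseteq> ?Y"
  proof safe
    fix x c assume x: "x \<in> word_vectors M c"
    have "stripped_into M p x" if "mset c \<subseteq># mset p" for p
    proof -
      obtain d where d: "mset p - mset c = mset d" by (metis ex_mset)
      hence ms: "mset (c @ d) = mset p" using that by (metis mset_append subset_mset.add_diff_inverse)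
      have "x \<in> closed_cspan (word_vectors M (c @ d))" using word_vectors_extend[OF M] x by blast
      also have "\<dots> \<subseteq> {w. stripped_into M p w}"
        using word_vectors_stripped[OF M ms]
        by (intro closed_cspan_minimal closed_csubspace_stripped_into coinvariantD(1)[OF M]) auto
      finally show ?thesis by simp
    qed
    thus "\<exists>c. \<forall>p. mset c \<subseteq># mset p \<longrightarrow> stripped_into M p x" by blast
  qed
  ultimately have "w \<in> ?Y" using w complex_vector.span_minimal by blast
  thus ?thesis by blast
qed

text \<open>Strip \<open>y\<close> and \<open>w\<close> simultaneously.  At the end the estimate is \<open>base\<close>, because \<open>y\<close> has stayed in
  \<open>L\<close> and \<open>w\<close> has arrived in \<open>M\<close>.  Going back one colour, the approximants \<open>h e\<close> of the vectors
  \<open>Sa i e y\<close> are combined to \<open>\<Sum>\<^sub>e S i e (h e)\<close>; the errors are orthogonal, and the squares of the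
  norms of \<open>Sa i e (y - w)\<close> add up to at most that of \<open>y - w\<close>, so the constant does not grow.\<close>
lemma dist_orbit_span_le_of_stripped:
  assumes L: "coinvariant L" and C: "C \<ge> 0"
    and base: "\<And>y w. y \<in> L \<Longrightarrow> w \<in> M \<Longrightarrow> \<exists>n\<in>N. norm (y - n) \<le> C * norm (y - w)"
  shows "y \<in> L \<Longrightarrow> stripped_into M p w \<Longrightarrow> \<exists>h\<in>orbit_span N. norm (y - h) \<le> C * norm (y - w)"
proof (induction p arbitrary: y w)
  case Nil
  thus ?case using base[of y w] subset_orbit_span by auto
next
  case (Cons i p)
  have "\<forall>e\<in>E i. \<exists>h\<in>orbit_span N. norm (Sa i e y - h) \<le> C * norm (Sa i e y - Sa i e w)"
    using Cons coinvariantD(2)[OF L] by simp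
  then obtain h where h: "\<And>e. e \<in> E i \<Longrightarrow> h e \<in> orbit_span N"
      "\<And>e. e \<in> E i \<Longrightarrow> norm (Sa i e y - h e) \<le> C * norm (Sa i e (y - w))"
    unfolding Bex_def bchoice_iff by (auto simp: bop_diff[OF bop_Sa])
  let ?q = "orth_proj (orbit_span N) y"
  have "norm (y - ?q) \<le> C * norm (y - w) + \<delta>" if \<delta>: "\<delta> > 0" for \<delta>
  proof -
    obtain F where F: "finite F" "F \<subseteq> E i" "norm (y - (\<Sum>e\<in>F. S i e (Sa i e y))) < \<delta>"
      using S_expansion[OF \<delta>] by blast
    have "(\<Sum>e\<in>F. S i e (h e)) \<in> orbit_span N"
      using F(2) h(1) invariant_orbit_span[of N] closed_csubspaceD(1)[OF closed_csubspace_orbit_span, of N]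
      by (intro complex_vector.subspace_sum) (auto simp: invariant_def)
    hence "norm (y - ?q) \<le> norm (y - (\<Sum>e\<in>F. S i e (h e)))"
      by (rule orth_proj_nearest[OF closed_csubspace_orbit_span])
    also have "y - (\<Sum>e\<in>F. S i e (h e)) =
        (y - (\<Sum>e\<in>F. S i e (Sa i e y))) + (\<Sum>e\<in>F. S i e (Sa i e y - h e))"
      using F(2) by (simp add: bop_diff[OF bop_S] subset_iff sum_subtractf)
    also have "norm \<dots> \<le> \<delta> + norm (\<Sum>e\<in>F. S i e (Sa i e y - h e))"
      using F(3) by (intro order_trans[OF norm_triangle_ineq]) simp
    also have "norm (\<Sum>e\<in>F. S i e (Sa i e y - h e)) \<le> C * norm (y - w)"
    proof (rule power2_le_imp_le)
      have "(norm (\<Sum>e\<in>F. S i e (Sa i e y - h e)))\<^sup>2 \<le> (\<Sum>e\<in>F. (norm (Sa i e y - h e))\<^sup>2)"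
        by (rule norm_S_sum_le[OF F(1,2)])
      also have "\<dots> \<le> (\<Sum>e\<in>F. (C * norm (Sa i e (y - w)))\<^sup>2)"
        using F(2) h(2) by (intro sum_mono power_mono) auto
      also have "\<dots> = C\<^sup>2 * (\<Sum>e\<in>F. (norm (Sa i e (y - w)))\<^sup>2)"
        by (simp add: power_mult_distrib sum_distrib_left)
      also have "\<dots> \<le> C\<^sup>2 * (norm (y - w))\<^sup>2" by (intro mult_left_mono S_Bessel_le(1)[OF F(1,2)]) simp
      finally show "(norm (\<Sum>e\<in>F. S i e (Sa i e y - h e)))\<^sup>2 \<le> (C * norm (y - w))\<^sup>2"
        by (simp add: power_mult_distrib)
    qed (simp add: C)
    finally show ?thesis by simp
  qed
  hence "norm (y - ?q) \<le> C * norm (y - w)" by (rule field_le_epsilon)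
  thus ?case using orth_proj(1)[OF closed_csubspace_orbit_span] by blast
qed

text \<open>A vector \<open>y\<close> of \<open>L\<close> is arbitrarily close to combinations \<open>w\<close> of words, which can be stripped into
  \<open>M\<close>; the distance of \<open>y\<close> from the orbit span of \<open>L \<inter> M\<close> is at most a fixed multiple of \<open>y - w\<close>.\<close>
lemma coinvariant_subset_orbit_span_Int:
  assumes M: "coinvariant M" "finite_dim M" and L: "coinvariant L" "L \<subseteq> orbit_span M"
  shows "L \<subseteq> orbit_span (L \<inter> M)"
proof
  fix y assume y: "y \<in> L"
  obtain C where C: "C \<ge> 0"
    and CP: "\<And>m. m \<in> M \<Longrightarrow> \<exists>n\<in>L \<inter> M. \<forall>l\<in>L. norm (m - n) \<le> C * norm (m - l)"
    using finite_dim_positive_angle[OF coinvariantD(1)[OF L(1)] M(2)] by blast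
  have base: "\<exists>n\<in>L \<inter> M. norm (y - n) \<le> (C + 1) * norm (y - w)" if yw: "y \<in> L" "w \<in> M" for y w
  proof -
    obtain n where n: "n \<in> L \<inter> M" "norm (w - n) \<le> C * norm (w - y)" using CP[OF yw(2)] yw(1) by blast
    have "norm (y - n) \<le> norm (y - w) + norm (w - n)"
      using norm_triangle_ineq[of "y - w" "w - n"] by simp
    hence "norm (y - n) \<le> (C + 1) * norm (y - w)"
      using n(2) by (simp add: algebra_simps norm_minus_commute)
    thus ?thesis using n(1) by blast
  qed
  let ?q = "orth_proj (orbit_span (L \<inter> M)) y"
  have "norm (y - ?q) \<le> \<delta>" if \<delta>: "\<delta> > 0" for \<delta>
  proof -
    have "y \<in> closure (complex_vector.span (\<Union>c. word_vectors M c))"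
      using L(2) y by (auto simp: orbit_span_def closed_cspan_def)
    moreover have "\<delta> / (C + 1) > 0" using \<delta> C by simp
    ultimately obtain w where w: "w \<in> complex_vector.span (\<Union>c. word_vectors M c)" "dist w y < \<delta> / (C + 1)"
      unfolding closure_approachable by blast
    obtain p where "stripped_into M p w" using span_words_stripped[OF M(1) w(1)] by blast
    then obtain h where h: "h \<in> orbit_span (L \<inter> M)" "norm (y - h) \<le> (C + 1) * norm (y - w)"
      using dist_orbit_span_le_of_stripped[OF L(1) _ base y] C by force
    have "norm (y - ?q) \<le> norm (y - h)" by (rule orth_proj_nearest[OF closed_csubspace_orbit_span h(1)])
    also have "\<dots> \<le> (C + 1) * norm (y - w)" by (rule h(2))
    also have "\<dots> \<le> \<delta>" using w(2) C by (simp add: dist_norm norm_minus_commute field_simps)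
    finally show ?thesis .
  qed
  hence "norm (y - ?q) \<le> 0" using field_le_epsilon[of "norm (y - ?q)" 0] by simp
  thus "y \<in> orbit_span (L \<inter> M)" using orth_proj(1)[OF closed_csubspace_orbit_span, of "L \<inter> M" y] by simp
qed

definition least_cyclic :: "'h set \<Rightarrow> bool" where
  "least_cyclic M \<longleftrightarrow> coinvariant M \<and> finite_dim M \<and> orbit_span M = UNIV \<and>
     (\<forall>L. coinvariant L \<longrightarrow> orbit_span L = UNIV \<longrightarrow> M \<subseteq> L)"

text \<open>Take a finite-dimensional cyclic coinvariant \<open>M\<close> of least dimension.  For each cyclic coinvariant
  \<open>L\<close> the intersection \<open>L \<inter> M\<close> is cyclic as well, so it cannot be smaller than \<open>M\<close>.\<close>
lemma least_cyclic_exists: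
  assumes "coinvariant W" "finite_dim W" "orbit_span W = UNIV"
  shows "\<exists>M. least_cyclic M"
proof -
  let ?R = "\<lambda>M. coinvariant M \<and> finite_dim M \<and> orbit_span M = UNIV"
  obtain M where M: "?R M" and min: "\<And>N. ?R N \<Longrightarrow> complex_vector.dim M \<le> complex_vector.dim N"
    using ex_has_least_nat[of ?R W complex_vector.dim] assms by blast
  have "M \<subseteq> L" if L: "coinvariant L" "orbit_span L = UNIV" for L
  proof -
    have "L \<subseteq> orbit_span (L \<inter> M)" using coinvariant_subset_orbit_span_Int[of M L] M L by simp
    hence "orbit_span (L \<inter> M) = UNIV" using orbit_span_least[OF invariant_orbit_span, of L "L \<inter> M"] L by auto
    moreover have co: "coinvariant (L \<inter> M)" using coinvariant_Int M L by blast
    moreover have sub: "complex_vector.subspace (L \<inter> M)"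
      using closed_csubspaceD(1)[OF coinvariantD(1)[OF co]] .
    ultimately have "complex_vector.dim M \<le> complex_vector.dim (L \<inter> M)"
      using M finite_dim_subspace(1)[OF _ sub] by (intro min) auto
    hence "L \<inter> M = M" using finite_dim_subspace(2)[of M "L \<inter> M"] M sub by (meson inf_le2 leD)
    thus ?thesis by blast
  qed
  thus ?thesis using M by (auto simp: least_cyclic_def)
qed

end


section \<open>Square-summable sequences of vectors\<close>

text \<open>One Hilbert space which contains all finite direct powers of \<open>'h\<close>: the \<open>n\<close>-th power consists of
  the sequences which vanish from \<open>n\<close> on.\<close>
typedef (overloaded) 'h l2 = "{f :: nat \<Rightarrow> 'h::complex_hilbert_space. summable (\<lambda>n. (norm (f n))\<^sup>2)}"
  morphisms coord Abs_l2
  by (rule exI[of _ "\<lambda>_. 0"]) simp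

setup_lifting type_definition_l2

lemma summable_norm_sq_add:
  fixes f g :: "nat \<Rightarrow> 'a::real_normed_vector"
  assumes "summable (\<lambda>n. (norm (f n))\<^sup>2)" "summable (\<lambda>n. (norm (g n))\<^sup>2)"
  shows "summable (\<lambda>n. (norm (f n + g n))\<^sup>2)"
proof (rule summable_comparison_test')
  show "summable (\<lambda>n. 2 * (norm (f n))\<^sup>2 + 2 * (norm (g n))\<^sup>2)"
    using assms by (intro summable_add summable_mult)
  fix n
  have "(norm (f n + g n))\<^sup>2 \<le> (norm (f n) + norm (g n))\<^sup>2"
    by (intro power_mono norm_triangle_ineq) simp
  also have "\<dots> \<le> 2 * (norm (f n))\<^sup>2 + 2 * (norm (g n))\<^sup>2"
    using zero_le_power2[of "norm (f n) - norm (g n)"] by (simp add: power2_sum power2_diff)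
  finally show "norm ((norm (f n + g n))\<^sup>2) \<le> 2 * (norm (f n))\<^sup>2 + 2 * (norm (g n))\<^sup>2" by simp
qed

lemma summable_norm_sq_scale:
  fixes f g :: "nat \<Rightarrow> 'a::real_normed_vector"
  assumes "summable (\<lambda>n. (norm (f n))\<^sup>2)" "\<And>n. norm (g n) \<le> K * norm (f n)"
  shows "summable (\<lambda>n. (norm (g n))\<^sup>2)"
proof (rule summable_comparison_test')
  show "summable (\<lambda>n. K\<^sup>2 * (norm (f n))\<^sup>2)" by (intro summable_mult assms(1))
  fix n
  have "(norm (g n))\<^sup>2 \<le> (K * norm (f n))\<^sup>2" by (intro power_mono assms(2)) simp
  thus "norm ((norm (g n))\<^sup>2) \<le> K\<^sup>2 * (norm (f n))\<^sup>2" by (simp add: power_mult_distrib)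
qed

lemma summable_cinner:
  fixes f g :: "nat \<Rightarrow> 'h::complex_hilbert_space"
  assumes "summable (\<lambda>n. (norm (f n))\<^sup>2)" "summable (\<lambda>n. (norm (g n))\<^sup>2)"
  shows "summable (\<lambda>n. cinner (f n) (g n))"
proof (rule summable_comparison_test')
  show "summable (\<lambda>n. (norm (f n))\<^sup>2 + (norm (g n))\<^sup>2)"
    using assms by (intro summable_add)
  fix n
  have "norm (cinner (f n) (g n)) \<le> norm (f n) * norm (g n)" by (rule cinner_cauchy_schwarz)
  also have "\<dots> \<le> (norm (f n))\<^sup>2 + (norm (g n))\<^sup>2"
    using sum_squares_bound[of "norm (f n)" "norm (g n)"] zero_le_power2[of "norm (f n)"]
      zero_le_power2[of "norm (g n)"] by linarith
  finally show "norm (cinner (f n) (g n)) \<le> (norm (f n))\<^sup>2 + (norm (g n))\<^sup>2" .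
qed

lemma suminf_norm_sq_le:
  fixes f :: "nat \<Rightarrow> 'a::real_normed_vector"
  assumes "\<And>K. (\<Sum>n<K. (norm (f n))\<^sup>2) \<le> B\<^sup>2" "B \<ge> 0"
  shows "summable (\<lambda>n. (norm (f n))\<^sup>2)" "sqrt (\<Sum>n. (norm (f n))\<^sup>2) \<le> B"
proof -
  show *: "summable (\<lambda>n. (norm (f n))\<^sup>2)"
    using assms(1) by (intro summableI_nonneg_bounded) auto
  have "(\<Sum>n. (norm (f n))\<^sup>2) \<le> B\<^sup>2" by (rule suminf_le_const[OF * assms(1)])
  thus "sqrt (\<Sum>n. (norm (f n))\<^sup>2) \<le> B" using assms(2) by (simp add: real_le_lsqrt)
qed

instantiation l2 :: (complex_hilbert_space) real_normed_vector
begin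

lift_definition zero_l2 :: "'a l2" is "\<lambda>_. 0" by simp
lift_definition plus_l2 :: "'a l2 \<Rightarrow> 'a l2 \<Rightarrow> 'a l2" is "\<lambda>f g n. f n + g n"
  by (rule summable_norm_sq_add)
lift_definition uminus_l2 :: "'a l2 \<Rightarrow> 'a l2" is "\<lambda>f n. - f n" by simp
lift_definition minus_l2 :: "'a l2 \<Rightarrow> 'a l2 \<Rightarrow> 'a l2" is "\<lambda>f g n. f n - g n"
  subgoal for f g using summable_norm_sq_add[of f "\<lambda>n. - g n"] by simp
  done
lift_definition scaleR_l2 :: "real \<Rightarrow> 'a l2 \<Rightarrow> 'a l2" is "\<lambda>r f n. r *\<^sub>R f n"
  subgoal for r f by (rule summable_norm_sq_scale[of f _ "\<bar>r\<bar>"]) auto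
  done
lift_definition norm_l2 :: "'a l2 \<Rightarrow> real" is "\<lambda>f. sqrt (\<Sum>n. (norm (f n))\<^sup>2)" .
definition sgn_l2 :: "'a l2 \<Rightarrow> 'a l2" where "sgn_l2 x = inverse (norm x) *\<^sub>R x"
definition dist_l2 :: "'a l2 \<Rightarrow> 'a l2 \<Rightarrow> real" where "dist_l2 x y = norm (x - y)"
definition uniformity_l2 :: "('a l2 \<times> 'a l2) filter" where
  "uniformity_l2 = (INF e\<in>{0<..}. principal {(x, y). dist x y < e})"
definition open_l2 :: "'a l2 set \<Rightarrow> bool" where
  "open_l2 U \<longleftrightarrow> (\<forall>x\<in>U. eventually (\<lambda>(x', y). x' = x \<longrightarrow> y \<in> U) uniformity)"

lemma coord_sum_le: "(\<Sum>n<K. (norm (coord x n))\<^sup>2) \<le> (norm x)\<^sup>2" for x :: "'a l2"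
  by (transfer, simp add: suminf_nonneg sum_le_suminf)

lemma norm_l2_leI: "(\<And>K. (\<Sum>n<K. (norm (coord x n))\<^sup>2) \<le> B\<^sup>2) \<Longrightarrow> B \<ge> 0 \<Longrightarrow> norm x \<le> B" for x :: "'a l2"
  by transfer (rule suminf_norm_sq_le(2))

lemma norm_l2_nonneg: "norm x \<ge> 0" for x :: "'a l2"
  by transfer (simp add: suminf_nonneg)

lemma norm_coord_le: "norm (coord x n) \<le> norm x" for x :: "'a l2"
proof (rule power2_le_imp_le)
  have "(norm (coord x n))\<^sup>2 \<le> (\<Sum>n<Suc n. (norm (coord x n))\<^sup>2)"
    by (simp add: sum_nonneg)
  thus "(norm (coord x n))\<^sup>2 \<le> (norm x)\<^sup>2" using coord_sum_le[of x "Suc n"] by linarith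
qed (rule norm_l2_nonneg)

lemma l2_triangle: "norm (x + y) \<le> norm x + norm y" for x y :: "'a l2"
proof (rule norm_l2_leI)
  fix K
  have le: "L2_set (\<lambda>n. norm (coord z n)) {..<K} \<le> norm z" for z :: "'a l2"
    unfolding L2_set_def using coord_sum_le[of z K] norm_l2_nonneg[of z] by (simp add: real_le_lsqrt)
  have "L2_set (\<lambda>n. norm (coord (x + y) n)) {..<K} \<le> L2_set (\<lambda>n. norm (coord x n) + norm (coord y n)) {..<K}"
    by (intro L2_set_mono) (auto simp: plus_l2.rep_eq norm_triangle_ineq)
  also have "\<dots> \<le> norm x + norm y"
    by (rule order_trans[OF L2_set_triangle_ineq add_mono[OF le le]])
  finally have "sqrt (\<Sum>n<K. (norm (coord (x + y) n))\<^sup>2) \<le> norm x + norm y" by (simp add: L2_set_def)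
  thus "(\<Sum>n<K. (norm (coord (x + y) n))\<^sup>2) \<le> (norm x + norm y)\<^sup>2" by (rule sqrt_le_D)
qed (simp add: norm_l2_nonneg)

instance
proof
  fix x y z :: "'a l2" and a b :: real
  show "x + y + z = x + (y + z)" "x + y = y + x" "0 + x = x" "- x + x = 0" "x - y = x + - y"
    by (transfer; simp add: algebra_simps)+
  show "a *\<^sub>R (x + y) = a *\<^sub>R x + a *\<^sub>R y" "(a + b) *\<^sub>R x = a *\<^sub>R x + b *\<^sub>R x"
    "a *\<^sub>R b *\<^sub>R x = (a * b) *\<^sub>R x" "1 *\<^sub>R x = x"
    by (transfer; simp add: algebra_simps)+
  show "dist x y = norm (x - y)" by (rule dist_l2_def)
  show "sgn x = inverse (norm x) *\<^sub>R x" by (rule sgn_l2_def)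
  show "uniformity = (INF e\<in>{0<..}. principal {(x, y :: 'a l2). dist x y < e})"
    by (rule uniformity_l2_def)
  show "open U = (\<forall>x\<in>U. \<forall>\<^sub>F (x', y) in uniformity. x' = x \<longrightarrow> y \<in> U)" for U :: "'a l2 set"
    by (rule open_l2_def)
  show "norm x = 0 \<longleftrightarrow> x = 0"
  proof
    assume "norm x = 0"
    hence "coord x = (\<lambda>_. 0)" using norm_coord_le[of x] by auto
    thus "x = 0" by (simp add: coord_inject[symmetric] zero_l2.rep_eq)
  qed (simp add: norm_l2.rep_eq zero_l2.rep_eq)
  show "norm (x + y) \<le> norm x + norm y" by (rule l2_triangle)
  show "norm (a *\<^sub>R x) = \<bar>a\<bar> * norm x"
    by transfer (simp add: power_mult_distrib suminf_mult real_sqrt_mult)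
qed

end

text \<open>The limit is formed in each coordinate; the partial sums of the squared distances from it are
  controlled by letting the second index tend to infinity.\<close>
lemma Cauchy_l2_convergent:
  fixes X :: "nat \<Rightarrow> 'a::complex_hilbert_space l2"
  assumes "\<And>e. e > 0 \<Longrightarrow> \<exists>N. \<forall>m\<ge>N. \<forall>n\<ge>N. norm (X m - X n) < e"
  shows "\<exists>L. \<forall>e>0. \<exists>N. \<forall>m\<ge>N. norm (X m - L) \<le> e"
proof -
  have "\<exists>l. (\<lambda>m. coord (X m) k) \<longlonglongrightarrow> l" for k
  proof -
    have "Cauchy (\<lambda>m. coord (X m) k)"
    proof (rule CauchyI)
      fix e :: real assume "e > 0"
      then obtain N where N: "\<forall>m\<ge>N. \<forall>n\<ge>N. norm (X m - X n) < e" using assms by blast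
      have "norm (coord (X m) k - coord (X n) k) < e" if "m \<ge> N" "n \<ge> N" for m n
        using norm_coord_le[of "X m - X n" k] N that by (simp add: minus_l2.rep_eq) (meson order_le_less_trans)
      thus "\<exists>N. \<forall>m\<ge>N. \<forall>n\<ge>N. norm (coord (X m) k - coord (X n) k) < e" by blast
    qed
    thus ?thesis using Cauchy_convergent convergent_def by blast
  qed
  then obtain l where l: "\<And>k. (\<lambda>m. coord (X m) k) \<longlonglongrightarrow> l k" by metis
  have est: "\<exists>N. \<forall>m\<ge>N. \<forall>K. (\<Sum>k<K. (norm (coord (X m) k - l k))\<^sup>2) \<le> e\<^sup>2" if e: "e > 0" for e
  proof -
    obtain N where N: "\<And>m n. m \<ge> N \<Longrightarrow> n \<ge> N \<Longrightarrow> norm (X m - X n) < e" using assms[OF e] by blast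
    have "(\<Sum>k<K. (norm (coord (X m) k - l k))\<^sup>2) \<le> e\<^sup>2" if m: "m \<ge> N" for m K
    proof (rule LIMSEQ_le_const2)
      show "(\<lambda>n. \<Sum>k<K. (norm (coord (X m) k - coord (X n) k))\<^sup>2) \<longlonglongrightarrow> (\<Sum>k<K. (norm (coord (X m) k - l k))\<^sup>2)"
        by (intro tendsto_intros l)
      have "(\<Sum>k<K. (norm (coord (X m) k - coord (X n) k))\<^sup>2) \<le> e\<^sup>2" if n: "n \<ge> N" for n
      proof -
        have "(\<Sum>k<K. (norm (coord (X m - X n) k))\<^sup>2) \<le> (norm (X m - X n))\<^sup>2" by (rule coord_sum_le)
        also have "\<dots> \<le> e\<^sup>2" using N[OF m n] norm_l2_nonneg by (intro power_mono) auto
        finally show ?thesis by (simp add: minus_l2.rep_eq)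
      qed
      thus "\<exists>N. \<forall>n\<ge>N. (\<Sum>k<K. (norm (coord (X m) k - coord (X n) k))\<^sup>2) \<le> e\<^sup>2" by blast
    qed
    thus ?thesis by blast
  qed
  obtain N where N: "\<And>m K. m \<ge> N \<Longrightarrow> (\<Sum>k<K. (norm (coord (X m) k - l k))\<^sup>2) \<le> 1\<^sup>2"
    using est[of 1] by auto
  have "summable (\<lambda>k. (norm (coord (X N) k - l k))\<^sup>2)" by (rule suminf_norm_sq_le(1)[OF N]) auto
  hence "summable (\<lambda>k. (norm (- (coord (X N) k - l k) + coord (X N) k))\<^sup>2)"
    using coord[of "X N"] by (intro summable_norm_sq_add) (auto simp: norm_minus_commute)
  hence "coord (Abs_l2 l) = l" by (intro Abs_l2_inverse) simp
  hence "norm (X m - Abs_l2 l) \<le> e" if "\<And>K. (\<Sum>k<K. (norm (coord (X m) k - l k))\<^sup>2) \<le> e\<^sup>2" "e > 0" for m e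
    using that by (intro norm_l2_leI) (auto simp: minus_l2.rep_eq)
  thus ?thesis using est by (intro exI[of _ "Abs_l2 l"]) meson
qed

instance l2 :: (complex_hilbert_space) banach
proof
  fix X :: "nat \<Rightarrow> 'a l2" assume X: "Cauchy X"
  have "\<exists>N. \<forall>m\<ge>N. \<forall>n\<ge>N. norm (X m - X n) < e" if "e > 0" for e
  proof -
    show ?thesis using CauchyD[OF X that] .
  qed
  then obtain L where L: "\<forall>e>0. \<exists>N. \<forall>m\<ge>N. norm (X m - L) \<le> e" using Cauchy_l2_convergent by blast
  have "X \<longlonglongrightarrow> L"
    unfolding tendsto_iff eventually_sequentially dist_l2_def
  proof (intro allI impI)
    fix e :: real assume "e > 0"
    thus "\<exists>N. \<forall>n\<ge>N. norm (X n - L) < e" using L[rule_format, of "e / 2"] by force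
  qed
  thus "convergent X" by (auto simp: convergent_def)
qed

instantiation l2 :: (complex_hilbert_space) complex_hilbert_space
begin

lift_definition cscale_l2 :: "complex \<Rightarrow> 'a l2 \<Rightarrow> 'a l2" is "\<lambda>c f n. c *\<^sub>C f n"
  subgoal for c f by (rule summable_norm_sq_scale[of f _ "cmod c"]) auto
  done
lift_definition cinner_l2 :: "'a l2 \<Rightarrow> 'a l2 \<Rightarrow> complex" is "\<lambda>f g. \<Sum>n. cinner (f n) (g n)" .
instance
proof
  fix x y z :: "'a l2" and a :: real and c d :: complex
  show "c *\<^sub>C (x + y) = c *\<^sub>C x + c *\<^sub>C y" "(c + d) *\<^sub>C x = c *\<^sub>C x + d *\<^sub>C x"
    "c *\<^sub>C d *\<^sub>C x = (c * d) *\<^sub>C x" "complex_of_real a *\<^sub>C x = a *\<^sub>R x"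
    by (transfer; simp add: cscale_add_right cscale_add_left cscale_cscale cscale_of_real)+
  show "cinner x y = cnj (cinner y x)"
    by transfer (subst bounded_linear.suminf[OF bounded_linear_cnj],
      auto intro!: summable_cinner simp flip: cinner_commute)
  show "cinner x (y + z) = cinner x y + cinner x z"
    by transfer (simp add: cinner_add_right suminf_add summable_cinner)
  show "cinner x (c *\<^sub>C y) = c * cinner x y"
    by transfer (simp add: cinner_cscale_right suminf_mult summable_cinner)
  show "cinner x x = complex_of_real ((norm x)\<^sup>2)"
    by transfer (simp add: cinner_self suminf_nonneg suminf_of_real del: of_real_power)
qed

end


lemma bounded_linear_coord: "bounded_linear (\<lambda>z. coord z k)"
  by (rule bounded_linear_intro[of _ 1])
    (auto simp: plus_l2.rep_eq scaleR_l2.rep_eq norm_coord_le)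

lemma l2_eqI: "(\<And>k. coord y k = coord z k) \<Longrightarrow> y = z"
  by (simp add: coord_inject[symmetric] fun_eq_iff)

definition at_l2 :: "nat \<Rightarrow> 'h::complex_hilbert_space \<Rightarrow> 'h l2" where
  "at_l2 j x = Abs_l2 (\<lambda>k. if k = j then x else 0)"

definition amp :: "('h::complex_hilbert_space \<Rightarrow> 'h) \<Rightarrow> 'h l2 \<Rightarrow> 'h l2" where
  "amp T z = Abs_l2 (\<lambda>k. T (coord z k))"

lemma coord_at_l2: "coord (at_l2 j x) k = (if k = j then x else 0)"
proof -
  have "summable (\<lambda>n. (norm (if n = j then x else 0))\<^sup>2)"
    by (rule summable_finite[of "{j}"]) auto
  thus ?thesis by (simp add: at_l2_def Abs_l2_inverse)
qed

lemma norm_at_l2: "norm (at_l2 j x) = norm x"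
proof -
  have "(\<Sum>n. (norm (coord (at_l2 j x) n))\<^sup>2) = (\<Sum>n\<in>{j}. (norm (coord (at_l2 j x) n))\<^sup>2)"
    by (rule suminf_finite) (auto simp: coord_at_l2)
  thus ?thesis by (simp add: norm_l2.rep_eq coord_at_l2)
qed

lemma bounded_linear_at_l2: "bounded_linear (at_l2 j)"
  by (rule bounded_linear_intro[of _ 1])
    (auto intro!: l2_eqI simp: coord_at_l2 plus_l2.rep_eq scaleR_l2.rep_eq norm_at_l2)

lemma at_l2_cscale: "at_l2 j (c *\<^sub>C x) = c *\<^sub>C at_l2 j x"
  by (rule l2_eqI) (simp add: coord_at_l2 cscale_l2.rep_eq)

lemma coord_sum: "coord (\<Sum>i\<in>I. f i) k = (\<Sum>i\<in>I. coord (f i) k)"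
  by (rule linear_sum[OF bounded_linear.linear[OF bounded_linear_coord]])

lemma l2_finite_sum:
  assumes "\<And>k. k \<ge> n \<Longrightarrow> coord z k = 0"
  shows "z = (\<Sum>j<n. at_l2 j (coord z j))"
proof (rule l2_eqI)
  fix k
  have "coord (\<Sum>j<n. at_l2 j (coord z j)) k = (\<Sum>j<n. if j = k then coord z j else 0)"
    by (simp add: coord_sum coord_at_l2 eq_commute)
  thus "coord z k = coord (\<Sum>j<n. at_l2 j (coord z j)) k" using assms[of k] by auto
qed

lemma cinner_l2_coord: "cinner y z = (\<Sum>k. cinner (coord y k) (coord z k))"
  by (rule cinner_l2.rep_eq)

lemma coord_amp: assumes "bop T" shows "coord (amp T z) k = T (coord z k)"
proof -
  obtain K where K: "\<And>x. norm (T x) \<le> K * norm x" using bop_bound[OF assms] by blast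
  have "summable (\<lambda>n. (norm (T (coord z n)))\<^sup>2)"
    by (rule summable_norm_sq_scale[of "coord z" _ K]) (use coord[of z] K in auto)
  thus ?thesis by (simp add: amp_def Abs_l2_inverse)
qed

lemma bop_amp: assumes "bop T" shows "bop (amp T)"
proof -
  obtain K where K: "K \<ge> 0" "\<And>x. norm (T x) \<le> K * norm x" using bop_bound[OF assms] by blast
  have "norm (amp T z) \<le> K * norm z" for z
  proof (rule norm_l2_leI)
    fix N
    have "(\<Sum>n<N. (norm (coord (amp T z) n))\<^sup>2) \<le> (\<Sum>n<N. (K * norm (coord z n))\<^sup>2)"
      by (intro sum_mono power_mono) (auto simp: coord_amp[OF assms] K)
    also have "\<dots> = K\<^sup>2 * (\<Sum>n<N. (norm (coord z n))\<^sup>2)" by (simp add: power_mult_distrib sum_distrib_left)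
    also have "\<dots> \<le> K\<^sup>2 * (norm z)\<^sup>2" by (intro mult_left_mono coord_sum_le) simp
    finally show "(\<Sum>n<N. (norm (coord (amp T z) n))\<^sup>2) \<le> (K * norm z)\<^sup>2"
      by (simp add: power_mult_distrib)
  qed (simp add: K)
  moreover have "amp T (y + z) = amp T y + amp T z" "amp T (c *\<^sub>C z) = c *\<^sub>C amp T z" for y z c
    by (rule l2_eqI, simp add: coord_amp[OF assms] plus_l2.rep_eq cscale_l2.rep_eq
        bop_add[OF assms] bop_cscale[OF assms])+
  ultimately show ?thesis by (intro bopI)
qed

lemma amp_at_l2: "bop T \<Longrightarrow> amp T (at_l2 j x) = at_l2 j (T x)"
  by (rule l2_eqI) (simp add: coord_amp coord_at_l2 bop_zero)

definition slices :: "(nat \<Rightarrow> 'h::complex_hilbert_space set) \<Rightarrow> 'h l2 set" where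
  "slices W = {z. \<forall>k. coord z k \<in> W k}"

lemma slicesD: "z \<in> slices W \<Longrightarrow> coord z k \<in> W k"
  by (simp add: slices_def)

lemma closed_csubspace_slices:
  assumes "\<And>k. closed_csubspace (W k)" shows "closed_csubspace (slices W)"
proof -
  have "closed_csubspace {z. coord z k \<in> W k}" for k
    by (rule closed_csubspace_vimage[OF bounded_linear_coord _ assms]) (simp add: cscale_l2.rep_eq)
  hence "closed_csubspace (\<Inter>k. {z. coord z k \<in> W k})"
    by (auto simp: closed_csubspace_def intro!: complex_vector.subspace_Inter)
  moreover have "(\<Inter>k. {z. coord z k \<in> W k}) = slices W" by (auto simp: slices_def)
  ultimately show ?thesis by simp
qed

lemma closed_csubspace_UNIV: "closed_csubspace (UNIV :: 'h::complex_hilbert_space set)"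
  by (simp add: closed_csubspace_def complex_vector.subspace_UNIV)

lemma finite_dim_image:
  assumes "finite_dim M" "\<And>x y. g (x + y) = g x + g y" "\<And>c x. g (c *\<^sub>C x) = c *\<^sub>C g x"
  shows "finite_dim (g ` M)"
proof -
  obtain B where B: "finite B" "M = complex_vector.span B" using assms(1) by (auto simp: finite_dim_def)
  have g0: "g 0 = 0" using assms(3)[of 0 0] by simp
  have "B \<subseteq> {x. g x \<in> complex_vector.span (g ` B)}" by (auto intro: complex_vector.span_base)
  moreover have "complex_vector.subspace {x. g x \<in> complex_vector.span (g ` B)}"
    by (rule complex_vector.subspaceI)
      (auto simp: assms g0 complex_vector.span_zero complex_vector.span_add complex_vector.span_scale)
  ultimately have 1: "g ` M \<subseteq> complex_vector.span (g ` B)"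
    using complex_vector.span_minimal B(2) by blast
  have "complex_vector.subspace (g ` M)"
  proof (rule complex_vector.subspaceI)
    show "0 \<in> g ` M" using g0 B(2) complex_vector.span_zero by (metis imageI)
  next
    fix x y assume "x \<in> g ` M" "y \<in> g ` M"
    thus "x + y \<in> g ` M" using assms(2) B(2) complex_vector.span_add by (smt (verit) image_iff)
  next
    fix c x assume "x \<in> g ` M"
    thus "c *\<^sub>C x \<in> g ` M" using assms(3) B(2) complex_vector.span_scale by (smt (verit) image_iff)
  qed
  hence "complex_vector.span (g ` B) \<subseteq> g ` M"
    using complex_vector.span_superset[of B] B(2) by (intro complex_vector.span_minimal) auto
  with 1 show ?thesis using B(1) by (auto simp: finite_dim_def intro!: exI[of _ "g ` B"])
qed

lemma finite_dim_plus:
  assumes "finite_dim M" "finite_dim N" shows "finite_dim {x + y |x y. x \<in> M \<and> y \<in> N}"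
proof -
  obtain B C where "finite B" "M = complex_vector.span B" "finite C" "N = complex_vector.span C"
    using assms by (auto simp: finite_dim_def)
  thus ?thesis unfolding finite_dim_def
    by (intro exI[of _ "B \<union> C"]) (auto simp: complex_vector.span_Un)
qed

lemma finite_dim_slices:
  fixes M :: "'h::complex_hilbert_space set"
  assumes "finite_dim M"
  shows "finite_dim (slices (\<lambda>k. if k < n then M else {0}))"
proof (induction n)
  case 0
  have "slices (\<lambda>k. if k < 0 then M else {0}) = {0}"
    by (auto simp: slices_def coord_inject[symmetric] zero_l2.rep_eq fun_eq_iff)
  moreover have "finite_dim {0 :: 'h l2}"
    unfolding finite_dim_def by (rule exI[of _ "{}"]) simp
  ultimately show ?case by simp
next
  case (Suc n)
  let ?M = "\<lambda>n. slices (\<lambda>k. if k < n then M else {0})"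
  have M0: "0 \<in> M" using assms finite_dim_closed_csubspace closed_csubspaceD(3) by blast
  have "?M (Suc n) = {x + y |x y. x \<in> ?M n \<and> y \<in> at_l2 n ` M}"
  proof (intro equalityI subsetI)
    fix z assume z: "z \<in> ?M (Suc n)"
    have "coord (z - at_l2 n (coord z n)) k \<in> (if k < n then M else {0})" for k
      using z[unfolded slices_def, simplified, rule_format, of k]
      by (cases "k = n") (auto simp: minus_l2.rep_eq coord_at_l2 split: if_splits)
    hence "z - at_l2 n (coord z n) \<in> ?M n" by (simp add: slices_def)
    moreover have "coord z n \<in> M" using slicesD[OF z, of n] by simp
    ultimately show "z \<in> {x + y |x y. x \<in> ?M n \<and> y \<in> at_l2 n ` M}"
      by (intro CollectI exI[of _ "z - at_l2 n (coord z n)"] exI[of _ "at_l2 n (coord z n)"]) auto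
  next
    fix z assume "z \<in> {x + y |x y. x \<in> ?M n \<and> y \<in> at_l2 n ` M}"
    then obtain x m where z: "z = x + at_l2 n m" "x \<in> ?M n" "m \<in> M" by blast
    have "coord z k \<in> (if k < Suc n then M else {0})" for k
      using z(2)[unfolded slices_def, simplified, rule_format, of k] z(3)
      by (cases "k = n") (auto simp: z(1) plus_l2.rep_eq coord_at_l2 split: if_splits)
    thus "z \<in> ?M (Suc n)" by (simp add: slices_def)
  qed
  moreover have "finite_dim (at_l2 n ` M)"
    by (rule finite_dim_image[OF assms])
      (auto simp: at_l2_cscale linear_add[OF bounded_linear.linear[OF bounded_linear_at_l2]])
  ultimately show ?case using finite_dim_plus[OF Suc.IH] by simp
qed


section \<open>The projection onto the least cyclic coinvariant subspace\<close>

context edge_system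
begin

text \<open>The relations hold in each coordinate.  For the totality of the ranges, a vector orthogonal to them
  is annihilated by all adjoints, hence so is each of its coordinates.\<close>
lemma edge_system_amp: "edge_system E (\<lambda>i e. amp (S i e)) (\<lambda>i e. amp (Sa i e)) V (\<lambda>v. amp (P v))"
proof
  fix e f i j v and x y :: "'h l2"
  note c = coord_amp[OF bop_S] coord_amp[OF bop_Sa] coord_amp[OF bop_P]
  show "e \<in> E i \<Longrightarrow> bop (amp (S i e))" by (simp add: bop_amp bop_S)
  show "v \<in> V \<Longrightarrow> bop (amp (P v))" by (simp add: bop_amp bop_P)
  show "e \<in> E i \<Longrightarrow> cinner (amp (S i e) x) y = cinner x (amp (Sa i e) y)"
    by (simp add: cinner_l2_coord c S_adjoint)
  show "v \<in> V \<Longrightarrow> cinner (amp (P v) x) y = cinner x (amp (P v) y)"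
    by (simp add: cinner_l2_coord c P_selfadjoint)
  show "v \<in> V \<Longrightarrow> amp (P v) (amp (P v) x) = amp (P v) x"
    by (rule l2_eqI) (simp add: c P_idem)
  show "\<exists>v\<in>V. \<forall>x. amp (Sa i e) (amp (S i e) x) = amp (P v) x" if e: "e \<in> E i"
  proof -
    obtain v where "v \<in> V" "\<And>x. Sa i e (S i e x) = P v x" using Sa_S_same[OF e] by blast
    thus ?thesis using e by (intro bexI[of _ v]) (auto intro!: l2_eqI simp: c)
  qed
  show "amp (Sa i e) (amp (S i f) x) = 0" if "e \<in> E i" "f \<in> E i" "e \<noteq> f"
    using that by (intro l2_eqI) (simp add: c Sa_S_diff zero_l2.rep_eq)
  show "(\<forall>x. amp (P v) (amp (S i e) x) = amp (S i e) x) \<or> (\<forall>x. amp (P v) (amp (S i e) x) = 0)"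
    if "v \<in> V" "e \<in> E i"
    using P_S[OF that] that by (auto intro!: l2_eqI simp: c zero_l2.rep_eq)
  show "(\<forall>x. amp (S i e) (amp (S j f) x) = 0) \<or>
      (\<exists>f'\<in>E j. \<exists>e'\<in>E i. \<forall>x. amp (S i e) (amp (S j f) x) = amp (S j f') (amp (S i e') x))"
    if ef: "e \<in> E i" "f \<in> E j"
    using S_commute[OF ef]
  proof
    assume "\<forall>x. S i e (S j f x) = 0"
    thus ?thesis using ef by (auto intro!: l2_eqI simp: c zero_l2.rep_eq)
  next
    assume "\<exists>f'\<in>E j. \<exists>e'\<in>E i. \<forall>x. S i e (S j f x) = S j f' (S i e' x)"
    then obtain f' e' where "f' \<in> E j" "e' \<in> E i" "\<And>x. S i e (S j f x) = S j f' (S i e' x)" by blast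
    hence "\<forall>x. amp (S i e) (amp (S j f) x) = amp (S j f') (amp (S i e') x)"
      using ef by (auto intro!: l2_eqI simp: c)
    thus ?thesis using \<open>f' \<in> E j\<close> \<open>e' \<in> E i\<close> by blast
  qed
  show "closed_cspan {amp (S i e) x |e x. e \<in> E i} = UNIV"
  proof (rule closed_csubspace_eq_UNIV[OF closed_cspan_closed_csubspace])
    fix z assume z: "z \<in> orth_compl (closed_cspan {amp (S i e) x |e x. e \<in> E i})"
    have Sa0: "amp (Sa i e) z = 0" if e: "e \<in> E i" for e
    proof (rule cinner_ext)
      fix w
      have "amp (S i e) w \<in> closed_cspan {amp (S i e) x |e x. e \<in> E i}"
        by (rule subsetD[OF closed_cspan_superset]) (use e in blast)
      hence "cinner (amp (S i e) w) z = 0" using z by (auto simp: orth_compl_def)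
      thus "cinner w (amp (Sa i e) z) = cinner w 0" using e by (simp add: cinner_l2_coord c S_adjoint zero_l2.rep_eq)
    qed
    have "coord z k = 0" for k
    proof -
      have "S i e x \<in> orth_compl {coord z k}" if e: "e \<in> E i" for e x
      proof -
        have "Sa i e (coord z k) = 0" using Sa0[OF e] e by (metis c(2) zero_l2.rep_eq)
        thus ?thesis using e by (subst orth_compl_def) (simp add: cinner_commute[of "coord z k"] S_adjoint)
      qed
      hence "closed_cspan {S i e x |e x. e \<in> E i} \<subseteq> orth_compl {coord z k}"
        by (intro closed_cspan_minimal orth_compl_closed_csubspace) auto
      hence "coord z k \<in> orth_compl {coord z k}" using S_total[of i] by auto
      thus ?thesis by (simp add: orth_compl_def)
    qed
    thus "z = 0" by (intro l2_eqI) (simp add: zero_l2.rep_eq)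
  qed
qed

lemma coinvariant_zero: "coinvariant {0}"
  by (auto simp: coinvariant_def closed_csubspace_zero bop_zero[OF bop_Sa] bop_zero[OF bop_P])

lemma coinvariant_UNIV: "coinvariant UNIV"
  by (simp add: coinvariant_def closed_csubspace_UNIV)

lemma orth_proj_slices:
  fixes M :: "'h set"
  assumes "finite_dim M"
  shows "coord (orth_proj (slices (\<lambda>k. if k < n then M else {0})) y) k =
    (if k < n then orth_proj M (coord y k) else 0)"
proof -
  let ?Mn = "slices (\<lambda>k. if k < n then M else {0})"
  have M: "closed_csubspace M" by (rule finite_dim_closed_csubspace[OF assms])
  define w where "w = (\<Sum>j<n. at_l2 j (orth_proj M (coord y j)))"
  have w: "coord w k = (if k < n then orth_proj M (coord y k) else 0)" for k
  proof -
    have "coord w k = (\<Sum>j<n. if j = k then orth_proj M (coord y j) else 0)"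
      by (simp add: w_def coord_sum coord_at_l2 eq_commute)
    thus ?thesis by auto
  qed
  have "orth_proj ?Mn y = w"
  proof (rule orth_proj_unique)
    show "closed_csubspace ?Mn" using M closed_csubspace_zero by (intro closed_csubspace_slices) auto
    show "w \<in> ?Mn" by (auto simp: slices_def w orth_proj(1)[OF M])
    have "cinner (coord z k) (coord (y - w) k) = 0" if "z \<in> ?Mn" for z k
      using that[unfolded slices_def, simplified, rule_format, of k] orth_proj(2)[OF M, of "coord y k"]
      by (auto simp: w minus_l2.rep_eq orth_compl_def split: if_splits)
    thus "y - w \<in> orth_compl ?Mn" by (simp add: orth_compl_def cinner_l2_coord)
  qed
  thus ?thesis by (simp add: w)
qed

text \<open>The ampliated form of the statement that the projection onto \<open>M\<close> maps coinvariant subspaces into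
  themselves.  The leastness of \<open>M\<close> is used for the slices \<open>{x. at_l2 j x \<in> L'}\<close> of a finite-dimensional
  coinvariant \<open>L'\<close> whose orbit span contains that of \<open>Mn\<close>: by \<open>coinvariant_subset_orbit_span_Int\<close>, applied to
  the \<open>j\<close>-th copy of the space, these slices are cyclic, so they contain \<open>M\<close>.\<close>
lemma orth_proj_slices_coinvariant:
  assumes M: "least_cyclic M"
    and L: "edge_system.coinvariant E (\<lambda>i e. amp (Sa i e)) V (\<lambda>v. amp (P v)) L"
    and Ln: "L \<subseteq> slices (\<lambda>k. if k < n then UNIV else {0})"
    and y: "y \<in> L"
  shows "orth_proj (slices (\<lambda>k. if k < n then M else {0})) y \<in> L"
proof -
  interpret amp: edge_system E "\<lambda>i e. amp (S i e)" "\<lambda>i e. amp (Sa i e)" V "\<lambda>v. amp (P v)"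
    by (rule edge_system_amp)
  note c = coord_amp[OF bop_S] coord_amp[OF bop_Sa] coord_amp[OF bop_P]
  have Mco: "coinvariant M" and Mfin: "finite_dim M" and Mcyc: "orbit_span M = UNIV"
    and Mleast: "\<And>L. coinvariant L \<Longrightarrow> orbit_span L = UNIV \<Longrightarrow> M \<subseteq> L"
    using M by (auto simp: least_cyclic_def)
  have slices_co: "amp.coinvariant (slices W)" if W: "\<And>k. coinvariant (W k)" for W
    unfolding amp.coinvariant_def
  proof (intro conjI allI ballI)
    show "closed_csubspace (slices W)" using W coinvariantD(1) by (intro closed_csubspace_slices) blast
  next
    fix i e z assume "e \<in> E i" "z \<in> slices W"
    thus "amp (Sa i e) z \<in> slices W" using coinvariantD(2)[OF W] by (simp add: slices_def c)
  next
    fix v z assume "v \<in> V" "z \<in> slices W"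
    thus "amp (P v) z \<in> slices W" using coinvariantD(3)[OF W] by (simp add: slices_def c)
  qed
  define Mn where "Mn = slices (\<lambda>k. if k < n then M else {0})"
  have Mn_co: "amp.coinvariant Mn"
    unfolding Mn_def by (intro slices_co) (simp add: Mco coinvariant_zero)
  have Mn_fin: "finite_dim Mn" unfolding Mn_def by (rule finite_dim_slices[OF Mfin])
  have Mn_closed: "closed_csubspace Mn" by (rule finite_dim_closed_csubspace[OF Mn_fin])
  have at_vimage: "closed_csubspace {x. at_l2 j x \<in> W}" if "closed_csubspace W" for j W
    by (rule closed_csubspace_vimage[OF bounded_linear_at_l2 at_l2_cscale that])
  have at_Mn: "at_l2 j x \<in> amp.orbit_span Mn" if j: "j < n" for j x
  proof -
    have "invariant {x. at_l2 j x \<in> amp.orbit_span Mn}"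
      unfolding invariant_def
      using amp.invariant_orbit_span[of Mn] at_vimage[OF amp.closed_csubspace_orbit_span]
      by (auto simp: amp.invariant_def bop_S simp flip: amp_at_l2)
    moreover have "M \<subseteq> {x. at_l2 j x \<in> amp.orbit_span Mn}"
    proof safe
      fix m assume "m \<in> M"
      hence "at_l2 j m \<in> Mn"
        using j coinvariantD(1)[OF Mco] by (auto simp: Mn_def slices_def coord_at_l2 closed_csubspaceD)
      thus "at_l2 j m \<in> amp.orbit_span Mn" using amp.subset_orbit_span by blast
    qed
    ultimately show ?thesis using orbit_span_least Mcyc by blast
  qed
  have Hn: "slices (\<lambda>k. if k < n then UNIV else {0}) \<subseteq> amp.orbit_span Mn"
  proof
    fix z :: "'h l2" assume z: "z \<in> slices (\<lambda>k. if k < n then UNIV else {0})"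
    have "coord z k = 0" if "k \<ge> n" for k using slicesD[OF z, of k] that by simp
    hence "z = (\<Sum>j<n. at_l2 j (coord z j))" by (rule l2_finite_sum)
    also have "\<dots> \<in> amp.orbit_span Mn"
      using at_Mn closed_csubspaceD(1)[OF amp.closed_csubspace_orbit_span]
      by (intro complex_vector.subspace_sum) auto
    finally show "z \<in> amp.orbit_span Mn" .
  qed
  \<comment> \<open>the slices of \<open>L'\<close> are cyclic, hence contain \<open>M\<close>\<close>
  have Mn_least: "Mn \<subseteq> L'" if L': "amp.coinvariant L'" "finite_dim L'" "amp.orbit_span Mn \<subseteq> amp.orbit_span L'" for L'
  proof -
    have "M \<subseteq> {x. at_l2 j x \<in> L'}" if j: "j < n" for j
    proof (rule Mleast)
      show "coinvariant {x. at_l2 j x \<in> L'}"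
        unfolding coinvariant_def
        using at_vimage[OF amp.coinvariantD(1)[OF L'(1)]] amp.coinvariantD(2,3)[OF L'(1)]
        by (auto simp: bop_Sa bop_P simp flip: amp_at_l2)
      let ?R = "slices (\<lambda>k. if k = j then UNIV else {0 :: 'h})"
      have "amp.coinvariant ?R" by (intro slices_co) (simp add: coinvariant_UNIV coinvariant_zero)
      moreover have "?R \<subseteq> slices (\<lambda>k. if k < n then UNIV else {0})"
        using j by (force simp: slices_def split: if_splits)
      hence "?R \<subseteq> amp.orbit_span L'" using Hn L'(3) by blast
      ultimately have 1: "?R \<subseteq> amp.orbit_span (?R \<inter> L')"
        by (rule amp.coinvariant_subset_orbit_span_Int[OF L'(1,2)])
      let ?K = "{z. coord z j \<in> orbit_span {x. at_l2 j x \<in> L'}}"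
      have 2: "amp.orbit_span (?R \<inter> L') \<subseteq> ?K"
      proof (rule amp.orbit_span_least)
        show "amp.invariant ?K"
          unfolding amp.invariant_def
          using closed_csubspace_vimage[OF bounded_linear_coord _ closed_csubspace_orbit_span]
            invariant_orbit_span
          by (auto simp: invariant_def c cscale_l2.rep_eq)
        show "?R \<inter> L' \<subseteq> ?K"
        proof safe
          fix z assume z: "z \<in> ?R" "z \<in> L'"
          have "z = at_l2 j (coord z j)"
          proof (rule l2_eqI)
            fix k show "coord z k = coord (at_l2 j (coord z j)) k"
              using slicesD[OF z(1), of k] by (cases "k = j") (auto simp: coord_at_l2)
          qed
          hence "coord z j \<in> {x. at_l2 j x \<in> L'}" using z(2) by simp
          thus "coord z j \<in> orbit_span {x. at_l2 j x \<in> L'}" by (rule subsetD[OF subset_orbit_span])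
        qed
      qed
      have "x \<in> orbit_span {x. at_l2 j x \<in> L'}" for x
      proof -
        have "at_l2 j x \<in> ?R" by (simp add: slices_def coord_at_l2)
        hence "at_l2 j x \<in> ?K" using 1 2 by blast
        thus ?thesis by (simp add: coord_at_l2)
      qed
      thus "orbit_span {x. at_l2 j x \<in> L'} = UNIV" by blast
    qed
    note at_L' = this
    show ?thesis
    proof
      fix z assume z: "z \<in> Mn"
      have "coord z k = 0" if "k \<ge> n" for k using slicesD[OF z[unfolded Mn_def], of k] that by simp
      hence "z = (\<Sum>j<n. at_l2 j (coord z j))" by (rule l2_finite_sum)
      also have "\<dots> \<in> L'"
      proof (rule complex_vector.subspace_sum)
        show "complex_vector.subspace L'" using closed_csubspaceD(1)[OF amp.coinvariantD(1)[OF L'(1)]] .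
        fix j assume "j \<in> {..<n}"
        moreover from this have "coord z j \<in> M" using slicesD[OF z[unfolded Mn_def], of j] by simp
        ultimately show "at_l2 j (coord z j) \<in> L'" using at_L' by blast
      qed
      finally show "z \<in> L'" .
    qed
  qed
  define N where "N = L \<inter> Mn"
  define K where "K = amp.orbit_span N"
  have N_co: "amp.coinvariant N" unfolding N_def by (rule amp.coinvariant_Int[OF L Mn_co])
  have N_sub: "complex_vector.subspace N" using closed_csubspaceD(1)[OF amp.coinvariantD(1)[OF N_co]] .
  have N_fin: "finite_dim N"
    using finite_dim_subspace(1)[OF Mn_fin N_sub] by (simp add: N_def)
  have K: "closed_csubspace K" by (simp add: K_def amp.closed_csubspace_orbit_span)
  have K_co: "amp.coinvariant K" unfolding K_def by (rule amp.coinvariant_orbit_span[OF N_co])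
  have Kc_co: "amp.coinvariant (orth_compl K)"
    using amp.coinvariant_orth_compl[OF amp.invariant_orbit_span, of N] amp.coinvariantD(3)[OF K_co]
    by (simp add: K_def)
  let ?g = "\<lambda>m. m - orth_proj K m"
  have proj_comm: "T (?g m) = ?g (T m)" if "bop T" "\<And>x. x \<in> K \<Longrightarrow> T x \<in> K"
      "\<And>x. x \<in> orth_compl K \<Longrightarrow> T x \<in> orth_compl K" for T m
  proof -
    have "orth_proj K (T m) = T (orth_proj K m)"
      using that orth_proj[OF K, of m] by (intro orth_proj_unique[OF K]) (auto simp flip: bop_diff[OF that(1)])
    thus ?thesis by (simp add: bop_diff[OF that(1)])
  qed
  \<comment> \<open>replacing in \<open>Mn\<close> the part inside the reducing subspace \<open>K\<close> by \<open>N\<close> keeps the orbit span\<close>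
  define L' where "L' = {a + b |a b. a \<in> N \<and> b \<in> ?g ` Mn}"
  have L'_fin: "finite_dim L'"
    unfolding L'_def
    by (intro finite_dim_plus[OF N_fin] finite_dim_image[OF Mn_fin])
      (auto simp: orth_proj_add[OF K] orth_proj_cscale[OF K] complex_vector.scale_right_diff_distrib)
  have L'_co: "amp.coinvariant L'"
    unfolding amp.coinvariant_def
  proof (intro conjI allI ballI)
    show "closed_csubspace L'" by (rule finite_dim_closed_csubspace[OF L'_fin])
  next
    fix i e z assume e: "e \<in> E i" and "z \<in> L'"
    then obtain a m where z: "z = a + ?g m" "a \<in> N" "m \<in> Mn" by (auto simp: L'_def)
    have "amp (Sa i e) z = amp (Sa i e) a + ?g (amp (Sa i e) m)"
      unfolding z(1) bop_add[OF amp.bop_Sa[OF e]]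
      using amp.coinvariantD(2)[OF K_co e] amp.coinvariantD(2)[OF Kc_co e]
      by (subst proj_comm[OF amp.bop_Sa[OF e]]) auto
    thus "amp (Sa i e) z \<in> L'"
      using amp.coinvariantD(2)[OF N_co e z(2)] amp.coinvariantD(2)[OF Mn_co e z(3)] by (auto simp: L'_def)
  next
    fix v z assume v: "v \<in> V" and "z \<in> L'"
    then obtain a m where z: "z = a + ?g m" "a \<in> N" "m \<in> Mn" by (auto simp: L'_def)
    have "amp (P v) z = amp (P v) a + ?g (amp (P v) m)"
      unfolding z(1) bop_add[OF amp.bop_P[OF v]]
      using amp.coinvariantD(3)[OF K_co v] amp.coinvariantD(3)[OF Kc_co v]
      by (subst proj_comm[OF amp.bop_P[OF v]]) auto
    thus "amp (P v) z \<in> L'"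
      using amp.coinvariantD(3)[OF N_co v z(2)] amp.coinvariantD(3)[OF Mn_co v z(3)] by (auto simp: L'_def)
  qed
  have "Mn \<subseteq> amp.orbit_span L'"
  proof
    fix m assume m: "m \<in> Mn"
    have "?g 0 = 0" using orth_proj_id[OF K closed_csubspaceD(3)[OF K]] by simp
    hence g0: "0 \<in> ?g ` Mn" using closed_csubspaceD(3)[OF Mn_closed] by (metis imageI)
    have "N \<subseteq> L'"
    proof
      fix a assume "a \<in> N"
      thus "a \<in> L'" unfolding L'_def using g0 by (intro CollectI exI[of _ a] exI[of _ 0]) simp
    qed
    hence "K \<subseteq> amp.orbit_span L'"
      unfolding K_def using amp.orbit_span_least[OF amp.invariant_orbit_span] amp.subset_orbit_span by blast
    hence 1: "orth_proj K m \<in> amp.orbit_span L'" using orth_proj(1)[OF K] by blast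
    have "?g m \<in> L'"
      unfolding L'_def using m complex_vector.subspace_0[OF N_sub]
      by (intro CollectI exI[of _ 0] exI[of _ "?g m"]) simp
    hence "?g m \<in> amp.orbit_span L'" using amp.subset_orbit_span by blast
    from closed_csubspaceD(4)[OF amp.closed_csubspace_orbit_span this 1]
    show "m \<in> amp.orbit_span L'" by simp
  qed
  hence "amp.orbit_span Mn \<subseteq> amp.orbit_span L'" by (rule amp.orbit_span_least[OF amp.invariant_orbit_span])
  hence Mn_L': "Mn \<subseteq> L'" by (rule Mn_least[OF L'_co L'_fin])
  have proj_K_Mn: "orth_proj K m \<in> N" if "m \<in> Mn" for m
  proof -
    have "m \<in> L'" using that Mn_L' by blast
    then obtain a m' where m: "m = a + ?g m'" "a \<in> N" by (auto simp: L'_def)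
    have "orth_proj K (?g m') = 0" by (intro orth_proj_compl orth_proj K)
    moreover have "orth_proj K a = a"
      using m(2) amp.subset_orbit_span[of N] by (intro orth_proj_id[OF K]) (auto simp: K_def)
    ultimately show ?thesis using m by (simp add: orth_proj_add[OF K])
  qed
  have yK: "y \<in> K"
    using amp.coinvariant_subset_orbit_span_Int[OF Mn_co Mn_fin L] Ln Hn y by (auto simp: K_def N_def)
  let ?z = "orth_proj Mn y"
  have z: "?z \<in> Mn" by (rule orth_proj(1)[OF Mn_closed])
  let ?a = "orth_proj K ?z"
  have a: "?a \<in> N" by (rule proj_K_Mn[OF z])
  have d: "?z - ?a \<in> Mn" using z a closed_csubspaceD(5)[OF Mn_closed] by (auto simp: N_def)
  have orth: "cinner (?z - ?a) u = 0" if "u \<in> K" for u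
    using that orth_proj(2)[OF K, of ?z] by (subst cinner_commute) (auto simp: orth_compl_def)
  have "cinner (?z - ?a) ?z = cinner (?z - ?a) y" by (rule orth_proj_cinner(1)[OF Mn_closed d])
  also have "\<dots> = 0" by (rule orth[OF yK])
  finally have "cinner (?z - ?a) (?z - ?a) = 0"
    using orth[OF orth_proj(1)[OF K, of ?z]] by (simp only: cinner_diff(2)) simp
  hence "?z = ?a" by simp
  hence "?z \<in> N" using a by metis
  thus ?thesis by (simp add: N_def Mn_def)
qed

text \<open>The tuples \<open>(T (x j))\<close> with \<open>T\<close> in \<open>A\<close> have a closure \<open>Y\<close> whose complement is coinvariant, as \<open>A\<close>
  is closed under left multiplication by the \<open>S i e\<close> and \<open>P v\<close>.  The projection \<open>p\<close> of \<open>x\<close> onto the power of \<open>M\<close> lies in \<open>Y\<close>: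
  its component orthogonal to \<open>Y\<close> stays orthogonal to \<open>x \<in> Y\<close> when projected onto that power, which
  means that it is orthogonal to \<open>p\<close> itself.\<close>
lemma orth_proj_strong_approximation:
  fixes A :: "('h \<Rightarrow> 'h) set" and x :: "nat \<Rightarrow> 'h"
  assumes M: "least_cyclic M"
    and A_id: "id \<in> A"
    and A_add: "\<And>T U. T \<in> A \<Longrightarrow> U \<in> A \<Longrightarrow> (\<lambda>x. T x + U x) \<in> A"
    and A_scale: "\<And>T c. T \<in> A \<Longrightarrow> (\<lambda>x. c *\<^sub>C T x) \<in> A"
    and A_S: "\<And>T i e. T \<in> A \<Longrightarrow> e \<in> E i \<Longrightarrow> S i e \<circ> T \<in> A"
    and A_P: "\<And>T v. T \<in> A \<Longrightarrow> v \<in> V \<Longrightarrow> P v \<circ> T \<in> A"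
    and eps: "\<epsilon> > 0"
  shows "\<exists>T\<in>A. \<forall>j<n. norm (T (x j) - orth_proj M (x j)) < \<epsilon>"
proof -
  interpret amp: edge_system E "\<lambda>i e. amp (S i e)" "\<lambda>i e. amp (Sa i e)" V "\<lambda>v. amp (P v)"
    by (rule edge_system_amp)
  have Mfin: "finite_dim M" using M by (simp add: least_cyclic_def)
  let ?Hn = "slices (\<lambda>k. if k < n then UNIV else {0 :: 'h})"
  let ?Mn = "slices (\<lambda>k. if k < n then M else {0})"
  have Hn_closed: "closed_csubspace ?Hn"
    by (intro closed_csubspace_slices) (simp add: closed_csubspace_UNIV closed_csubspace_zero)
  have Mn_closed: "closed_csubspace ?Mn"
    by (rule finite_dim_closed_csubspace[OF finite_dim_slices[OF Mfin]])
  define tup where "tup T = (\<Sum>j<n. at_l2 j (T (x j)))" for T :: "'h \<Rightarrow> 'h"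
  have tup: "coord (tup T) k = (if k < n then T (x k) else 0)" for T k
  proof -
    have "coord (tup T) k = (\<Sum>j<n. if j = k then T (x j) else 0)"
      by (simp add: tup_def coord_sum coord_at_l2 eq_commute)
    thus ?thesis by auto
  qed
  define Y where "Y = closure (tup ` A)"
  have "complex_vector.subspace (tup ` A)"
  proof (rule complex_vector.subspaceI)
    have "tup (\<lambda>x. 0 *\<^sub>C id x) = 0" by (rule l2_eqI) (simp add: tup zero_l2.rep_eq)
    thus "0 \<in> tup ` A" using A_scale[OF A_id, of 0] by (metis imageI)
  next
    fix y z assume "y \<in> tup ` A" "z \<in> tup ` A"
    then obtain T U where TU: "y = tup T" "T \<in> A" "z = tup U" "U \<in> A" by blast
    hence "y + z = tup (\<lambda>x. T x + U x)" by (intro l2_eqI) (simp add: tup plus_l2.rep_eq)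
    thus "y + z \<in> tup ` A" using TU A_add by blast
  next
    fix c y assume "y \<in> tup ` A"
    then obtain T where T: "y = tup T" "T \<in> A" by blast
    hence "c *\<^sub>C y = tup (\<lambda>x. c *\<^sub>C T x)" by (intro l2_eqI) (simp add: tup cscale_l2.rep_eq)
    thus "c *\<^sub>C y \<in> tup ` A" using T A_scale by blast
  qed
  hence span_A: "complex_vector.span (tup ` A) = tup ` A" by (simp add: complex_vector.span_eq_iff)
  have Y_eq: "Y = closed_cspan (tup ` A)" unfolding Y_def closed_cspan_def span_A ..
  have Y: "closed_csubspace Y" unfolding Y_eq by (rule closed_cspan_closed_csubspace)
  have Y_inv: "amp T z \<in> Y" if T: "bop T" "\<And>U. U \<in> A \<Longrightarrow> T \<circ> U \<in> A" and z: "z \<in> Y" for T z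
  proof (rule bop_image_closed_cspan[OF bop_amp[OF T(1)] Y _ z[unfolded Y_eq]])
    fix w assume "w \<in> tup ` A"
    then obtain U where U: "w = tup U" "U \<in> A" by blast
    have "amp T w = tup (T \<circ> U)"
      by (rule l2_eqI) (simp add: U(1) tup coord_amp[OF T(1)] bop_zero[OF T(1)])
    thus "amp T w \<in> Y" using T(2)[OF U(2)] closed_cspan_superset[of "tup ` A"] by (auto simp: Y_eq)
  qed
  have Y_co: "amp.coinvariant (orth_compl Y)"
    using Y_inv[OF bop_S A_S] Y_inv[OF bop_P A_P] Y
    by (intro amp.coinvariant_orth_compl) (auto simp: amp.invariant_def)
  have "amp.coinvariant ?Hn"
    unfolding amp.coinvariant_def
    using Hn_closed
    by (auto simp: slices_def coord_amp[OF bop_Sa] coord_amp[OF bop_P] bop_zero[OF bop_Sa] bop_zero[OF bop_P])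
  hence L_co: "amp.coinvariant (orth_compl Y \<inter> ?Hn)" by (rule amp.coinvariant_Int[OF Y_co])
  let ?x = "tup id"
  have xY: "?x \<in> Y" unfolding Y_eq by (rule subsetD[OF closed_cspan_superset]) (use A_id in blast)
  let ?p = "orth_proj ?Mn ?x"
  have p: "coord ?p k = (if k < n then orth_proj M (x k) else 0)" for k
    unfolding orth_proj_slices[OF Mfin] by (simp add: tup)
  have "Y \<subseteq> ?Hn"
    unfolding Y_eq by (intro closed_cspan_minimal[OF Hn_closed]) (auto simp: slices_def tup)
  hence "orth_proj Y ?p \<in> ?Hn" using orth_proj(1)[OF Y] by blast
  moreover have "?p \<in> ?Hn" unfolding slices_def[of "\<lambda>k. if k < n then UNIV else {0}"] by (simp add: p)
  ultimately have w: "?p - orth_proj Y ?p \<in> orth_compl Y \<inter> ?Hn"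
    using orth_proj(2)[OF Y] closed_csubspaceD(5)[OF Hn_closed] by blast
  hence "orth_proj ?Mn (?p - orth_proj Y ?p) \<in> orth_compl Y \<inter> ?Hn"
    by (intro orth_proj_slices_coinvariant[OF M L_co]) auto
  hence "cinner ?x (orth_proj ?Mn (?p - orth_proj Y ?p)) = 0" using xY by (auto simp: orth_compl_def)
  hence "cinner ?p (?p - orth_proj Y ?p) = 0" by (simp add: orth_proj_cinner(3)[OF Mn_closed])
  moreover have "cinner (orth_proj Y ?p) (?p - orth_proj Y ?p) = 0"
    using w orth_proj(1)[OF Y, of ?p] by (auto simp: orth_compl_def)
  ultimately have "cinner (?p - orth_proj Y ?p) (?p - orth_proj Y ?p) = 0"
    by (simp only: cinner_diff(1)) simp
  hence "?p = orth_proj Y ?p" by simp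
  hence "?p \<in> closure (tup ` A)" using orth_proj(1)[OF Y] unfolding Y_def by metis
  then obtain T where T: "T \<in> A" "dist (tup T) ?p < \<epsilon>"
    using eps by (auto simp: closure_approachable)
  have "norm (T (x j) - orth_proj M (x j)) < \<epsilon>" if "j < n" for j
    using norm_coord_le[of "tup T - ?p" j] T(2) that by (simp add: minus_l2.rep_eq tup p dist_norm)
  thus ?thesis using T(1) by blast
qed

end


section \<open>Interior tensor products realised in a Hilbert space\<close>

definition list_val :: "('f \<Rightarrow> 'g \<Rightarrow> 'h::comm_monoid_add) \<Rightarrow> ('f \<times> 'g) list \<Rightarrow> 'h" where
  "list_val j z = (\<Sum>(\<xi>, g)\<leftarrow>z. j \<xi> g)"

definition tensor_val :: "('f \<Rightarrow> 'g \<Rightarrow> 'h) \<Rightarrow> ('f, 'g) tensor \<Rightarrow> 'h::complex_hilbert_space" where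
  "tensor_val j X = lim (\<lambda>n. list_val j (tensor_seq X n))"

lemma list_val_simps [simp]:
  "list_val j [] = 0" "list_val j ((\<xi>, g) # z) = j \<xi> g + list_val j z"
  "list_val j (z @ w) = list_val j z + list_val j w"
  by (auto simp: list_val_def)

lemma alg_tensors_simps [simp]:
  "[] \<in> alg_tensors F G"
  "(\<xi>, g) # z \<in> alg_tensors F G \<longleftrightarrow> \<xi> \<in> carr F \<and> g \<in> carr G \<and> z \<in> alg_tensors F G"
  "z @ w \<in> alg_tensors F G \<longleftrightarrow> z \<in> alg_tensors F G \<and> w \<in> alg_tensors F G"
  by (auto simp: alg_tensors_def)

lemma tilde_eq_tensor_val: "tilde A X = tensor_val A X"
  by (simp add: tilde_def tensor_val_def list_val_def)

lemma tensor_map_alg: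
  "(\<And>\<xi>. \<xi> \<in> carr F \<Longrightarrow> S \<xi> \<in> carr F') \<Longrightarrow> (\<And>g. g \<in> carr G \<Longrightarrow> T g \<in> carr G') \<Longrightarrow>
    z \<in> alg_tensors F G \<Longrightarrow> map (map_prod S T) z \<in> alg_tensors F' G'"
  by (induction z) auto

lemma carr_interior_tensor: "carr (interior_tensor F G) = tensor_cauchy F G // tensor_rel F G"
  by (simp add: interior_tensor_def)

lemma carr_interior_tensorE:
  assumes "X \<in> carr (interior_tensor F G)"
  obtains x where "x \<in> tensor_cauchy F G" "X = tensor_class F G x"
  using assms by (auto simp: carr_interior_tensor tensor_class_def elim!: quotientE)

lemma tensor_class_in_carr:
  "x \<in> tensor_cauchy F G \<Longrightarrow> tensor_class F G x \<in> carr (interior_tensor F G)"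
  by (simp add: carr_interior_tensor tensor_class_def quotientI)

lemma tensor_seq_in: "x \<in> X \<Longrightarrow> tensor_seq X \<in> X"
  unfolding tensor_seq_def by (rule someI[of "\<lambda>y. y \<in> X"])

text \<open>A balanced product \<open>j\<close> with values in a Hilbert space which reproduces the inner product of
  elementary tensors.  It extends to an isometry \<open>tensor_val j\<close> of the completed tensor product, so
  that the quotient of Cauchy sequences of lists can be forgotten.  The hypotheses on \<open>cmult F (-1)\<close>
  are there because distances of lists are formed with it.\<close>
locale tensor_realisation =
  fixes F :: "('u, 'v, 'f) corr" and G :: "('v, unit, 'g) corr"
    and j :: "'f \<Rightarrow> 'g \<Rightarrow> 'h::complex_hilbert_space"
  assumes inn_j: "\<xi> \<in> carr F \<Longrightarrow> \<eta> \<in> carr F \<Longrightarrow> g \<in> carr G \<Longrightarrow> k \<in> carr G \<Longrightarrow>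
      inn G g (lact G (inn F \<xi> \<eta>) k) () = cinner (j \<xi> g) (j \<eta> k)"
    and neg_carr: "\<xi> \<in> carr F \<Longrightarrow> cmult F (-1) \<xi> \<in> carr F"
    and neg_j: "\<xi> \<in> carr F \<Longrightarrow> g \<in> carr G \<Longrightarrow> j (cmult F (-1) \<xi>) g = - j \<xi> g"
begin

lemma alg_inn_eq:
  assumes "z \<in> alg_tensors F G" "w \<in> alg_tensors F G"
  shows "alg_inn F G z w () = cinner (list_val j z) (list_val j w)"
proof -
  have inner: "(\<Sum>(\<eta>, k)\<leftarrow>w. inn G g (lact G (inn F \<xi> \<eta>) k) ()) = cinner (j \<xi> g) (list_val j w)"
    if "\<xi> \<in> carr F" "g \<in> carr G" for \<xi> g
    using assms(2) by (induction w) (use that in \<open>auto simp: inn_j cinner_add_right\<close>)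
  show ?thesis
    using assms(1) by (induction z) (auto simp: alg_inn_def inner cinner_add_left)
qed

lemma neg_alg:
  assumes "w \<in> alg_tensors F G"
  shows "map (map_prod (cmult F (-1)) id) w \<in> alg_tensors F G"
    and "list_val j (map (map_prod (cmult F (-1)) id) w) = - list_val j w"
  using assms by (induction w) (auto simp: neg_carr neg_j)

lemma alg_dist_eq:
  assumes "z \<in> alg_tensors F G" "w \<in> alg_tensors F G"
  shows "alg_dist F G z w = norm (list_val j z - list_val j w)"
proof -
  let ?y = "z @ map (map_prod (cmult F (-1)) id) w"
  have y: "?y \<in> alg_tensors F G" using assms neg_alg by simp
  have "sup_norm (alg_inn F G ?y ?y) = cmod (alg_inn F G ?y ?y ())"
    by (simp add: sup_norm_def UNIV_unit)
  also have "\<dots> = (norm (list_val j ?y))\<^sup>2" using alg_inn_eq[OF y y] by (simp add: cinner_self norm_power)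
  also have "list_val j ?y = list_val j z - list_val j w" using neg_alg(2)[OF assms(2)] by simp
  finally show ?thesis unfolding alg_dist_def Let_def by (simp only: real_sqrt_abs abs_norm_cancel)
qed

lemma tensor_cauchy_iff:
  "x \<in> tensor_cauchy F G \<longleftrightarrow> (\<forall>n. x n \<in> alg_tensors F G) \<and> convergent (\<lambda>n. list_val j (x n))"
proof -
  have "(\<forall>e>0. \<exists>N. \<forall>m\<ge>N. \<forall>n\<ge>N. alg_dist F G (x m) (x n) < e) \<longleftrightarrow> Cauchy (\<lambda>n. list_val j (x n))"
    if "\<forall>n. x n \<in> alg_tensors F G"
    using that by (simp add: Cauchy_def alg_dist_eq dist_norm)
  thus ?thesis by (auto simp: tensor_cauchy_def Cauchy_convergent_iff)
qed

lemma tensor_class_mem: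
  assumes "\<And>n. x n \<in> alg_tensors F G" "(\<lambda>n. list_val j (x n)) \<longlonglongrightarrow> l"
  shows "y \<in> tensor_class F G x \<longleftrightarrow> (\<forall>n. y n \<in> alg_tensors F G) \<and> (\<lambda>n. list_val j (y n)) \<longlonglongrightarrow> l"
proof -
  have "y \<in> tensor_class F G x \<longleftrightarrow> y \<in> tensor_cauchy F G \<and> (\<lambda>n. alg_dist F G (x n) (y n)) \<longlonglongrightarrow> 0"
    using assms by (auto simp: tensor_class_def tensor_rel_def tensor_cauchy_iff convergent_def)
  also have "\<dots> \<longleftrightarrow> y \<in> tensor_cauchy F G \<and> (\<lambda>n. list_val j (x n) - list_val j (y n)) \<longlonglongrightarrow> 0"
    using assms(1) by (auto simp: tensor_cauchy_iff alg_dist_eq tendsto_norm_zero_iff)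
  also have "\<dots> \<longleftrightarrow> (\<forall>n. y n \<in> alg_tensors F G) \<and> (\<lambda>n. list_val j (y n)) \<longlonglongrightarrow> l"
  proof (intro iffI conjI; elim conjE)
    assume "(\<lambda>n. list_val j (x n) - list_val j (y n)) \<longlonglongrightarrow> 0"
    from tendsto_diff[OF assms(2) this] show "(\<lambda>n. list_val j (y n)) \<longlonglongrightarrow> l" by simp
  next
    assume "(\<lambda>n. list_val j (y n)) \<longlonglongrightarrow> l"
    from tendsto_diff[OF assms(2) this] show "(\<lambda>n. list_val j (x n) - list_val j (y n)) \<longlonglongrightarrow> 0" by simp
  qed (auto simp: tensor_cauchy_iff convergent_def)
  finally show ?thesis .
qed

lemma tensor_class_val:
  assumes "\<And>n. x n \<in> alg_tensors F G" "(\<lambda>n. list_val j (x n)) \<longlonglongrightarrow> l"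
  shows "tensor_class F G x \<in> carr (interior_tensor F G)" "tensor_val j (tensor_class F G x) = l"
proof -
  show "tensor_class F G x \<in> carr (interior_tensor F G)"
    using assms by (intro tensor_class_in_carr) (auto simp: tensor_cauchy_iff convergent_def)
  have "x \<in> tensor_class F G x" using tensor_class_mem[OF assms] assms by simp
  hence "tensor_seq (tensor_class F G x) \<in> tensor_class F G x" by (rule tensor_seq_in)
  thus "tensor_val j (tensor_class F G x) = l"
    unfolding tensor_class_mem[OF assms] tensor_val_def by (auto intro: limI)
qed

lemma tensor_seq_lim:
  assumes "X \<in> carr (interior_tensor F G)"
  shows "tensor_seq X n \<in> alg_tensors F G" "(\<lambda>n. list_val j (tensor_seq X n)) \<longlonglongrightarrow> tensor_val j X"
    and "X = {y. (\<forall>n. y n \<in> alg_tensors F G) \<and> (\<lambda>n. list_val j (y n)) \<longlonglongrightarrow> tensor_val j X}"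
proof -
  obtain x where x: "x \<in> tensor_cauchy F G" "X = tensor_class F G x"
    using assms by (rule carr_interior_tensorE)
  then obtain l where xl: "\<And>n. x n \<in> alg_tensors F G" "(\<lambda>n. list_val j (x n)) \<longlonglongrightarrow> l"
    by (auto simp: tensor_cauchy_iff convergent_def)
  have X: "X = {y. (\<forall>n. y n \<in> alg_tensors F G) \<and> (\<lambda>n. list_val j (y n)) \<longlonglongrightarrow> l}"
    using tensor_class_mem[OF xl] x(2) by blast
  have l: "tensor_val j X = l" unfolding x(2) by (rule tensor_class_val(2)[OF xl])
  show "X = {y. (\<forall>n. y n \<in> alg_tensors F G) \<and> (\<lambda>n. list_val j (y n)) \<longlonglongrightarrow> tensor_val j X}"
    unfolding l by (rule X)
  have "x \<in> X" using xl X by blast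
  hence "tensor_seq X \<in> X" by (rule tensor_seq_in)
  thus "tensor_seq X n \<in> alg_tensors F G" "(\<lambda>n. list_val j (tensor_seq X n)) \<longlonglongrightarrow> tensor_val j X"
    unfolding l by (subst (asm) (2) X, simp)+
qed

lemma tensor_val_inj:
  assumes "X \<in> carr (interior_tensor F G)" "Y \<in> carr (interior_tensor F G)" "tensor_val j X = tensor_val j Y"
  shows "X = Y"
  using tensor_seq_lim(3)[OF assms(1)] tensor_seq_lim(3)[OF assms(2)] assms(3) by metis

lemma inn_tensor_val:
  assumes "X \<in> carr (interior_tensor F G)" "Y \<in> carr (interior_tensor F G)"
  shows "inn (interior_tensor F G) X Y () = cinner (tensor_val j X) (tensor_val j Y)"
proof -
  have "inn (interior_tensor F G) X Y () =
      lim (\<lambda>n. cinner (list_val j (tensor_seq X n)) (list_val j (tensor_seq Y n)))"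
    by (simp add: interior_tensor_def alg_inn_eq tensor_seq_lim(1)[OF assms(1)] tensor_seq_lim(1)[OF assms(2)])
  also have "\<dots> = cinner (tensor_val j X) (tensor_val j Y)"
    by (intro limI tendsto_cinner tensor_seq_lim(2) assms)
  finally show ?thesis .
qed

lemma elem_tensor_val:
  assumes "\<xi> \<in> carr F" "g \<in> carr G"
  shows "elem_tensor F G \<xi> g \<in> carr (interior_tensor F G)" "tensor_val j (elem_tensor F G \<xi> g) = j \<xi> g"
  unfolding elem_tensor_def
  by (rule tensor_class_val[where l = "j \<xi> g"]; use assms in simp)+

lemma tensor_val_in:
  assumes "X \<in> carr (interior_tensor F G)"
  shows "tensor_val j X \<in> closed_cspan {j \<xi> g |\<xi> g. \<xi> \<in> carr F \<and> g \<in> carr G}"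
proof -
  let ?W = "closed_cspan {j \<xi> g |\<xi> g. \<xi> \<in> carr F \<and> g \<in> carr G}"
  have W: "closed_csubspace ?W" by (rule closed_cspan_closed_csubspace)
  have "list_val j z \<in> ?W" if "z \<in> alg_tensors F G" for z
    using that
  proof (induction z)
    case (Cons p z)
    obtain \<xi> g where p: "p = (\<xi>, g)" by force
    have "j \<xi> g \<in> ?W" by (rule subsetD[OF closed_cspan_superset]) (use Cons.prems p in auto)
    thus ?case using Cons closed_csubspaceD(4)[OF W] p by simp
  qed (simp add: closed_csubspaceD(3)[OF W])
  hence "list_val j (tensor_seq X n) \<in> ?W" for n using tensor_seq_lim(1)[OF assms] by blast
  thus ?thesis
    by (rule closed_sequentially[OF closed_csubspaceD(2)[OF W] _ tensor_seq_lim(2)[OF assms]])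
qed

text \<open>The isometry has closed range.  Scalars have to be absorbed by the first factor, as lists carry
  no coefficients.\<close>
lemma tensor_val_onto:
  assumes scale: "\<And>c \<xi> g. \<xi> \<in> carr F \<Longrightarrow> g \<in> carr G \<Longrightarrow> \<exists>\<xi>'\<in>carr F. j \<xi>' g = c *\<^sub>C j \<xi> g"
    and h: "h \<in> closed_cspan {j \<xi> g |\<xi> g. \<xi> \<in> carr F \<and> g \<in> carr G}"
  shows "\<exists>X\<in>carr (interior_tensor F G). tensor_val j X = h"
proof -
  let ?B = "{j \<xi> g |\<xi> g. \<xi> \<in> carr F \<and> g \<in> carr G}"
  let ?R = "list_val j ` alg_tensors F G"
  have "complex_vector.subspace ?R"
  proof (rule complex_vector.subspaceI)
    show "0 \<in> ?R" using alg_tensors_simps(1) list_val_simps(1) by (metis imageI)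
  next
    fix x y assume "x \<in> ?R" "y \<in> ?R"
    then obtain z w where "x = list_val j z" "y = list_val j w" "z \<in> alg_tensors F G" "w \<in> alg_tensors F G"
      by blast
    thus "x + y \<in> ?R" by (intro image_eqI[of _ _ "z @ w"]) auto
  next
    fix c x assume "x \<in> ?R"
    then obtain z where z: "x = list_val j z" "z \<in> alg_tensors F G" by blast
    have "c *\<^sub>C list_val j z \<in> ?R" using z(2)
    proof (induction z)
      case Nil
      show ?case by (intro image_eqI[of _ _ "[]"]) auto
    next
      case (Cons p z)
      obtain \<xi> g where p: "p = (\<xi>, g)" by force
      then obtain \<xi>' w where w: "\<xi>' \<in> carr F" "j \<xi>' g = c *\<^sub>C j \<xi> g" "c *\<^sub>C list_val j z = list_val j w"
          "w \<in> alg_tensors F G"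
        using Cons scale[of \<xi> g c] by auto
      show ?case
        using Cons.prems p w by (intro image_eqI[of _ _ "(\<xi>', g) # w"]) (auto simp: cscale_add_right)
    qed
    thus "c *\<^sub>C x \<in> ?R" by (simp add: z)
  qed
  moreover have "?B \<subseteq> ?R"
  proof safe
    fix \<xi> g assume "\<xi> \<in> carr F" "g \<in> carr G"
    thus "j \<xi> g \<in> ?R" by (intro image_eqI[of _ _ "[(\<xi>, g)]"]) auto
  qed
  ultimately have "complex_vector.span ?B \<subseteq> ?R" by (rule complex_vector.span_minimal[rotated])
  hence "h \<in> closure ?R" using h closure_mono unfolding closed_cspan_def by blast
  then obtain y where y: "\<forall>n. y n \<in> ?R" "y \<longlonglongrightarrow> h" unfolding closure_sequential by blast
  then obtain x where x: "\<And>n. x n \<in> alg_tensors F G" "\<And>n. y n = list_val j (x n)"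
    unfolding image_iff by metis
  have "y = (\<lambda>n. list_val j (x n))" using x(2) by auto
  hence "(\<lambda>n. list_val j (x n)) \<longlonglongrightarrow> h" using y(2) by simp
  thus ?thesis using tensor_class_val[of x h] x(1) by blast
qed

end


section \<open>Graph correspondences over finitely many vertices\<close>

text \<open>For a finite set of vertices \<open>C0\<close> consists of all functions supported there, and \<open>\<rho>\<close> is determined
  by the projections \<open>Pr v\<close>.\<close>
locale finite_vertex_rep =
  fixes Vs :: "'v set" and \<rho> :: "('v \<Rightarrow> complex) \<Rightarrow> 'h::complex_hilbert_space \<Rightarrow> 'h"
  assumes finite_Vs: "finite Vs" and rep: "algebra_rep Vs UNIV \<rho>"
begin

abbreviation K where "K \<equiv> hilbert_corr UNIV \<rho>"

definition Pr :: "'v \<Rightarrow> 'h \<Rightarrow> 'h" where "Pr v = \<rho> (delta v)"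

lemma C0_iff: "a \<in> C0 Vs \<longleftrightarrow> (\<forall>v. v \<notin> Vs \<longrightarrow> a v = 0)"
  using finite_Vs by (auto simp: C0_def)

lemma delta_C0: "v \<in> Vs \<Longrightarrow> delta v \<in> C0 Vs"
  by (auto simp: C0_iff delta_def)

lemma rho_bop: "a \<in> C0 Vs \<Longrightarrow> bop (\<rho> a)"
  and rho_add: "a \<in> C0 Vs \<Longrightarrow> b \<in> C0 Vs \<Longrightarrow> \<rho> (\<lambda>v. a v + b v) h = \<rho> a h + \<rho> b h"
  and rho_scale: "a \<in> C0 Vs \<Longrightarrow> \<rho> (\<lambda>v. c * a v) h = c *\<^sub>C \<rho> a h"
  and rho_mult: "a \<in> C0 Vs \<Longrightarrow> b \<in> C0 Vs \<Longrightarrow> \<rho> (\<lambda>v. a v * b v) h = \<rho> a (\<rho> b h)"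
  and rho_adj: "a \<in> C0 Vs \<Longrightarrow> \<rho> (\<lambda>v. cnj (a v)) h = adj_on UNIV (\<rho> a) h"
  and rho_one: "\<rho> (\<lambda>v. if v \<in> Vs then 1 else 0) h = h"
  using rep by (auto simp: algebra_rep_def)

lemma bop_Pr: "v \<in> Vs \<Longrightarrow> bop (Pr v)"
  unfolding Pr_def by (intro rho_bop delta_C0)

lemma Pr_selfadjoint: assumes "v \<in> Vs" shows "cinner (Pr v x) y = cinner x (Pr v y)"
proof -
  have "(\<lambda>u. cnj (delta v u)) = delta v" by (auto simp: delta_def)
  hence "adj_on UNIV (Pr v) y = Pr v y" using rho_adj[OF delta_C0[OF assms], of y] by (simp add: Pr_def)
  thus ?thesis using adj_on_UNIV[OF bop_Pr[OF assms], of x y] by simp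
qed

lemma Pr_mult: assumes "u \<in> Vs" "v \<in> Vs" shows "Pr u (Pr v x) = (if u = v then Pr v x else 0)"
proof -
  have "\<rho> (\<lambda>w. 0 * delta v w) x = 0" using rho_scale[OF delta_C0[OF assms(2)], of 0 x] by simp
  moreover have "(\<lambda>w. delta u w * delta v w) = (if u = v then delta v else (\<lambda>w. 0 * delta v w))"
    by (auto simp: delta_def fun_eq_iff)
  ultimately show ?thesis using rho_mult[OF assms[THEN delta_C0], of x] by (auto simp: Pr_def)
qed

lemma rho_eq_sum: assumes "a \<in> C0 Vs" shows "\<rho> a h = (\<Sum>v\<in>Vs. a v *\<^sub>C Pr v h)"
proof -
  have "\<rho> (\<lambda>u. if u \<in> W then a u else 0) h = (\<Sum>v\<in>W. a v *\<^sub>C Pr v h)" if "finite W" "W \<subseteq> Vs" for W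
    using that
  proof (induction W)
    case empty
    have "\<rho> (\<lambda>u. 0 * a u) h = 0" using rho_scale[OF assms, of 0 h] by simp
    thus ?case by simp
  next
    case (insert v W)
    have eq: "(\<lambda>u. if u \<in> insert v W then a u else 0) =
        (\<lambda>u. (\<lambda>u. a v * delta v u) u + (\<lambda>u. if u \<in> W then a u else 0) u)"
      using insert.hyps by (auto simp: delta_def fun_eq_iff)
    have "\<rho> (\<lambda>u. if u \<in> insert v W then a u else 0) h =
        \<rho> (\<lambda>u. a v * delta v u) h + \<rho> (\<lambda>u. if u \<in> W then a u else 0) h"
      unfolding eq using insert.prems by (intro rho_add) (auto simp: C0_iff delta_def)
    also have "\<rho> (\<lambda>u. a v * delta v u) h = a v *\<^sub>C Pr v h"
      unfolding Pr_def using insert.prems by (intro rho_scale delta_C0) auto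
    finally show ?case using insert by simp
  qed
  moreover have "(\<lambda>u. if u \<in> Vs then a u else 0) = a" using assms by (auto simp: C0_iff)
  ultimately show ?thesis using finite_Vs by (metis subset_refl)
qed

text \<open>The matrix coefficient of \<open>\<rho> a\<close>, for arbitrary functions \<open>a\<close> and visibly linear in \<open>a\<close>.\<close>
definition weighted :: "'h \<Rightarrow> 'h \<Rightarrow> ('v \<Rightarrow> complex) \<Rightarrow> complex" where
  "weighted h k a = (\<Sum>v\<in>Vs. a v * cinner h (Pr v k))"

lemma cinner_rho: "a \<in> C0 Vs \<Longrightarrow> cinner h (\<rho> a k) = weighted h k a"
  by (simp add: rho_eq_sum weighted_def cinner_sum_right cinner_cscale_right)

lemma norm_Pr_le: "v \<in> Vs \<Longrightarrow> norm (Pr v x) \<le> norm x"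
  by (rule norm_le_if_cinner_eq) (simp add: Pr_selfadjoint Pr_mult)

lemma weighted_bound:
  assumes "\<And>v. v \<in> Vs \<Longrightarrow> cmod (a v) \<le> C"
  shows "cmod (weighted h h a) \<le> real (card Vs) * C * (norm h)\<^sup>2"
proof -
  have "cmod (weighted h h a) \<le> (\<Sum>v\<in>Vs. cmod (a v) * cmod (cinner h (Pr v h)))"
    unfolding weighted_def by (intro order_trans[OF norm_sum]) (simp add: norm_mult)
  also have "\<dots> \<le> (\<Sum>v\<in>Vs. C * (norm h)\<^sup>2)"
  proof (intro sum_mono mult_mono)
    fix v assume v: "v \<in> Vs"
    show "cmod (a v) \<le> C" using assms v by simp
    show "0 \<le> C" using assms[OF v] norm_ge_zero order_trans by blast
    have "cmod (cinner h (Pr v h)) \<le> norm h * norm (Pr v h)" by (rule cinner_cauchy_schwarz)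
    also have "\<dots> \<le> norm h * norm h" by (intro mult_left_mono norm_Pr_le v) simp
    finally show "cmod (cinner h (Pr v h)) \<le> (norm h)\<^sup>2" by (simp add: power2_eq_square)
  qed simp
  finally show ?thesis by simp
qed

definition isometric_graph_rep where
  "isometric_graph_rep X s r A \<longleftrightarrow> s ` X \<subseteq> Vs \<and> corr_rep Vs (graph_corr Vs X s r) UNIV A \<rho> \<and>
     isometric_corr_rep (graph_corr Vs X s r) UNIV A \<rho>"

lemma graph_carr_iff: "\<xi> \<in> carr (graph_corr Vs X s r) \<longleftrightarrow>
    (\<forall>e. e \<notin> X \<longrightarrow> \<xi> e = 0) \<and> (\<forall>v\<in>Vs. (\<lambda>e. (cmod (\<xi> e))\<^sup>2) summable_on {e \<in> X. s e = v})"
  by (auto simp: graph_corr_def C0_iff)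

lemma graph_corr_sel:
  "inn (graph_corr Vs X s r) \<xi> \<eta> v = (if v \<in> Vs then \<Sum>\<^sub>\<infinity>e\<in>{e \<in> X. s e = v}. cnj (\<xi> e) * \<eta> e else 0)"
  "lact (graph_corr Vs X s r) a \<xi> = (\<lambda>e. a (r e) * \<xi> e)"
  "ract (graph_corr Vs X s r) \<xi> a = (\<lambda>e. \<xi> e * a (s e))"
  "cmult (graph_corr Vs X s r) c \<xi> = (\<lambda>e. c * \<xi> e)"
  "cplus (graph_corr Vs X s r) \<xi> \<eta> = (\<lambda>e. \<xi> e + \<eta> e)"
  by (simp_all add: graph_corr_def)

lemma K_sel [simp]: "carr K = UNIV" "inn K h k u = cinner h k" "lact K a h = \<rho> a h"
  by (simp_all add: hilbert_corr_def)

lemma inn_C0: "inn (graph_corr Vs X s r) \<xi> \<eta> \<in> C0 Vs"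
  by (simp add: C0_iff graph_corr_sel)

lemma graph_carr_dominated:
  assumes "\<xi> \<in> carr (graph_corr Vs X s r)" "\<And>e. cmod (\<eta> e) \<le> C * cmod (\<xi> e)"
  shows "\<eta> \<in> carr (graph_corr Vs X s r)"
  unfolding graph_carr_iff
proof (intro conjI allI impI ballI)
  fix e assume "e \<notin> X"
  thus "\<eta> e = 0" using assms(1) assms(2)[of e] by (simp add: graph_carr_iff)
next
  fix v assume "v \<in> Vs"
  hence "(\<lambda>e. C\<^sup>2 * (cmod (\<xi> e))\<^sup>2) summable_on {e \<in> X. s e = v}"
    using assms(1) by (intro summable_on_cmult_right) (auto simp: graph_carr_iff)
  thus "(\<lambda>e. (cmod (\<eta> e))\<^sup>2) summable_on {e \<in> X. s e = v}"
  proof (rule summable_on_comparison_test)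
    fix e
    have "(cmod (\<eta> e))\<^sup>2 \<le> (C * cmod (\<xi> e))\<^sup>2" by (intro power_mono assms(2)) simp
    thus "(cmod (\<eta> e))\<^sup>2 \<le> C\<^sup>2 * (cmod (\<xi> e))\<^sup>2" by (simp add: power_mult_distrib)
  qed simp
qed

lemma cmult_carr: "\<xi> \<in> carr (graph_corr Vs X s r) \<Longrightarrow>
    cmult (graph_corr Vs X s r) c \<xi> \<in> carr (graph_corr Vs X s r)"
  by (rule graph_carr_dominated[of \<xi> _ _ _ _ "cmod c"]) (auto simp: graph_corr_sel norm_mult)

lemma lact_carr:
  assumes "\<xi> \<in> carr (graph_corr Vs X s r)" "a \<in> C0 Vs"
  shows "lact (graph_corr Vs X s r) a \<xi> \<in> carr (graph_corr Vs X s r)"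
proof (rule graph_carr_dominated[OF assms(1)])
  fix e
  have "cmod (a v) \<le> (\<Sum>v\<in>Vs. cmod (a v))" for v
  proof (cases "v \<in> Vs")
    case True thus ?thesis using finite_Vs by (intro member_le_sum) auto
  qed (use assms(2) in \<open>simp add: C0_iff sum_nonneg\<close>)
  thus "cmod (lact (graph_corr Vs X s r) a \<xi> e) \<le> (\<Sum>v\<in>Vs. cmod (a v)) * cmod (\<xi> e)"
    by (simp add: graph_corr_sel norm_mult mult_right_mono)
qed

lemma delta_carr: "e \<in> X \<Longrightarrow> delta e \<in> carr (graph_corr Vs X s r)"
  unfolding graph_carr_iff
  by (auto simp: delta_def split: if_splits
      intro!: finite_nonzero_values_imp_summable_on finite_subset[of _ "{e}"])

context
  fixes X s r A assumes isorep: "isometric_graph_rep X s r A"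
begin

abbreviation F where "F \<equiv> graph_corr Vs X s r"

lemma A_bop: "\<xi> \<in> carr F \<Longrightarrow> bop (A \<xi>)"
  and A_plus: "\<xi> \<in> carr F \<Longrightarrow> \<eta> \<in> carr F \<Longrightarrow> A (cplus F \<xi> \<eta>) h = A \<xi> h + A \<eta> h"
  and A_cmult: "\<xi> \<in> carr F \<Longrightarrow> A (cmult F c \<xi>) h = c *\<^sub>C A \<xi> h"
  and A_bimodule: "a \<in> C0 Vs \<Longrightarrow> b \<in> C0 Vs \<Longrightarrow> \<xi> \<in> carr F \<Longrightarrow>
    A (lact F a (ract F \<xi> b)) h = \<rho> a (A \<xi> (\<rho> b h))"
  using isorep by (auto simp: isometric_graph_rep_def corr_rep_def)

lemma A_inn: "\<xi> \<in> carr F \<Longrightarrow> \<eta> \<in> carr F \<Longrightarrow> cinner (A \<xi> h) (A \<eta> k) = cinner h (\<rho> (inn F \<xi> \<eta>) k)"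
  using isorep adj_on_UNIV[OF A_bop, of \<xi> h "A \<eta> k"]
  by (simp add: isometric_graph_rep_def isometric_corr_rep_def)

lemma A_lact: assumes "\<xi> \<in> carr F" "a \<in> C0 Vs" shows "A (lact F a \<xi>) h = \<rho> a (A \<xi> h)"
proof -
  let ?one = "\<lambda>v. if v \<in> Vs then 1 else 0 :: complex"
  have "ract F \<xi> ?one = \<xi>"
    using isorep assms(1) unfolding graph_carr_iff graph_corr_sel isometric_graph_rep_def by fastforce
  thus ?thesis using A_bimodule[OF assms(2) _ assms(1), of ?one h] by (simp add: rho_one C0_iff)
qed

lemma realisation1: "tensor_realisation F K A"
  by standard (auto simp: A_inn cmult_carr A_cmult)

lemma lact_tensor:
  assumes "Y \<in> carr (interior_tensor F K)" "a \<in> C0 Vs"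
  shows "lact (interior_tensor F K) a Y \<in> carr (interior_tensor F K)"
    and "tensor_val A (lact (interior_tensor F K) a Y) = \<rho> a (tensor_val A Y)"
proof -
  interpret R: tensor_realisation F K A by (rule realisation1)
  let ?x = "\<lambda>n. map (map_prod (lact F a) id) (tensor_seq Y n)"
  have eq: "lact (interior_tensor F K) a Y = tensor_class F K ?x"
    by (simp add: interior_tensor_def tensor_map_def)
  have x: "?x n \<in> alg_tensors F K" for n
    by (rule tensor_map_alg[OF _ _ R.tensor_seq_lim(1)[OF assms(1)]]) (auto simp: lact_carr assms(2))
  have "list_val A (map (map_prod (lact F a) id) z) = \<rho> a (list_val A z)" if "z \<in> alg_tensors F K" for z
    using that by (induction z)
      (auto simp: bop_zero[OF rho_bop[OF assms(2)]] bop_add[OF rho_bop[OF assms(2)]] A_lact assms(2))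
  hence "(\<lambda>n. list_val A (?x n)) = (\<lambda>n. \<rho> a (list_val A (tensor_seq Y n)))"
    using R.tensor_seq_lim(1)[OF assms(1)] by simp
  also have "\<dots> \<longlonglongrightarrow> \<rho> a (tensor_val A Y)"
    by (rule bounded_linear.tendsto[OF bop_bounded_linear[OF rho_bop[OF assms(2)]] R.tensor_seq_lim(2)[OF assms(1)]])
  finally show "lact (interior_tensor F K) a Y \<in> carr (interior_tensor F K)"
    "tensor_val A (lact (interior_tensor F K) a Y) = \<rho> a (tensor_val A Y)"
    unfolding eq by (rule R.tensor_class_val[OF x])+
qed

text \<open>The adjoint of \<open>\<xi> \<otimes> h \<mapsto> A \<xi> h\<close> sends \<open>h\<close> to the tensor representing the projection of \<open>h\<close> onto the
  closed span of the vectors \<open>A \<xi> k\<close>.  Full coisometry therefore says that this projection is the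
  identity.\<close>
lemma coisometric_total:
  assumes "fully_coisometric_corr_rep F UNIV A \<rho>"
  shows "closed_cspan {A \<xi> h |\<xi> h. \<xi> \<in> carr F} = UNIV"
proof -
  interpret R: tensor_realisation F K A by (rule realisation1)
  let ?W = "closed_cspan {A \<xi> h |\<xi> h. \<xi> \<in> carr F \<and> h \<in> carr K}"
  have W: "closed_csubspace ?W" by (rule closed_cspan_closed_csubspace)
  have "h \<in> ?W" for h
  proof -
    have "\<exists>Z\<in>carr (interior_tensor F K). tensor_val A Z = orth_proj ?W h"
      by (rule R.tensor_val_onto[OF _ orth_proj(1)[OF W]]) (use A_cmult cmult_carr in metis)
    then obtain Z where Z: "Z \<in> carr (interior_tensor F K)" "tensor_val A Z = orth_proj ?W h" by blast
    have "tilde_adj F UNIV A \<rho> h = Z"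
      unfolding tilde_adj_def Let_def
    proof (rule the_equality)
      show "Z \<in> carr (interior_tensor F K) \<and>
          (\<forall>Y\<in>carr (interior_tensor F K). inn (interior_tensor F K) Y Z () = cinner (tilde A Y) h)"
      proof (intro conjI ballI Z(1))
        fix Y assume Y: "Y \<in> carr (interior_tensor F K)"
        show "inn (interior_tensor F K) Y Z () = cinner (tilde A Y) h"
          unfolding R.inn_tensor_val[OF Y Z(1)] Z(2) tilde_eq_tensor_val
          by (rule orth_proj_cinner(1)[OF W R.tensor_val_in[OF Y]])
      qed
    next
      fix Z' assume Z': "Z' \<in> carr (interior_tensor F K) \<and>
          (\<forall>Y\<in>carr (interior_tensor F K). inn (interior_tensor F K) Y Z' () = cinner (tilde A Y) h)"
      have "tensor_val A Z' = orth_proj ?W h"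
      proof (rule sym[OF orth_proj_unique[OF W]])
        show Z'W: "tensor_val A Z' \<in> ?W" using R.tensor_val_in Z' by blast
        have "A \<xi> k \<in> orth_compl {h - tensor_val A Z'}" if "\<xi> \<in> carr F" for \<xi> k
        proof -
          have "elem_tensor F K \<xi> k \<in> carr (interior_tensor F K)"
            "tensor_val A (elem_tensor F K \<xi> k) = A \<xi> k"
            using R.elem_tensor_val[OF that, of k] by simp_all
          hence "cinner (A \<xi> k) (tensor_val A Z') = cinner (A \<xi> k) h"
            using Z' R.inn_tensor_val tilde_eq_tensor_val by metis
          hence "cinner (A \<xi> k) (h - tensor_val A Z') = 0" by (simp add: cinner_diff)
          thus ?thesis by (simp add: orth_compl_def cinner_commute[of "h - tensor_val A Z'"])
        qed
        hence "?W \<subseteq> orth_compl {h - tensor_val A Z'}"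
          by (intro closed_cspan_minimal orth_compl_closed_csubspace) auto
        thus "h - tensor_val A Z' \<in> orth_compl ?W"
          by (force simp: orth_compl_def cinner_commute[of _ "h - tensor_val A Z'"])
      qed
      thus "Z' = Z" using R.tensor_val_inj Z Z' by simp
    qed
    hence "h = orth_proj ?W h"
      using assms Z(2) by (simp add: fully_coisometric_corr_rep_def tilde_eq_tensor_val) metis
    thus ?thesis using orth_proj(1)[OF W, of h] by simp
  qed
  thus ?thesis by auto
qed

lemma inn_delta:
  assumes "e \<in> X" "f \<in> X"
  shows "inn F (delta e) (delta f) = (if e = f then delta (s e) else (\<lambda>_. 0))"
proof
  fix v
  have sV: "s e \<in> Vs" using isorep assms by (auto simp: isometric_graph_rep_def)
  show "inn F (delta e) (delta f) v = (if e = f then delta (s e) else (\<lambda>_. 0)) v"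
  proof (cases "e = f \<and> v = s e")
    case True
    have "(\<Sum>\<^sub>\<infinity>e'\<in>{e' \<in> X. s e' = s e}. cnj (delta e e') * delta e e') =
        (\<Sum>\<^sub>\<infinity>e'\<in>{e}. cnj (delta e e') * delta e e' :: complex)"
      by (rule infsum_cong_neutral) (use assms in \<open>auto simp: delta_def\<close>)
    thus ?thesis using True sV by (simp add: graph_corr_sel) (simp add: delta_def)
  next
    case False
    have "(\<Sum>\<^sub>\<infinity>e'\<in>{e' \<in> X. s e' = v}. cnj (delta e e') * delta f e' :: complex) = 0"
      by (rule infsum_0) (use False in \<open>auto simp: delta_def\<close>)
    thus ?thesis using False by (auto simp: graph_corr_sel delta_def)
  qed
qed

lemma A_adj_delta:
  assumes "e \<in> X" "f \<in> X"
  shows "adj_on UNIV (A (delta e)) (A (delta f) h) = (if e = f then Pr (s e) h else 0)"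
proof -
  have 0: "\<rho> (\<lambda>_. 0) h = 0"
  proof -
    have "(\<lambda>_. 0) \<in> C0 Vs" by (simp add: C0_iff)
    from rho_scale[OF this, of 0 h] show ?thesis by simp
  qed
  have "adj_on UNIV (A (delta e)) (A (delta f) h) = \<rho> (inn F (delta e) (delta f)) h"
    using isorep delta_carr[OF assms(1), of s r] delta_carr[OF assms(2), of s r]
    by (simp add: isometric_graph_rep_def isometric_corr_rep_def)
  thus ?thesis using 0 by (simp add: inn_delta[OF assms] Pr_def)
qed

lemma Pr_A_delta:
  assumes "e \<in> X" "v \<in> Vs"
  shows "Pr v (A (delta e) h) = (if r e = v then A (delta e) h else 0)"
proof -
  have c: "delta e \<in> carr F" by (rule delta_carr[OF assms(1)])
  have "Pr v (A (delta e) h) = A (lact F (delta v) (delta e)) h"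
    unfolding Pr_def by (rule A_lact[OF c delta_C0[OF assms(2)], symmetric])
  also have "lact F (delta v) (delta e) = (if r e = v then delta e else cmult F 0 (delta e))"
    by (auto simp: graph_corr_sel delta_def)
  finally show ?thesis using A_cmult[OF c, of 0 h] by (simp split: if_splits)
qed

lemma A_delta_Pr: assumes "e \<in> X" shows "A (delta e) (Pr (s e) h) = A (delta e) h"
proof -
  have sV: "s e \<in> Vs" using isorep assms by (auto simp: isometric_graph_rep_def)
  have c: "delta e \<in> carr F" by (rule delta_carr[OF assms])
  have one: "(\<lambda>v. if v \<in> Vs then 1 else 0 :: complex) \<in> C0 Vs" by (simp add: C0_iff)
  have "ract F (delta e) (delta (s e)) = delta e" by (auto simp: graph_corr_sel delta_def)
  moreover have "A (lact F (\<lambda>v. if v \<in> Vs then 1 else 0) (ract F (delta e) (delta (s e)))) h =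
      A (delta e) (Pr (s e) h)"
    using A_bimodule[OF one delta_C0[OF sV] c] by (simp add: Pr_def rho_one)
  moreover have "A (lact F (\<lambda>v. if v \<in> Vs then 1 else 0) (delta e)) h = A (delta e) h"
    using A_lact[OF c one] by (simp add: rho_one)
  ultimately show ?thesis by simp
qed

text \<open>Subtracting from \<open>\<xi>\<close> its values on a large finite set of edges leaves a function whose inner
  product with itself is uniformly small on the finitely many vertices; by isometry \<open>A\<close> of the remainder is small
  at \<open>h\<close>.\<close>
lemma A_in_closed_cspan_delta:
  assumes \<xi>: "\<xi> \<in> carr F"
  shows "A \<xi> h \<in> closed_cspan {A (delta e) h |e. e \<in> X}"
proof -
  let ?W = "closed_cspan {A (delta e) h |e. e \<in> X}"
  have W: "closed_csubspace ?W" by (rule closed_cspan_closed_csubspace)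
  define cut where "cut G = (\<lambda>e. if e \<in> G then 0 else \<xi> e)" for G
  have cut_carr: "cut G \<in> carr F" for G
    by (rule graph_carr_dominated[OF \<xi>, of _ 1]) (simp add: cut_def)
  have cut_eq: "A (cut G) h = A \<xi> h - (\<Sum>e\<in>G. \<xi> e *\<^sub>C A (delta e) h)" if "finite G" "G \<subseteq> X" for G
    using that
  proof (induction G)
    case (insert e G)
    have c: "delta e \<in> carr F" using insert.prems by (intro delta_carr) simp
    have "cut G = cplus F (cut (insert e G)) (cmult F (\<xi> e) (delta e))"
      using insert.hyps by (auto simp: cut_def graph_corr_sel delta_def fun_eq_iff)
    hence "A (cut G) h = A (cut (insert e G)) h + \<xi> e *\<^sub>C A (delta e) h"
      by (simp add: A_plus[OF cut_carr cmult_carr[OF c]] A_cmult[OF c])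
    thus ?case using insert by (simp add: algebra_simps)
  qed (simp add: cut_def)
  have "\<exists>y\<in>?W. dist y (A \<xi> h) < \<epsilon>" if \<epsilon>: "\<epsilon> > 0" for \<epsilon>
  proof -
    \<comment> \<open>the summand 1 keeps the denominator positive\<close>
    define \<delta> where "\<delta> = \<epsilon>\<^sup>2 / (2 * (real (card Vs) * (norm h)\<^sup>2 + 1))"
    have pos: "real (card Vs) * (norm h)\<^sup>2 + 1 > 0" by (simp add: add_nonneg_pos)
    have \<delta>: "\<delta> > 0" using \<epsilon> pos by (simp add: \<delta>_def)
    let ?f = "\<lambda>e. (cmod (\<xi> e))\<^sup>2" and ?X = "\<lambda>v. {e \<in> X. s e = v}"
    have "\<forall>v\<in>Vs. \<exists>G. finite G \<and> G \<subseteq> ?X v \<and> infsum ?f (?X v - G) \<le> \<delta>"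
    proof
      fix v assume v: "v \<in> Vs"
      have sm: "?f summable_on ?X v" using \<xi> v by (simp add: graph_carr_iff)
      obtain G where G: "finite G" "G \<subseteq> ?X v" "dist (sum ?f G) (infsum ?f (?X v)) \<le> \<delta>"
        using infsum_finite_approximation[OF sm \<delta>] by blast
      have "infsum ?f (?X v - G) = infsum ?f (?X v) - infsum ?f G"
        by (rule infsum_Diff[OF sm _ G(2)]) (simp add: G(1))
      hence "infsum ?f (?X v - G) \<le> \<delta>" using G by (simp add: dist_real_def)
      thus "\<exists>G. finite G \<and> G \<subseteq> ?X v \<and> infsum ?f (?X v - G) \<le> \<delta>" using G by blast
    qed
    then obtain G where G: "\<And>v. v \<in> Vs \<Longrightarrow> finite (G v)" "\<And>v. v \<in> Vs \<Longrightarrow> G v \<subseteq> ?X v"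
        "\<And>v. v \<in> Vs \<Longrightarrow> infsum ?f (?X v - G v) \<le> \<delta>"
      unfolding bchoice_iff by blast
    define D where "D = (\<Union>v\<in>Vs. G v)"
    have D: "finite D" "D \<subseteq> X" using G finite_Vs by (auto simp: D_def)
    have inn_le: "cmod (inn F (cut D) (cut D) v) \<le> \<delta>" if v: "v \<in> Vs" for v
    proof -
      have "inn F (cut D) (cut D) v = (\<Sum>\<^sub>\<infinity>e\<in>?X v. complex_of_real ((cmod (cut D e))\<^sup>2))"
        using v by (simp add: graph_corr_sel complex_norm_square mult.commute del: of_real_power)
      also have "\<dots> = complex_of_real (\<Sum>\<^sub>\<infinity>e\<in>?X v. (cmod (cut D e))\<^sup>2)"
        using cut_carr[of D] v by (intro infsumI has_sum_of_real has_sum_infsum) (simp add: graph_carr_iff)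
      also have "(\<Sum>\<^sub>\<infinity>e\<in>?X v. (cmod (cut D e))\<^sup>2) = infsum ?f (?X v - G v)"
      proof (rule infsum_cong_neutral)
        fix e assume "e \<in> ?X v \<inter> (?X v - G v)"
        moreover from this have "e \<notin> D" using G(2) by (force simp: D_def)
        ultimately show "(cmod (cut D e))\<^sup>2 = ?f e" by (simp add: cut_def)
      qed (use v in \<open>auto simp: cut_def D_def\<close>)
      finally show ?thesis using G(3)[OF v] by (simp add: infsum_nonneg)
    qed
    have "complex_of_real ((norm (A (cut D) h))\<^sup>2) = weighted h h (inn F (cut D) (cut D))"
      by (simp add: cinner_self[symmetric] A_inn[OF cut_carr cut_carr] cinner_rho[OF inn_C0] del: of_real_power)
    hence "(norm (A (cut D) h))\<^sup>2 = cmod (weighted h h (inn F (cut D) (cut D)))"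
      by (metis abs_of_nonneg norm_of_real zero_le_power2)
    also have "\<dots> \<le> real (card Vs) * \<delta> * (norm h)\<^sup>2" by (rule weighted_bound[OF inn_le])
    also have "\<dots> \<le> (real (card Vs) * (norm h)\<^sup>2 + 1) * \<delta>" using \<delta> by (simp add: algebra_simps)
    also have "\<dots> = \<epsilon>\<^sup>2 / 2"
    proof -
      have "q * (x / (2 * q)) = x / 2" if "q > 0" for q x :: real using that by simp
      thus ?thesis unfolding \<delta>_def using pos by blast
    qed
    also have "\<dots> < \<epsilon>\<^sup>2" using \<epsilon> by simp
    finally have "norm (A (cut D) h) < \<epsilon>" using \<epsilon> by (simp add: power2_less_imp_less)
    moreover have "(\<Sum>e\<in>D. \<xi> e *\<^sub>C A (delta e) h) \<in> ?W"
    proof (rule complex_vector.subspace_sum[OF closed_csubspaceD(1)[OF W]])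
      fix e assume "e \<in> D"
      hence "A (delta e) h \<in> ?W" using D by (intro subsetD[OF closed_cspan_superset]) auto
      thus "\<xi> e *\<^sub>C A (delta e) h \<in> ?W" by (rule closed_csubspaceD(6)[OF W])
    qed
    ultimately show ?thesis
      using cut_eq[OF D] by (intro bexI[of _ "\<Sum>e\<in>D. \<xi> e *\<^sub>C A (delta e) h"])
        (auto simp: dist_norm norm_minus_commute)
  qed
  hence "A \<xi> h \<in> closure ?W" by (simp add: closure_approachable)
  thus ?thesis using closed_csubspaceD(2)[OF W] by (simp only: closure_closed)
qed

end

end


section \<open>Commutation relations from tensor products\<close>

lemma alg_inn_simps:
  "alg_inn F G [] w v = 0"
  "alg_inn F G ((\<xi>, g) # z) w v = (\<Sum>(\<eta>, k)\<leftarrow>w. inn G g (lact G (inn F \<xi> \<eta>) k) v) + alg_inn F G z w v"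
  by (simp_all add: alg_inn_def)

lemma alg_inn_append_left: "alg_inn F G (z @ z') w v = alg_inn F G z w v + alg_inn F G z' w v"
  by (simp add: alg_inn_def)

lemma alg_inn_append_right: "alg_inn F G z (w @ w') v = alg_inn F G z w v + alg_inn F G z w' v"
  by (induction z) (auto simp: alg_inn_simps)

lemma cinner_eq_0_sym: "cinner x y = 0 \<Longrightarrow> cinner y x = 0"
  by (subst cinner_commute) simp

abbreviation neg_list where "neg_list F \<equiv> map (map_prod (cmult F (-1)) id)"

context finite_vertex_rep
begin

lemma weighted_add: "weighted h k (\<lambda>v. a v + b v) = weighted h k a + weighted h k b"
  and weighted_zero: "weighted h k (\<lambda>v. 0) = 0"
  by (simp_all add: weighted_def distrib_right sum.distrib)

lemma alg_inn_neg:
  fixes X :: "'e set" and Y :: "'f set"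
  shows "alg_inn (graph_corr Vs X s r) (graph_corr Vs Y s' r') (neg_list (graph_corr Vs X s r) z) w v =
      - alg_inn (graph_corr Vs X s r) (graph_corr Vs Y s' r') z w v" (is ?left)
    and "alg_inn (graph_corr Vs X s r) (graph_corr Vs Y s' r') z (neg_list (graph_corr Vs X s r) w) v =
      - alg_inn (graph_corr Vs X s r) (graph_corr Vs Y s' r') z w v" (is ?right)
proof -
  let ?F = "graph_corr Vs X s r" and ?G = "graph_corr Vs Y s' r'"
  have inn_neg: "inn ?F (cmult ?F (-1) \<xi>) \<eta> = (\<lambda>u. - inn ?F \<xi> \<eta> u)"
    "inn ?F \<xi> (cmult ?F (-1) \<eta>) = (\<lambda>u. - inn ?F \<xi> \<eta> u)" for \<xi> \<eta>
    by (auto simp: graph_corr_sel fun_eq_iff infsum_uminus)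
  have lact_neg: "inn ?G g (lact ?G (\<lambda>u. - a u) k) v = - inn ?G g (lact ?G a k) v" for g k a
    by (simp add: graph_corr_sel infsum_uminus)
  note neg = inn_neg lact_neg
  have "(\<Sum>(\<eta>, k)\<leftarrow>w. inn ?G g (lact ?G (inn ?F (cmult ?F (-1) \<xi>) \<eta>) k) v) =
      - (\<Sum>(\<eta>, k)\<leftarrow>w. inn ?G g (lact ?G (inn ?F \<xi> \<eta>) k) v)" for g \<xi>
    by (induction w) (auto simp: neg)
  thus ?left by (induction z) (auto simp: alg_inn_simps)
  have "(\<Sum>(\<eta>, k)\<leftarrow>neg_list ?F w. inn ?G g (lact ?G (inn ?F \<xi> \<eta>) k) v) =
      - (\<Sum>(\<eta>, k)\<leftarrow>w. inn ?G g (lact ?G (inn ?F \<xi> \<eta>) k) v)" for g \<xi>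
    by (induction w) (auto simp: neg)
  thus ?right by (induction z) (auto simp: alg_inn_simps)
qed

context
  fixes X :: "'e set" and s r A and Y :: "'f set" and s' r' B
  assumes isoA: "isometric_graph_rep X s r A" and isoB: "isometric_graph_rep Y s' r' B"
begin

abbreviation FA where "FA \<equiv> graph_corr Vs X s r"
abbreviation GB where "GB \<equiv> graph_corr Vs Y s' r'"

text \<open>Iterating the realisation: the second factor is first evaluated by \<open>B\<close>, then \<open>A\<close> is applied.\<close>
lemma realisation2: "tensor_realisation FA (interior_tensor GB K) (\<lambda>\<xi> Z. A \<xi> (tensor_val B Z))"
proof
  interpret R: tensor_realisation GB K B by (rule realisation1[OF isoB])
  fix \<xi> \<eta> g k
  assume *: "\<xi> \<in> carr FA" "\<eta> \<in> carr FA" "g \<in> carr (interior_tensor GB K)" "k \<in> carr (interior_tensor GB K)"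
  show "inn (interior_tensor GB K) g (lact (interior_tensor GB K) (inn FA \<xi> \<eta>) k) () =
      cinner (A \<xi> (tensor_val B g)) (A \<eta> (tensor_val B k))"
    using * by (simp add: R.inn_tensor_val lact_tensor[OF isoB] inn_C0 A_inn[OF isoA])
qed (auto simp: cmult_carr A_cmult[OF isoA])

text \<open>The value at \<open>h\<close> of the operator \<open>\<Sum> A \<xi> B \<eta>\<close> belonging to a list of pairs \<open>(\<xi>, \<eta>)\<close>.\<close>
definition iter where "iter z h = list_val (\<lambda>\<xi> \<eta>. A \<xi> (B \<eta> h)) z"

lemma iter_simps [simp]:
  "iter [] h = 0" "iter ((\<xi>, \<eta>) # z) h = A \<xi> (B \<eta> h) + iter z h" "iter (z @ w) h = iter z h + iter w h"
  by (simp_all add: iter_def)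

text \<open>The product of two isometric representations is isometric for the inner product of lists.\<close>
lemma weighted_alg_inn:
  assumes "z \<in> alg_tensors FA GB" "w \<in> alg_tensors FA GB"
  shows "weighted h k (alg_inn FA GB z w) = cinner (iter z h) (iter w k)"
proof -
  have one: "weighted h k (inn GB g (lact GB (inn FA \<xi> \<eta>) g')) = cinner (A \<xi> (B g h)) (A \<eta> (B g' k))"
    if "\<xi> \<in> carr FA" "\<eta> \<in> carr FA" "g \<in> carr GB" "g' \<in> carr GB" for \<xi> \<eta> g g'
  proof -
    have "weighted h k (inn GB g (lact GB (inn FA \<xi> \<eta>) g')) = cinner (B g h) (B (lact GB (inn FA \<xi> \<eta>) g') k)"
      using that by (simp add: A_inn[OF isoB] lact_carr inn_C0 cinner_rho)
    thus ?thesis using that by (simp add: A_lact[OF isoB] A_inn[OF isoA] inn_C0)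
  qed
  have row: "weighted h k (\<lambda>v. \<Sum>(\<eta>, g')\<leftarrow>w. inn GB g (lact GB (inn FA \<xi> \<eta>) g') v) =
      cinner (A \<xi> (B g h)) (iter w k)" if "\<xi> \<in> carr FA" "g \<in> carr GB" for \<xi> g
    using assms(2)
    by (induction w) (use that in \<open>auto simp: weighted_add weighted_zero one cinner_add_right\<close>)
  have step: "alg_inn FA GB [] w = (\<lambda>v. 0)"
    "alg_inn FA GB ((\<xi>, g) # z) w =
      (\<lambda>v. (\<lambda>v. \<Sum>(\<eta>, g')\<leftarrow>w. inn GB g (lact GB (inn FA \<xi> \<eta>) g') v) v + alg_inn FA GB z w v)" for \<xi> g z
    by (auto simp: alg_inn_simps)
  show ?thesis using assms(1)
  proof (induction z)
    case (Cons p z)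
    obtain \<xi> g where p: "p = (\<xi>, g)" by force
    show ?case using Cons unfolding p step(2) weighted_add by (simp add: row cinner_add_left)
  qed (simp add: step(1) weighted_zero)
qed

lemma neg_list_alg:
  assumes "w \<in> alg_tensors FA GB"
  shows "neg_list FA w \<in> alg_tensors FA GB" "iter (neg_list FA w) h = - iter w h"
  using assms by (induction w) (auto simp: cmult_carr A_cmult[OF isoA])

lemma alg_inn_outside: "v \<notin> Vs \<Longrightarrow> alg_inn FA GB z w v = 0"
proof -
  assume v: "v \<notin> Vs"
  have "(\<Sum>(\<eta>, k)\<leftarrow>w. inn GB g (lact GB (inn FA \<xi> \<eta>) k) v) = 0" for \<xi> g
    by (induction w) (auto simp: graph_corr_sel v)
  thus ?thesis by (induction z) (auto simp: alg_inn_simps)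
qed

lemma alg_inn_le_sup_norm: "cmod (alg_inn FA GB z w v) \<le> sup_norm (alg_inn FA GB z w)"
proof -
  have "range (\<lambda>v. cmod (alg_inn FA GB z w v)) \<subseteq> insert 0 ((\<lambda>v. cmod (alg_inn FA GB z w v)) ` Vs)"
    using alg_inn_outside by force
  hence "finite (range (\<lambda>v. cmod (alg_inn FA GB z w v)))"
    using finite_Vs by (meson finite_imageI finite_insert finite_subset)
  thus ?thesis unfolding sup_norm_def by (intro cSUP_upper bdd_above_finite) auto
qed

lemma iter_diff_le:
  assumes "z \<in> alg_tensors FA GB" "w \<in> alg_tensors FA GB"
  shows "norm (iter z h - iter w h) \<le> sqrt (real (card Vs)) * norm h * alg_dist FA GB z w"
proof -
  let ?y = "z @ neg_list FA w"
  have y: "?y \<in> alg_tensors FA GB" using assms neg_list_alg by simp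
  have "complex_of_real ((norm (iter ?y h))\<^sup>2) = weighted h h (alg_inn FA GB ?y ?y)"
    by (simp only: weighted_alg_inn[OF y y] cinner_self)
  hence "(norm (iter ?y h))\<^sup>2 = cmod (weighted h h (alg_inn FA GB ?y ?y))"
    by (metis abs_of_nonneg norm_of_real zero_le_power2)
  also have "\<dots> \<le> real (card Vs) * sup_norm (alg_inn FA GB ?y ?y) * (norm h)\<^sup>2"
    by (rule weighted_bound[OF alg_inn_le_sup_norm])
  finally have "norm (iter ?y h) \<le> sqrt (real (card Vs) * sup_norm (alg_inn FA GB ?y ?y) * (norm h)\<^sup>2)"
    by (rule real_le_rsqrt)
  also have "\<dots> = sqrt (real (card Vs)) * norm h * alg_dist FA GB z w"
    by (simp add: real_sqrt_mult alg_dist_def Let_def)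
  finally show ?thesis using neg_list_alg(2)[OF assms(2)] by simp
qed

lemma alg_dist_refl: "alg_dist FA GB z z = 0"
proof -
  have "alg_inn FA GB (z @ neg_list FA z) (z @ neg_list FA z) = (\<lambda>v. 0)"
    by (simp add: alg_inn_append_left alg_inn_append_right alg_inn_neg fun_eq_iff)
  thus ?thesis unfolding alg_dist_def Let_def by (simp add: sup_norm_def)
qed

lemma alg_dist_neg: "alg_dist FA GB (neg_list FA z) (neg_list FA w) = alg_dist FA GB z w"
proof -
  have "neg_list FA z @ neg_list FA (neg_list FA w) = neg_list FA (z @ neg_list FA w)" by simp
  moreover have "alg_inn FA GB (neg_list FA y) (neg_list FA y) = alg_inn FA GB y y" for y
    by (simp only: fun_eq_iff alg_inn_neg) simp
  ultimately show ?thesis unfolding alg_dist_def Let_def by metis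
qed

lemma tensor_cauchy_alg: "x \<in> tensor_cauchy FA GB \<Longrightarrow> x n \<in> alg_tensors FA GB"
  by (auto simp: tensor_cauchy_def)

lemma iter_convergent:
  assumes "x \<in> tensor_cauchy FA GB" shows "convergent (\<lambda>n. iter (x n) h)"
proof -
  let ?C = "sqrt (real (card Vs)) * norm h + 1"
  have C: "?C > 0" by (simp add: add_nonneg_pos)
  have "Cauchy (\<lambda>n. iter (x n) h)"
  proof (rule CauchyI)
    fix e :: real assume "e > 0"
    hence "e / ?C > 0" using C by simp
    then obtain N where N: "\<And>m n. m \<ge> N \<Longrightarrow> n \<ge> N \<Longrightarrow> alg_dist FA GB (x m) (x n) < e / ?C"
      using assms unfolding tensor_cauchy_def by blast
    have "norm (iter (x m) h - iter (x n) h) < e" if "m \<ge> N" "n \<ge> N" for m n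
    proof -
      let ?d = "alg_dist FA GB (x m) (x n)"
      have "0 \<le> sup_norm (alg_inn FA GB y y)" for y
        using order_trans[OF norm_ge_zero alg_inn_le_sup_norm] .
      hence d: "?d \<ge> 0" by (simp add: alg_dist_def Let_def)
      have "norm (iter (x m) h - iter (x n) h) \<le> sqrt (real (card Vs)) * norm h * ?d"
        by (rule iter_diff_le) (use tensor_cauchy_alg assms in auto)
      also have "\<dots> \<le> ?C * ?d" using d by (intro mult_right_mono) auto
      also have "\<dots> < ?C * (e / ?C)" using N[OF that] C by (intro mult_strict_left_mono) auto
      finally show ?thesis using C by simp
    qed
    thus "\<exists>N. \<forall>m\<ge>N. \<forall>n\<ge>N. norm (iter (x m) h - iter (x n) h) < e" by blast
  qed
  thus ?thesis by (simp add: Cauchy_convergent_iff)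
qed

text \<open>The operator belonging to an element of the completed tensor product of two correspondences.\<close>
definition pair_val where "pair_val T h = lim (\<lambda>n. iter (tensor_seq T n) h)"

lemma tensor_class_pair:
  assumes x: "x \<in> tensor_cauchy FA GB"
  shows "tensor_seq (tensor_class FA GB x) \<in> tensor_cauchy FA GB"
    and "(\<lambda>n. iter (x n) h) \<longlonglongrightarrow> pair_val (tensor_class FA GB x) h"
proof -
  have "x \<in> tensor_class FA GB x"
    using x by (auto simp: tensor_class_def tensor_rel_def alg_dist_refl)
  hence "tensor_seq (tensor_class FA GB x) \<in> tensor_class FA GB x" by (rule tensor_seq_in)
  then obtain y where y: "y = tensor_seq (tensor_class FA GB x)" "y \<in> tensor_cauchy FA GB"
      "(\<lambda>n. alg_dist FA GB (x n) (y n)) \<longlonglongrightarrow> 0"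
    by (auto simp: tensor_class_def tensor_rel_def)
  show "tensor_seq (tensor_class FA GB x) \<in> tensor_cauchy FA GB" using y by simp
  have lim_y: "(\<lambda>n. iter (y n) h) \<longlonglongrightarrow> pair_val (tensor_class FA GB x) h"
    using iter_convergent[OF y(2), of h] unfolding pair_val_def y(1)[symmetric]
    by (simp add: convergent_LIMSEQ_iff)
  have "(\<lambda>n. iter (x n) h - iter (y n) h) \<longlonglongrightarrow> 0"
  proof (rule Lim_null_comparison)
    show "\<forall>\<^sub>F n in sequentially. norm (iter (x n) h - iter (y n) h) \<le>
        sqrt (real (card Vs)) * norm h * alg_dist FA GB (x n) (y n)"
      by (intro always_eventually allI iter_diff_le tensor_cauchy_alg x y)
    show "(\<lambda>n. sqrt (real (card Vs)) * norm h * alg_dist FA GB (x n) (y n)) \<longlonglongrightarrow> 0"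
      using tendsto_mult_right_zero[OF y(3)] .
  qed
  from tendsto_add[OF this lim_y] show "(\<lambda>n. iter (x n) h) \<longlonglongrightarrow> pair_val (tensor_class FA GB x) h"
    by simp
qed

lemma tensor_seq_pair:
  assumes "T \<in> carr (interior_tensor FA GB)"
  shows "tensor_seq T \<in> tensor_cauchy FA GB" "(\<lambda>n. iter (tensor_seq T n) h) \<longlonglongrightarrow> pair_val T h"
proof -
  obtain x where x: "x \<in> tensor_cauchy FA GB" "T = tensor_class FA GB x"
    using assms by (rule carr_interior_tensorE)
  show 1: "tensor_seq T \<in> tensor_cauchy FA GB" unfolding x(2) by (rule tensor_class_pair(1)[OF x(1)])
  show "(\<lambda>n. iter (tensor_seq T n) h) \<longlonglongrightarrow> pair_val T h"
    using iter_convergent[OF 1, of h] unfolding pair_val_def by (simp add: convergent_LIMSEQ_iff)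
qed

text \<open>The inner product of two tensors is defined as a limit in each vertex \<open>v\<close>.  The representation
  shows that this limit exists where \<open>Pr v\<close> is non-zero; at the other vertices its value has no
  influence on \<open>weighted\<close>.\<close>
lemma inn_pair:
  assumes T: "T \<in> carr (interior_tensor FA GB)" and T': "T' \<in> carr (interior_tensor FA GB)"
  shows "inn (interior_tensor FA GB) T T' \<in> C0 Vs"
    and "weighted h k (inn (interior_tensor FA GB) T T') = cinner (pair_val T h) (pair_val T' k)"
proof -
  define a where "a n = alg_inn FA GB (tensor_seq T n) (tensor_seq T' n)" for n
  have inn_eq: "inn (interior_tensor FA GB) T T' = (\<lambda>v. lim (\<lambda>n. a n v))"
    by (simp add: interior_tensor_def a_def)
  show "inn (interior_tensor FA GB) T T' \<in> C0 Vs"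
    unfolding inn_eq C0_iff by (simp add: a_def alg_inn_outside)
  note alg = tensor_cauchy_alg[OF tensor_seq_pair(1)[OF T]] tensor_cauchy_alg[OF tensor_seq_pair(1)[OF T']]
  have lim_weighted: "(\<lambda>n. weighted x y (a n)) \<longlonglongrightarrow> cinner (pair_val T x) (pair_val T' y)" for x y
    unfolding a_def weighted_alg_inn[OF alg]
    by (intro tendsto_cinner tensor_seq_pair(2) T T')
  have conv: "(\<lambda>n. a n v * cinner h (Pr v k)) \<longlonglongrightarrow> lim (\<lambda>n. a n v) * cinner h (Pr v k)" if v: "v \<in> Vs" for v
  proof (cases "Pr v k = 0")
    case False
    let ?u = "Pr v k"
    \<comment> \<open>at a vector in the range of \<open>Pr v\<close> the matrix coefficient isolates the value at \<open>v\<close>\<close>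
    have "weighted ?u ?u (a n) = (\<Sum>w\<in>Vs. if w = v then a n v * cinner ?u ?u else 0)" for n
      unfolding weighted_def using v by (intro sum.cong) (auto simp: Pr_mult)
    hence "a n v = weighted ?u ?u (a n) / cinner ?u ?u" for n using v finite_Vs False by simp
    moreover have "convergent (\<lambda>n. weighted ?u ?u (a n) / cinner ?u ?u)"
      by (rule convergentI[OF tendsto_divide[OF lim_weighted tendsto_const]]) (use False in simp)
    ultimately have "convergent (\<lambda>n. a n v)" by simp
    thus ?thesis by (intro tendsto_mult_right) (simp add: convergent_LIMSEQ_iff)
  qed simp
  have "(\<lambda>n. weighted h k (a n)) \<longlonglongrightarrow> weighted h k (\<lambda>v. lim (\<lambda>n. a n v))"
    unfolding weighted_def by (intro tendsto_sum conv)
  thus "weighted h k (inn (interior_tensor FA GB) T T') = cinner (pair_val T h) (pair_val T' k)"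
    unfolding inn_eq by (rule LIMSEQ_unique[OF _ lim_weighted])
qed

lemma neg_pair:
  assumes T: "T \<in> carr (interior_tensor FA GB)"
  shows "cmult (interior_tensor FA GB) (-1) T \<in> carr (interior_tensor FA GB)"
    and "pair_val (cmult (interior_tensor FA GB) (-1) T) h = - pair_val T h"
proof -
  let ?x = "\<lambda>n. neg_list FA (tensor_seq T n)"
  note seq = tensor_seq_pair(1)[OF T]
  have eq: "cmult (interior_tensor FA GB) (-1) T = tensor_class FA GB ?x"
    by (simp add: interior_tensor_def tensor_map_def)
  have x: "?x \<in> tensor_cauchy FA GB"
    using seq neg_list_alg(1) unfolding tensor_cauchy_def by (simp add: alg_dist_neg)
  show "cmult (interior_tensor FA GB) (-1) T \<in> carr (interior_tensor FA GB)"
    unfolding eq by (rule tensor_class_in_carr[OF x])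
  have "(\<lambda>n. iter (?x n) h) \<longlonglongrightarrow> - pair_val T h"
    unfolding neg_list_alg(2)[OF tensor_cauchy_alg[OF seq]]
    by (intro tendsto_minus tensor_seq_pair(2) T)
  thus "pair_val (cmult (interior_tensor FA GB) (-1) T) h = - pair_val T h"
    unfolding eq by (rule LIMSEQ_unique[OF tensor_class_pair(2)[OF x]])
qed

lemma realisation3: "tensor_realisation (interior_tensor FA GB) K pair_val"
  by standard (simp_all add: neg_pair cinner_rho inn_pair)

lemma elem_pair:
  assumes "\<xi> \<in> carr FA" "\<eta> \<in> carr GB"
  shows "elem_tensor FA GB \<xi> \<eta> \<in> carr (interior_tensor FA GB)"
    and "pair_val (elem_tensor FA GB \<xi> \<eta>) h = A \<xi> (B \<eta> h)"
proof -
  have x: "(\<lambda>_. [(\<xi>, \<eta>)]) \<in> tensor_cauchy FA GB"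
    using assms by (auto simp: tensor_cauchy_def alg_dist_refl)
  show "elem_tensor FA GB \<xi> \<eta> \<in> carr (interior_tensor FA GB)"
    unfolding elem_tensor_def by (rule tensor_class_in_carr[OF x])
  have "(\<lambda>n :: nat. A \<xi> (B \<eta> h)) \<longlonglongrightarrow> pair_val (elem_tensor FA GB \<xi> \<eta>) h"
    using tensor_class_pair(2)[OF x, of h] by (simp add: elem_tensor_def)
  thus "pair_val (elem_tensor FA GB \<xi> \<eta>) h = A \<xi> (B \<eta> h)"
    by (rule LIMSEQ_unique[OF _ tendsto_const])
qed

text \<open>Reassociation preserves the represented vectors: the tensor demanded by \<open>tensor_assoc\<close> is
  determined by its inner products with elementary tensors, since these are total.\<close>
lemma tilde2_elem_tensor:
  assumes \<xi>: "\<xi> \<in> carr FA" and \<eta>: "\<eta> \<in> carr GB"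
  shows "tilde2 FA GB UNIV \<rho> A B (elem_tensor (interior_tensor FA GB) K (elem_tensor FA GB \<xi> \<eta>) h) =
    A \<xi> (B \<eta> h)"
proof -
  interpret R1: tensor_realisation FA K A by (rule realisation1[OF isoA])
  interpret R1': tensor_realisation GB K B by (rule realisation1[OF isoB])
  let ?j = "\<lambda>\<xi> Z. A \<xi> (tensor_val B Z)"
  interpret R2: tensor_realisation FA "interior_tensor GB K" ?j by (rule realisation2)
  interpret R3: tensor_realisation "interior_tensor FA GB" K pair_val by (rule realisation3)
  let ?X = "elem_tensor (interior_tensor FA GB) K (elem_tensor FA GB \<xi> \<eta>) h"
  let ?E = "\<lambda>\<xi> \<eta> h. elem_tensor FA (interior_tensor GB K) \<xi> (elem_tensor GB K \<eta> h)"
  have elem1: "elem_tensor GB K \<eta> h \<in> carr (interior_tensor GB K)" "tensor_val B (elem_tensor GB K \<eta> h) = B \<eta> h"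
    if "\<eta> \<in> carr GB" for \<eta> h
    using R1'.elem_tensor_val[OF that, of h] by simp_all
  have elem2: "?E \<xi> \<eta> h \<in> carr (interior_tensor FA (interior_tensor GB K))"
    "tensor_val ?j (?E \<xi> \<eta> h) = A \<xi> (B \<eta> h)" if "\<xi> \<in> carr FA" "\<eta> \<in> carr GB" for \<xi> \<eta> h
    using R2.elem_tensor_val[OF that(1) elem1(1)[OF that(2)]] elem1(2)[OF that(2)] by simp_all
  have elem3: "elem_tensor (interior_tensor FA GB) K (elem_tensor FA GB \<xi> \<eta>) h
        \<in> carr (interior_tensor (interior_tensor FA GB) K)"
    "tensor_val pair_val (elem_tensor (interior_tensor FA GB) K (elem_tensor FA GB \<xi> \<eta>) h) = A \<xi> (B \<eta> h)"
    if "\<xi> \<in> carr FA" "\<eta> \<in> carr GB" for \<xi> \<eta> h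
    using R3.elem_tensor_val[OF elem_pair(1)[OF that], of h] elem_pair(2)[OF that] by simp_all
  have assoc: "tensor_assoc FA GB K ?X = ?E \<xi> \<eta> h"
    unfolding tensor_assoc_def
  proof (rule the_equality)
    show "?E \<xi> \<eta> h \<in> carr (interior_tensor FA (interior_tensor GB K)) \<and>
        (\<forall>\<xi>'\<in>carr FA. \<forall>\<eta>'\<in>carr GB. \<forall>h'\<in>carr K.
          inn (interior_tensor FA (interior_tensor GB K)) (?E \<xi>' \<eta>' h') (?E \<xi> \<eta> h) =
          inn (interior_tensor (interior_tensor FA GB) K)
            (elem_tensor (interior_tensor FA GB) K (elem_tensor FA GB \<xi>' \<eta>') h') ?X)"
      using \<xi> \<eta> by (auto simp: fun_eq_iff R2.inn_tensor_val R3.inn_tensor_val elem2 elem3)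
  next
    fix Z assume Z: "Z \<in> carr (interior_tensor FA (interior_tensor GB K)) \<and>
        (\<forall>\<xi>'\<in>carr FA. \<forall>\<eta>'\<in>carr GB. \<forall>h'\<in>carr K.
          inn (interior_tensor FA (interior_tensor GB K)) (?E \<xi>' \<eta>' h') Z =
          inn (interior_tensor (interior_tensor FA GB) K)
            (elem_tensor (interior_tensor FA GB) K (elem_tensor FA GB \<xi>' \<eta>') h') ?X)"
    let ?d = "tensor_val ?j Z - A \<xi> (B \<eta> h)"
    have d: "cinner (A \<xi>' (B \<eta>' h')) ?d = 0" if "\<xi>' \<in> carr FA" "\<eta>' \<in> carr GB" for \<xi>' \<eta>' h'
    proof -
      have "cinner (A \<xi>' (B \<eta>' h')) (tensor_val ?j Z) = cinner (A \<xi>' (B \<eta>' h')) (A \<xi> (B \<eta> h))"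
        using Z[THEN conjunct2, rule_format, OF that, of h', THEN fun_cong, of "()"] Z[THEN conjunct1] that \<xi> \<eta>
        by (simp add: R2.inn_tensor_val R3.inn_tensor_val elem2 elem3)
      thus ?thesis by (simp add: cinner_diff)
    qed
    have "A \<xi>' (tensor_val B Z') \<in> orth_compl {?d}" if \<xi>': "\<xi>' \<in> carr FA" and Z': "Z' \<in> carr (interior_tensor GB K)" for \<xi>' Z'
    proof (rule bop_image_closed_cspan[OF A_bop[OF isoA \<xi>'] orth_compl_closed_csubspace _ R1'.tensor_val_in[OF Z']])
      fix x assume "x \<in> {B \<xi> g |\<xi> g. \<xi> \<in> carr GB \<and> g \<in> carr K}"
      thus "A \<xi>' x \<in> orth_compl {?d}"
        using d[OF \<xi>'] by (force simp: orth_compl_def intro: cinner_eq_0_sym)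
    qed
    hence "closed_cspan {?j \<xi>' Z' |\<xi>' Z'. \<xi>' \<in> carr FA \<and> Z' \<in> carr (interior_tensor GB K)} \<subseteq> orth_compl {?d}"
      by (intro closed_cspan_minimal orth_compl_closed_csubspace) auto
    hence "tensor_val ?j Z \<in> orth_compl {?d}" "A \<xi> (B \<eta> h) \<in> orth_compl {?d}"
      using R2.tensor_val_in[OF Z[THEN conjunct1]] R2.tensor_val_in[OF elem2(1)[OF \<xi> \<eta>, of h]]
      unfolding elem2(2)[OF \<xi> \<eta>] by (simp_all only: subset_iff)
    hence "?d \<in> orth_compl {?d}" by (rule closed_csubspaceD(5)[OF orth_compl_closed_csubspace])
    hence "tensor_val ?j Z = A \<xi> (B \<eta> h)" by (simp add: orth_compl_def)
    thus "Z = ?E \<xi> \<eta> h" using R2.tensor_val_inj Z elem2[OF \<xi> \<eta>] by simp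
  qed
  let ?y = "tensor_seq (?E \<xi> \<eta> h)"
  note y = R2.tensor_seq_lim[OF elem2(1)[OF \<xi> \<eta>, of h]]
  have list_eq: "list_val A (map (map_prod id (tilde B)) z) = list_val ?j z" for z
    by (induction z) (auto simp: tilde_eq_tensor_val)
  have "tensor_val A (tensor_map FA K id (tilde B) (?E \<xi> \<eta> h)) = A \<xi> (B \<eta> h)"
    unfolding tensor_map_def
  proof (rule R1.tensor_class_val(2))
    show "map (map_prod id (tilde B)) (?y n) \<in> alg_tensors FA K" for n
      by (rule tensor_map_alg[OF _ _ y(1)]) auto
    show "(\<lambda>n. list_val A (map (map_prod id (tilde B)) (?y n))) \<longlonglongrightarrow> A \<xi> (B \<eta> h)"
      unfolding list_eq using y(2) elem2(2)[OF \<xi> \<eta>] by simp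
  qed
  thus ?thesis unfolding tilde2_def assoc by (simp add: tilde_eq_tensor_val)
qed

end

text \<open>The two tensors \<open>\<xi> \<otimes> \<eta> \<otimes> h\<close> and \<open>\<eta>' \<otimes> \<xi>' \<otimes> h\<close> correspond to each other under \<open>t \<otimes> I\<close>.  As
  \<open>tensor_map\<close> works with an arbitrary representing sequence, this needs that \<open>t\<close> preserves distances
  of lists, which follows from its preserving inner products.\<close>
lemma commutation_from_tilde2:
  assumes isoA: "isometric_graph_rep X s r A" and isoB: "isometric_graph_rep Y s' r' B"
    and t: "corr_iso Vs (interior_tensor (graph_corr Vs X s r) (graph_corr Vs Y s' r'))
        (interior_tensor (graph_corr Vs Y s' r') (graph_corr Vs X s r)) t"
    and tilde: "\<And>Z. Z \<in> carr (interior_tensor (interior_tensor (graph_corr Vs X s r) (graph_corr Vs Y s' r')) K) \<Longrightarrow>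
        tilde2 (graph_corr Vs X s r) (graph_corr Vs Y s' r') UNIV \<rho> A B Z =
        tilde2 (graph_corr Vs Y s' r') (graph_corr Vs X s r) UNIV \<rho> B A
          (tensor_map (interior_tensor (graph_corr Vs Y s' r') (graph_corr Vs X s r)) K t id Z)"
    and elems: "\<xi> \<in> carr (graph_corr Vs X s r)" "\<eta> \<in> carr (graph_corr Vs Y s' r')"
      "\<xi>' \<in> carr (graph_corr Vs X s r)" "\<eta>' \<in> carr (graph_corr Vs Y s' r')"
    and t_elem: "t (elem_tensor (graph_corr Vs X s r) (graph_corr Vs Y s' r') \<xi> \<eta>) =
      elem_tensor (graph_corr Vs Y s' r') (graph_corr Vs X s r) \<eta>' \<xi>'"
  shows "A \<xi> (B \<eta> h) = B \<eta>' (A \<xi>' h)"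
proof -
  let ?F = "graph_corr Vs X s r" and ?G = "graph_corr Vs Y s' r'"
  let ?FG = "interior_tensor ?F ?G" and ?GF = "interior_tensor ?G ?F"
  let ?T = "elem_tensor ?F ?G \<xi> \<eta>" and ?T' = "elem_tensor ?G ?F \<eta>' \<xi>'"
  interpret R: tensor_realisation ?FG K "pair_val A B" by (rule realisation3[OF isoA isoB])
  interpret R': tensor_realisation ?GF K "pair_val B A" by (rule realisation3[OF isoB isoA])
  have T: "?T \<in> carr ?FG" by (rule elem_pair(1)[OF isoA isoB elems(1,2)])
  have T': "?T' \<in> carr ?GF" by (rule elem_pair(1)[OF isoB isoA elems(4,3)])
  have t_carr: "t Z \<in> carr ?GF" if "Z \<in> carr ?FG" for Z
    using t that by (auto simp: corr_iso_def bij_betw_def)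
  have t_inn: "inn ?GF (t Z) (t Z') = inn ?FG Z Z'" if "Z \<in> carr ?FG" "Z' \<in> carr ?FG" for Z Z'
    using t that by (simp add: corr_iso_def)
  have t_neg: "cmult ?GF (-1) (t Z) = t (cmult ?FG (-1) Z)" if "Z \<in> carr ?FG" for Z
    using t that by (simp add: corr_iso_def)
  let ?m = "map (map_prod t id)"
  have m_alg: "?m z \<in> alg_tensors ?GF K" if "z \<in> alg_tensors ?FG K" for z
    by (rule tensor_map_alg[OF _ _ that]) (auto simp: t_carr)
  have m_inn: "alg_inn ?GF K (?m z) (?m w) v = alg_inn ?FG K z w v"
    if z: "z \<in> alg_tensors ?FG K" and w: "w \<in> alg_tensors ?FG K" for z w v
  proof -
    have "(\<Sum>(\<eta>, k)\<leftarrow>?m w. inn K g (lact K (inn ?GF (t Z) \<eta>) k) v) =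
        (\<Sum>(\<eta>, k)\<leftarrow>w. inn K g (lact K (inn ?FG Z \<eta>) k) v)" if "Z \<in> carr ?FG" for Z g
      using w by (induction w) (auto simp: t_inn that)
    thus ?thesis using z by (induction z) (auto simp: alg_inn_simps)
  qed
  have m_neg: "neg_list ?GF (?m w) = ?m (neg_list ?FG w)" if "w \<in> alg_tensors ?FG K" for w
    unfolding list.map_comp
  proof (rule map_cong[OF refl])
    fix p assume "p \<in> set w"
    moreover obtain Z g where p: "p = (Z, g)" by force
    ultimately have "Z \<in> carr ?FG" using that by (auto simp: alg_tensors_def)
    thus "(map_prod (cmult ?GF (-1)) id \<circ> map_prod t id) p = (map_prod t id \<circ> map_prod (cmult ?FG (-1)) id) p"
      by (simp add: p t_neg)
  qed
  have m_dist: "alg_dist ?GF K (?m z) (?m w) = alg_dist ?FG K z w"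
    if z: "z \<in> alg_tensors ?FG K" and w: "w \<in> alg_tensors ?FG K" for z w
  proof -
    have y: "z @ neg_list ?FG w \<in> alg_tensors ?FG K" using z R.neg_alg(1)[OF w] by simp
    have "?m z @ neg_list ?GF (?m w) = ?m (z @ neg_list ?FG w)"
      unfolding m_neg[OF w] by simp
    moreover have "alg_inn ?GF K (?m (z @ neg_list ?FG w)) (?m (z @ neg_list ?FG w)) =
        alg_inn ?FG K (z @ neg_list ?FG w) (z @ neg_list ?FG w)"
      by (rule ext) (rule m_inn[OF y y])
    ultimately show ?thesis unfolding alg_dist_def Let_def by metis
  qed
  let ?X = "elem_tensor ?FG K ?T h" and ?X' = "elem_tensor ?GF K ?T' h"
  have X: "?X \<in> carr (interior_tensor ?FG K)" "tensor_val (pair_val A B) ?X = pair_val A B ?T h"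
    using R.elem_tensor_val[OF T, of h] by simp_all
  have X': "?X' \<in> carr (interior_tensor ?GF K)" "tensor_val (pair_val B A) ?X' = pair_val B A ?T' h"
    using R'.elem_tensor_val[OF T', of h] by simp_all
  note x = R.tensor_seq_lim(1,2)[OF X(1)]
  have single: "[(?T, h)] \<in> alg_tensors ?FG K" using T by simp
  have lim: "(\<lambda>n. list_val (pair_val B A) (?m (tensor_seq ?X n))) \<longlonglongrightarrow> pair_val B A ?T' h"
  proof -
    have "norm (list_val (pair_val B A) (?m (tensor_seq ?X n)) - pair_val B A ?T' h) =
        norm (list_val (pair_val A B) (tensor_seq ?X n) - pair_val A B ?T h)" for n
    proof -
      have "norm (list_val (pair_val B A) (?m (tensor_seq ?X n)) - pair_val B A ?T' h) =
          alg_dist ?GF K (?m (tensor_seq ?X n)) (?m [(?T, h)])"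
        by (subst R'.alg_dist_eq[OF m_alg[OF x(1)] m_alg[OF single]]) (simp add: t_elem)
      also have "\<dots> = alg_dist ?FG K (tensor_seq ?X n) [(?T, h)]" by (rule m_dist[OF x(1) single])
      also have "\<dots> = norm (list_val (pair_val A B) (tensor_seq ?X n) - pair_val A B ?T h)"
        by (simp add: R.alg_dist_eq[OF x(1) single])
      finally show ?thesis .
    qed
    moreover have "(\<lambda>n. list_val (pair_val A B) (tensor_seq ?X n) - pair_val A B ?T h) \<longlonglongrightarrow> 0"
      using x(2) unfolding X(2) by (simp add: LIM_zero_iff)
    ultimately have "(\<lambda>n. norm (list_val (pair_val B A) (?m (tensor_seq ?X n)) - pair_val B A ?T' h)) \<longlonglongrightarrow> 0"
      by (simp only: tendsto_norm_zero_iff)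
    hence "(\<lambda>n. list_val (pair_val B A) (?m (tensor_seq ?X n)) - pair_val B A ?T' h) \<longlonglongrightarrow> 0"
      by (rule tendsto_norm_zero_cancel)
    thus ?thesis by (simp add: LIM_zero_iff)
  qed
  have "tensor_map ?GF K t id ?X = ?X'"
    unfolding tensor_map_def
    using R'.tensor_class_val[OF m_alg[OF x(1)] lim] X' by (intro R'.tensor_val_inj) auto
  hence "tilde2 ?F ?G UNIV \<rho> A B ?X = tilde2 ?G ?F UNIV \<rho> B A ?X'" using tilde[OF X(1)] by simp
  thus ?thesis
    by (simp add: tilde2_elem_tensor[OF isoA isoB elems(1,2)] tilde2_elem_tensor[OF isoB isoA elems(4,3)])
qed

end


section \<open>The weak operator topology\<close>

lemma topspace_wot: "topspace wot = {T :: 'h::complex_hilbert_space \<Rightarrow> 'h. bop T}"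
  unfolding wot_def topology_generated_by_topspace by (auto intro!: exI[of _ UNIV])

lemma openin_wot_basis: "open U \<Longrightarrow> openin wot {T. bop T \<and> cinner x (T y) \<in> U}"
  unfolding wot_def by (rule topology_generated_by_Basis) blast

lemma wot_closure_bop: "T \<in> wot closure_of A \<Longrightarrow> bop T"
  using closure_of_subset_topspace[of wot A] by (auto simp: topspace_wot)

text \<open>Closed subspaces are cut out by the functionals \<open>cinner y\<close>, so they are weakly closed.\<close>
lemma wot_closure_maps_into:
  assumes T: "T \<in> wot closure_of A" and W: "closed_csubspace W" and A: "\<And>U. U \<in> A \<Longrightarrow> U x \<in> W"
  shows "T x \<in> W"
proof -
  have "cinner y (T x) = 0" if y: "y \<in> orth_compl W" for y
  proof (rule ccontr)
    assume ne: "cinner y (T x) \<noteq> 0"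
    let ?N = "{T. bop T \<and> cinner y (T x) \<in> - {0}}"
    have "openin wot ?N" by (rule openin_wot_basis) auto
    moreover have "T \<in> ?N" using ne wot_closure_bop[OF T] by simp
    ultimately have "\<exists>U. U \<in> A \<and> U \<in> ?N"
      by (intro T[unfolded in_closure_of, THEN conjunct2, THEN spec, of ?N, THEN mp] conjI)
    then obtain U where "U \<in> A" "U \<in> ?N" by (elim exE conjE)
    moreover have "cinner y (U x) = 0"
      using y A[OF \<open>U \<in> A\<close>] by (subst cinner_commute) (simp add: orth_compl_def)
    ultimately show False by simp
  qed
  hence "T x \<in> orth_compl (orth_compl W)" by (simp add: orth_compl_def)
  thus ?thesis by (simp add: orth_compl_orth_compl[OF W])
qed

lemma wot_neighbourhood:
  assumes "openin wot W" "T \<in> W"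
  shows "\<exists>X \<epsilon>. finite X \<and> \<epsilon> > 0 \<and> (\<forall>U. bop U \<and> (\<forall>x\<in>X. norm (U x - T x) < \<epsilon>) \<longrightarrow> U \<in> W)"
proof -
  let ?B = "{{T. bop T \<and> cinner x (T y) \<in> U} |x y U. open U} :: ('a \<Rightarrow> 'a) set set"
  have "generate_topology_on ?B W"
    using assms(1) unfolding wot_def openin_topology_generated_by_iff .
  thus ?thesis using assms(2)
  proof (induction W)
    case (Int W1 W2)
    obtain X1 \<epsilon>1 where 1: "finite X1" "\<epsilon>1 > 0"
      "\<forall>U. bop U \<and> (\<forall>x\<in>X1. norm (U x - T x) < \<epsilon>1) \<longrightarrow> U \<in> W1"
      using Int.IH(1)[OF IntD1[OF Int.prems]] by (elim exE conjE)
    obtain X2 \<epsilon>2 where 2: "finite X2" "\<epsilon>2 > 0"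
      "\<forall>U. bop U \<and> (\<forall>x\<in>X2. norm (U x - T x) < \<epsilon>2) \<longrightarrow> U \<in> W2"
      using Int.IH(2)[OF IntD2[OF Int.prems]] by (elim exE conjE)
    show ?case
      by (rule exI[of _ "X1 \<union> X2"], rule exI[of _ "min \<epsilon>1 \<epsilon>2"]) (use 1 2 in auto)
  next
    case (UN K)
    then obtain W' where "W' \<in> K" "T \<in> W'" by blast
    thus ?case using UN.IH[of W'] by blast
  next
    case (Basis W)
    then obtain x y U where W: "W = {T. bop T \<and> cinner x (T y) \<in> U}" and U: "open U" by auto
    have "cinner x (T y) \<in> U" using Basis.prems W by simp
    then obtain e where e: "e > 0" "ball (cinner x (T y)) e \<subseteq> U" using U open_contains_ball by blast
    have "U' \<in> W" if "bop U'" "norm (U' y - T y) < e / (norm x + 1)" for U'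
    proof -
      have "dist (cinner x (T y)) (cinner x (U' y)) = cmod (cinner x (U' y - T y))"
        by (simp add: dist_norm cinner_diff norm_minus_commute)
      also have "\<dots> \<le> norm x * norm (U' y - T y)" by (rule cinner_cauchy_schwarz)
      also have "\<dots> \<le> (norm x + 1) * norm (U' y - T y)" by (intro mult_right_mono) auto
      also have "\<dots> < e"
        using that(2) by (simp add: pos_less_divide_eq add_nonneg_pos mult.commute)
      finally show ?thesis using e(2) that(1) W by auto
    qed
    moreover have "e / (norm x + 1) > 0" using e(1) by (simp add: add_nonneg_pos)
    ultimately show ?case by (intro exI[of _ "{y}"] exI[of _ "e / (norm x + 1)"]) auto
  qed simp
qed

text \<open>Strong approximation on finite tuples implies weak approximation.\<close>
lemma in_wot_closureI:
  fixes T :: "'h::complex_hilbert_space \<Rightarrow> 'h"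
  assumes T: "bop T" and A: "\<And>U. U \<in> A \<Longrightarrow> bop U"
    and approx: "\<And>(x :: nat \<Rightarrow> 'h) n \<epsilon>. \<epsilon> > 0 \<Longrightarrow> \<exists>U\<in>A. \<forall>j<n. norm (U (x j) - T (x j)) < \<epsilon>"
  shows "T \<in> wot closure_of A"
  unfolding in_closure_of
proof (intro conjI allI impI)
  show "T \<in> topspace wot" by (simp add: topspace_wot T)
  fix W assume "T \<in> W \<and> openin wot W"
  then obtain X \<epsilon> where X: "finite X" "\<epsilon> > 0" "\<And>U. bop U \<Longrightarrow> (\<forall>x\<in>X. norm (U x - T x) < \<epsilon>) \<Longrightarrow> U \<in> W"
    using wot_neighbourhood by (metis (no_types, lifting))
  obtain x :: "nat \<Rightarrow> 'h" and n where x: "X = x ` {j. j < n}"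
    using finite_imp_nat_seg_image_inj_on[OF X(1)] by blast
  obtain U where "U \<in> A" "\<forall>j<n. norm (U (x j) - T (x j)) < \<epsilon>" using approx[OF X(2)] by blast
  thus "\<exists>U. U \<in> A \<and> U \<in> W" using X(3)[OF A] x by blast
qed


section \<open>Representations of higher-rank graphs\<close>

text \<open>The generators \<open>axis i 1\<close> of the degrees have to keep the form in which \<open>fibre\<close> mentions them.\<close>
declare One_nat_def [simp del]

locale coisometric_system_rep =
  fixes G :: "('a, 'k::finite) kgraph"
    and t :: "'k \<Rightarrow> 'k \<Rightarrow> 'a fibre_tensor \<Rightarrow> 'a fibre_tensor"
    and S :: "'k \<Rightarrow> ('a \<Rightarrow> complex) \<Rightarrow> 'h::complex_hilbert_space \<Rightarrow> 'h"
    and \<rho> :: "('a \<Rightarrow> complex) \<Rightarrow> 'h \<Rightarrow> 'h"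
  assumes kgraph: "is_kgraph G"
    and finite_vertices: "finite (vertices G)"
    and isos: "product_system_isos G t"
    and system_rep: "system_rep G t UNIV S \<rho>"
    and isometric: "isometric_rep G UNIV S \<rho>"
    and coisometric: "fully_coisometric_rep G UNIV S \<rho>"
begin

abbreviation edges :: "'k \<Rightarrow> 'a set" where "edges i \<equiv> paths_of_degree G (axis i 1)"

sublocale finite_vertex_rep "vertices G" \<rho>
  using finite_vertices system_rep by unfold_locales (auto simp: system_rep_def corr_rep_def)

lemma isometric_fibre: "isometric_graph_rep (edges i) (src G) (rng G) (S i)"
proof -
  have "src G ` edges i \<subseteq> vertices G"
    using kgraph by (auto simp: is_kgraph_def small_category_def paths_of_degree_def)
  thus ?thesis
    using system_rep isometric by (simp add: isometric_graph_rep_def system_rep_def isometric_rep_def)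
qed

abbreviation Se where "Se i e \<equiv> S i (delta e)"
abbreviation Sa where "Sa i e \<equiv> adj_on UNIV (S i (delta e))"

lemma bop_Se: "e \<in> edges i \<Longrightarrow> bop (Se i e)"
  by (rule A_bop[OF isometric_fibre delta_carr])

lemma src_vertex: "e \<in> edges i \<Longrightarrow> src G e \<in> vertices G"
  using isometric_fibre[of i] by (auto simp: isometric_graph_rep_def)

text \<open>A composable pair of edges of colours \<open>i\<close> and \<open>j\<close> refactors through edges of colours \<open>j\<close> and \<open>i\<close>,
  and \<open>t i j\<close> exchanges the corresponding elementary tensors.  For other pairs the product vanishes,
  as distinct vertex projections are orthogonal.\<close>
lemma Se_commute:
  assumes e: "e \<in> edges i" and f: "f \<in> edges j"
  shows "(\<forall>x. Se i e (Se j f x) = 0) \<or>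
    (\<exists>f'\<in>edges j. \<exists>e'\<in>edges i. \<forall>x. Se i e (Se j f x) = Se j f' (Se i e' x))"
proof (cases "src G e = rng G f")
  case False
  have "Se i e (Se j f x) = 0" for x
  proof -
    have "Se i e (Se j f x) = Se i e (Pr (src G e) (Se j f x))"
      by (rule A_delta_Pr[OF isometric_fibre e, symmetric])
    also have "Pr (src G e) (Se j f x) = 0"
      using False by (simp add: Pr_A_delta[OF isometric_fibre f src_vertex[OF e]])
    finally show ?thesis by (simp add: bop_zero[OF bop_Se[OF e]])
  qed
  thus ?thesis by blast
next
  case True
  have mor: "e \<in> mor G" "f \<in> mor G" "deg G e = axis i 1" "deg G f = axis j 1"
    using e f by (auto simp: paths_of_degree_def)
  have c: "cmp G e f \<in> mor G" using kgraph True mor by (simp add: is_kgraph_def small_category_def)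
  have "deg G (cmp G e f) = axis j 1 + axis i 1"
    using kgraph True mor by (simp add: is_kgraph_def add.commute)
  moreover have "\<forall>x\<in>mor G. \<forall>m n. deg G x = m + n \<longrightarrow>
        (\<exists>!p. fst p \<in> mor G \<and> snd p \<in> mor G \<and> src G (fst p) = rng G (snd p) \<and>
              x = cmp G (fst p) (snd p) \<and> deg G (fst p) = m \<and> deg G (snd p) = n)"
    using kgraph unfolding is_kgraph_def by (elim conjE)
  ultimately obtain p where p: "fst p \<in> mor G" "snd p \<in> mor G" "src G (fst p) = rng G (snd p)"
      "cmp G e f = cmp G (fst p) (snd p)" "deg G (fst p) = axis j 1" "deg G (snd p) = axis i 1"
    using c by blast
  let ?f' = "fst p" and ?e' = "snd p"
  have f': "?f' \<in> edges j" and e': "?e' \<in> edges i" using p by (auto simp: paths_of_degree_def)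
  have "Se i e (Se j f x) = Se j ?f' (Se i ?e' x)" for x
  proof (rule commutation_from_tilde2[OF isometric_fibre isometric_fibre])
    show "corr_iso (vertices G) (interior_tensor (fibre G i) (fibre G j))
        (interior_tensor (fibre G j) (fibre G i)) (t i j)"
      using isos by (simp add: product_system_isos_def)
    show "t i j (elem_tensor (fibre G i) (fibre G j) (delta e) (delta f)) =
        elem_tensor (fibre G j) (fibre G i) (delta ?f') (delta ?e')"
      using isos e f e' f' True p by (simp add: product_system_isos_def)
  qed (use system_rep e f e' f' in \<open>simp_all add: system_rep_def delta_carr\<close>)
  thus ?thesis using e' f' by blast
qed

lemma S_in_closed_cspan: "\<xi> \<in> carr (fibre G i) \<Longrightarrow> S i \<xi> x \<in> closed_cspan {Se i e x |e. e \<in> edges i}"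
  by (rule A_in_closed_cspan_delta[OF isometric_fibre])

sublocale edge_system edges Se Sa "vertices G" Pr
proof
  fix i j e f v and x y :: 'h
  show "e \<in> edges i \<Longrightarrow> bop (Se i e)" by (rule bop_Se)
  show "e \<in> edges i \<Longrightarrow> cinner (Se i e x) y = cinner x (Sa i e y)"
    by (rule adj_on_UNIV[OF bop_Se, symmetric])
  show "v \<in> vertices G \<Longrightarrow> bop (Pr v)" by (rule bop_Pr)
  show "v \<in> vertices G \<Longrightarrow> cinner (Pr v x) y = cinner x (Pr v y)" by (rule Pr_selfadjoint)
  show "v \<in> vertices G \<Longrightarrow> Pr v (Pr v x) = Pr v x" by (simp add: Pr_mult)
  show "e \<in> edges i \<Longrightarrow> \<exists>v\<in>vertices G. \<forall>x. Sa i e (Se i e x) = Pr v x"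
    using A_adj_delta[OF isometric_fibre] src_vertex by auto
  show "e \<in> edges i \<Longrightarrow> f \<in> edges i \<Longrightarrow> e \<noteq> f \<Longrightarrow> Sa i e (Se i f x) = 0"
    by (simp add: A_adj_delta[OF isometric_fibre])
  show "v \<in> vertices G \<Longrightarrow> e \<in> edges i \<Longrightarrow>
      (\<forall>x. Pr v (Se i e x) = Se i e x) \<or> (\<forall>x. Pr v (Se i e x) = 0)"
    by (simp add: Pr_A_delta[OF isometric_fibre])
  show "e \<in> edges i \<Longrightarrow> f \<in> edges j \<Longrightarrow> (\<forall>x. Se i e (Se j f x) = 0) \<or>
      (\<exists>f'\<in>edges j. \<exists>e'\<in>edges i. \<forall>x. Se i e (Se j f x) = Se j f' (Se i e' x))"
    by (rule Se_commute)
  let ?W = "closed_cspan {Se i e x |e x. e \<in> edges i}"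
  have "{S i \<xi> h |\<xi> h. \<xi> \<in> carr (fibre G i)} \<subseteq> ?W"
  proof safe
    fix \<xi> h assume "\<xi> \<in> carr (fibre G i)"
    hence "S i \<xi> h \<in> closed_cspan {Se i e h |e. e \<in> edges i}" by (rule S_in_closed_cspan)
    also have "\<dots> \<subseteq> ?W"
      by (intro closed_cspan_minimal closed_cspan_closed_csubspace subset_trans[OF _ closed_cspan_superset]) auto
    finally show "S i \<xi> h \<in> ?W" .
  qed
  hence "closed_cspan {S i \<xi> h |\<xi> h. \<xi> \<in> carr (fibre G i)} \<subseteq> ?W"
    by (intro closed_cspan_minimal closed_cspan_closed_csubspace)
  moreover have "closed_cspan {S i \<xi> h |\<xi> h. \<xi> \<in> carr (fibre G i)} = UNIV"
    by (rule coisometric_total[OF isometric_fibre]) (use coisometric in \<open>simp add: fully_coisometric_rep_def\<close>)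
  ultimately show "?W = UNIV" by auto
qed

abbreviation gens :: "('h \<Rightarrow> 'h) set" where
  "gens \<equiv> {id} \<union> {S i \<xi> |i \<xi>. \<xi> \<in> carr (fibre G i)} \<union> {\<rho> a |a. a \<in> C0 (vertices G)}"
abbreviation alg where "alg \<equiv> generated_algebra gens"
abbreviation SS where "SS \<equiv> rep_wot_algebra G S \<rho>"

lemma alg_bop: "T \<in> alg \<Longrightarrow> bop T"
proof (induction rule: generated_algebra.induct)
  case (gen T)
  have "bop (id :: 'h \<Rightarrow> 'h)" by (rule bopI[of _ 1]) auto
  thus ?case using gen A_bop[OF isometric_fibre] rho_bop by auto
next
  case (add T U)
  from bop_bound[OF add.IH(1)] bop_bound[OF add.IH(2)] obtain K L where
    KL: "\<And>x. norm (T x) \<le> K * norm x" "\<And>x. norm (U x) \<le> L * norm x" by blast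
  have "norm (T x + U x) \<le> (K + L) * norm x" for x
    using norm_triangle_ineq[of "T x" "U x"] KL[of x] by (simp add: distrib_right)
  thus ?case
    using add.IH by (intro bopI[where K = "K + L"]) (auto simp: bop_add bop_cscale cscale_add_right algebra_simps)
next
  case (scale T c)
  from bop_bound[OF scale.IH] obtain K where K: "\<And>x. norm (T x) \<le> K * norm x" by blast
  have "norm (c *\<^sub>C T x) \<le> (cmod c * K) * norm x" for x
    using mult_left_mono[OF K[of x], of "cmod c"] by (simp add: mult.assoc)
  thus ?case
    using scale.IH by (intro bopI[where K = "cmod c * K"]) (auto simp: bop_add bop_cscale cscale_add_right cscale_cscale mult.commute)
next
  case (comp T U)
  from bop_bound[OF comp.IH(1)] bop_bound[OF comp.IH(2)] obtain K L where
    KL: "K \<ge> 0" "\<And>x. norm (T x) \<le> K * norm x" "\<And>x. norm (U x) \<le> L * norm x" by blast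
  have "norm ((T \<circ> U) x) \<le> (K * L) * norm x" for x
    using KL(2)[of "U x"] mult_left_mono[OF KL(3)[of x] KL(1)] by (simp add: mult.assoc)
  thus ?case using comp.IH by (intro bopI[where K = "K * L"]) (auto simp: bop_add bop_cscale)
qed

lemma alg_subset_SS: "alg \<subseteq> SS"
  unfolding rep_wot_algebra_def using alg_bop by (intro closure_of_subset) (auto simp: topspace_wot)

lemma Se_in_alg: "e \<in> edges i \<Longrightarrow> Se i e \<in> alg"
  using delta_carr[of e "edges i" "src G" "rng G"] by (intro generated_algebra.gen) auto

lemma Pr_in_alg: "v \<in> vertices G \<Longrightarrow> Pr v \<in> alg"
  by (rule generated_algebra.gen) (use delta_C0 in \<open>auto simp: Pr_def\<close>)

lemma id_in_alg: "id \<in> alg"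
  by (rule generated_algebra.gen) blast

lemma S_maps_into:
  assumes W: "invariant W" and x: "x \<in> W" and \<xi>: "\<xi> \<in> carr (fibre G i)" shows "S i \<xi> x \<in> W"
proof -
  have "closed_cspan {Se i e x |e. e \<in> edges i} \<subseteq> W"
    using W x by (intro closed_cspan_minimal) (auto simp: invariant_def)
  thus ?thesis using S_in_closed_cspan[OF \<xi>] by blast
qed

text \<open>A closed subspace invariant under the edges and vertices is invariant under all generators, since
  \<open>S i \<xi> x\<close> is a limit of combinations of the \<open>Se i e x\<close>; hence it is invariant under the
  weakly closed algebra.\<close>
lemma SS_maps_into:
  assumes T: "T \<in> SS" and W: "invariant W" and P: "\<And>v x. v \<in> vertices G \<Longrightarrow> x \<in> W \<Longrightarrow> Pr v x \<in> W"
    and x: "x \<in> W"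
  shows "T x \<in> W"
proof (rule wot_closure_maps_into[OF T[unfolded rep_wot_algebra_def]])
  show Wc: "closed_csubspace W" using W by (simp add: invariant_def)
  fix U assume "U \<in> alg"
  thus "U x \<in> W" using x
  proof (induction arbitrary: x rule: generated_algebra.induct)
    case (gen T)
    then consider "T = id" | i \<xi> where "T = S i \<xi>" "\<xi> \<in> carr (fibre G i)" | a where "T = \<rho> a" "a \<in> C0 (vertices G)"
      by auto
    thus ?case
    proof cases
      case 3
      have "(\<Sum>v\<in>vertices G. a v *\<^sub>C Pr v x) \<in> W"
        using P gen.prems closed_csubspaceD[OF Wc] by (intro complex_vector.subspace_sum) auto
      thus ?thesis using 3 by (simp add: rho_eq_sum)
    qed (use gen.prems S_maps_into[OF W] in auto)
  qed (use closed_csubspaceD[OF Wc] in auto)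
qed

lemma cyclic_coinvariant_iff:
  "cyclic_coinvariant SS M \<longleftrightarrow> coinvariant M \<and> orbit_span M = UNIV"
proof
  assume cyc: "cyclic_coinvariant SS M"
  have M: "closed_csubspace M" and adj: "\<And>T x. T \<in> SS \<Longrightarrow> x \<in> M \<Longrightarrow> adj_on UNIV T x \<in> M"
    and span: "closed_cspan {T x |T x. T \<in> SS \<and> x \<in> M} = UNIV"
    using cyc by (auto simp: cyclic_coinvariant_def)
  have adjP: "adj_on UNIV (Pr v) = Pr v" if "v \<in> vertices G" for v
    by (rule adj_on_UNIV_eqI[OF bop_Pr[OF that] Pr_selfadjoint[OF that]])
  have co: "coinvariant M"
    unfolding coinvariant_def
  proof (intro conjI allI ballI M)
    fix i e x assume "e \<in> edges i" "x \<in> M"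
    thus "Sa i e x \<in> M" using adj Se_in_alg alg_subset_SS by blast
  next
    fix v x assume "v \<in> vertices G" "x \<in> M"
    thus "Pr v x \<in> M" using adj[of "Pr v" x] adjP Pr_in_alg alg_subset_SS by auto
  qed
  have "T x \<in> orbit_span M" if "T \<in> SS" "x \<in> M" for T x
    using that SS_maps_into[OF _ invariant_orbit_span] coinvariantD(3)[OF coinvariant_orbit_span[OF co]]
      subset_orbit_span by blast
  hence "closed_cspan {T x |T x. T \<in> SS \<and> x \<in> M} \<subseteq> orbit_span M"
    by (intro closed_cspan_minimal closed_csubspace_orbit_span) auto
  thus "coinvariant M \<and> orbit_span M = UNIV" using co span by auto
next
  assume "coinvariant M \<and> orbit_span M = UNIV"
  hence co: "coinvariant M" and span: "orbit_span M = UNIV" by auto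
  note M = coinvariantD(1)[OF co]
  have inv: "invariant (orth_compl M)"
    unfolding invariant_def
  proof (intro conjI allI ballI orth_compl_closed_csubspace)
    fix i e x assume e: "e \<in> edges i" and x: "x \<in> orth_compl M"
    show "Se i e x \<in> orth_compl M"
    proof (rule orth_compl_invariant[of "Sa i e", OF _ _ x])
      show "cinner (Sa i e x) y = cinner x (Se i e y)" for x y
        using S_adjoint[OF e] by (metis cinner_commute)
    qed (rule coinvariantD(2)[OF co e])
  qed
  have P: "Pr v x \<in> orth_compl M" if "v \<in> vertices G" "x \<in> orth_compl M" for v x
    by (rule orth_compl_invariant[of "Pr v", OF _ _ that(2)])
      (use that(1) Pr_selfadjoint coinvariantD(3)[OF co] in auto)
  have "adj_on UNIV T x \<in> M" if T: "T \<in> SS" and x: "x \<in> M" for T x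
  proof -
    have "cinner y (adj_on UNIV T x) = 0" if y: "y \<in> orth_compl M" for y
    proof -
      have "T y \<in> orth_compl M" by (rule SS_maps_into[OF T inv P y])
      hence "cinner (T y) x = 0" using x by (subst cinner_commute) (simp add: orth_compl_def)
      thus ?thesis using adj_on_UNIV[OF wot_closure_bop[OF T[unfolded rep_wot_algebra_def]]] by simp
    qed
    hence "adj_on UNIV T x \<in> orth_compl (orth_compl M)" by (simp add: orth_compl_def)
    thus ?thesis by (simp add: orth_compl_orth_compl[OF M])
  qed
  moreover have "closed_cspan {T x |T x. T \<in> SS \<and> x \<in> M} = UNIV"
  proof -
    have "word_vectors M c \<subseteq> {T x |T x. T \<in> alg \<and> x \<in> M}" for c
    proof (induction c)
      case Nil
      show ?case
      proof
        fix x assume "x \<in> word_vectors M []"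
        hence "x = id x" "x \<in> M" by simp_all
        thus "x \<in> {T x |T x. T \<in> alg \<and> x \<in> M}" using id_in_alg by blast
      qed
    next
      case (Cons i c)
      show ?case
      proof
        fix y assume "y \<in> word_vectors M (i # c)"
        then consider "y = 0" | e z where "y = Se i e z" "e \<in> edges i" "z \<in> word_vectors M c" by auto
        thus "y \<in> {T x |T x. T \<in> alg \<and> x \<in> M}"
        proof cases
          case 1
          hence "y = id 0" by simp
          thus ?thesis using id_in_alg closed_csubspaceD(3)[OF M] by blast
        next
          case 2
          then obtain T x where "z = T x" "T \<in> alg" "x \<in> M" using Cons.IH by blast
          moreover from this have "y = (Se i e \<circ> T) x" using 2 by simp
          moreover have "Se i e \<circ> T \<in> alg"
            using generated_algebra.comp[OF Se_in_alg[OF 2(2)] \<open>T \<in> alg\<close>] .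
          ultimately show ?thesis by blast
        qed
      qed
    qed
    hence "(\<Union>c. word_vectors M c) \<subseteq> {T x |T x. T \<in> SS \<and> x \<in> M}"
      using alg_subset_SS by blast
    hence "(\<Union>c. word_vectors M c) \<subseteq> closed_cspan {T x |T x. T \<in> SS \<and> x \<in> M}"
      by (rule subset_trans[OF _ closed_cspan_superset])
    hence "orbit_span M \<subseteq> closed_cspan {T x |T x. T \<in> SS \<and> x \<in> M}"
      unfolding orbit_span_def by (rule closed_cspan_minimal[OF closed_cspan_closed_csubspace])
    thus ?thesis using span by auto
  qed
  ultimately show "cyclic_coinvariant SS M" using M by (auto simp: cyclic_coinvariant_def)
qed

text \<open>The space of the dilated representation is coinvariant because its complement is invariant, and
  cyclic because the dilation is minimal.\<close>
lemma finitely_correlated_coinvariant: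
  assumes "finitely_correlated G t S \<rho>"
  shows "\<exists>W. coinvariant W \<and> finite_dim W \<and> orbit_span W = UNIV"
proof -
  obtain W A \<sigma> where W: "finite_dim W" "system_dilates G S \<rho> W A \<sigma>" "minimal_dilation_space G S W"
    using assms by (auto simp: finitely_correlated_def)
  have Wc: "closed_csubspace W" by (rule finite_dim_closed_csubspace[OF W(1)])
  have dilates: "corr_dilates (vertices G) (fibre G i) (S i) \<rho> W (A i) \<sigma>" for i
    using W(2) by (simp add: system_dilates_def)
  have dil_rho: "\<rho> a x \<in> W" if "a \<in> C0 (vertices G)" "x \<in> W" for a x
    using dilates[of undefined] that unfolding corr_dilates_def by blast
  have dil_S: "S i \<xi> x \<in> orth_compl W" if "\<xi> \<in> carr (fibre G i)" "x \<in> orth_compl W" for i \<xi> x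
    using dilates[of i] that unfolding corr_dilates_def by blast
  have co: "coinvariant W"
    unfolding coinvariant_def
  proof (intro conjI allI ballI Wc)
    fix i e x assume e: "e \<in> edges i" and x: "x \<in> W"
    have "Sa i e x \<in> orth_compl (orth_compl W)"
    proof (rule orth_compl_invariant[OF S_adjoint[OF e]])
      show "y \<in> orth_compl W \<Longrightarrow> Se i e y \<in> orth_compl W" for y by (rule dil_S[OF delta_carr[OF e]])
      show "x \<in> orth_compl (orth_compl W)" using x by (simp add: orth_compl_orth_compl[OF Wc])
    qed
    thus "Sa i e x \<in> W" by (simp add: orth_compl_orth_compl[OF Wc])
  next
    fix v x assume "v \<in> vertices G" "x \<in> W"
    thus "Pr v x \<in> W" using dil_rho[OF delta_C0] by (simp add: Pr_def)
  qed
  have "foldr (\<circ>) Xs id w \<in> orbit_span W"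
    if "set Xs \<subseteq> {S i \<xi> |i \<xi>. \<xi> \<in> carr (fibre G i)}" "w \<in> W" for Xs w
    using that(1)
  proof (induction Xs)
    case Nil
    show ?case using subsetD[OF subset_orbit_span that(2)] by simp
  next
    case (Cons X Xs)
    then obtain i \<xi> where "X = S i \<xi>" "\<xi> \<in> carr (fibre G i)" by auto
    thus ?case using S_maps_into[OF invariant_orbit_span] Cons by simp
  qed
  hence "closed_cspan {foldr (\<circ>) Xs id w |Xs w. set Xs \<subseteq> {S i \<xi> |i \<xi>. \<xi> \<in> carr (fibre G i)} \<and> w \<in> W}
      \<subseteq> orbit_span W"
    by (intro closed_cspan_minimal closed_csubspace_orbit_span) blast
  hence "orbit_span W = UNIV" using W(3) by (auto simp: minimal_dilation_space_def)
  thus ?thesis using co W(1) by blast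
qed

lemma minimal_cyclic_coinvariant_iff:
  assumes M: "least_cyclic M"
  shows "minimal_cyclic_coinvariant SS N \<longleftrightarrow> N = M"
proof -
  have cyc: "cyclic_coinvariant SS M" using M by (simp add: cyclic_coinvariant_iff least_cyclic_def)
  have least: "M \<subseteq> L" if "cyclic_coinvariant SS L" for L
    using that M by (simp add: cyclic_coinvariant_iff least_cyclic_def)
  show ?thesis unfolding minimal_cyclic_coinvariant_def using cyc least by blast
qed

lemma orth_proj_in_SS:
  assumes M: "least_cyclic M" shows "orth_proj M \<in> SS"
  unfolding rep_wot_algebra_def
proof (rule in_wot_closureI[OF bop_orth_proj alg_bop])
  show "closed_csubspace M" using M coinvariantD(1) by (auto simp: least_cyclic_def)
  show "\<exists>U\<in>alg. \<forall>j<n. norm (U (x j) - orth_proj M (x j)) < \<epsilon>" if "\<epsilon> > 0" for x :: "nat \<Rightarrow> 'h" and n \<epsilon>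
    by (rule orth_proj_strong_approximation[OF M id_in_alg generated_algebra.add generated_algebra.scale
          generated_algebra.comp[OF Se_in_alg] generated_algebra.comp[OF Pr_in_alg] that])
qed

end

theorem proposition4p12:
  fixes G :: "('a, 'k::finite) kgraph"
    and n :: "nat ^ 'k"
    and t :: "'k \<Rightarrow> 'k \<Rightarrow> 'a fibre_tensor \<Rightarrow> 'a fibre_tensor"
    and S :: "'k \<Rightarrow> ('a \<Rightarrow> complex) \<Rightarrow> 'h::complex_hilbert_space \<Rightarrow> 'h"
    and \<rho> :: "('a \<Rightarrow> complex) \<Rightarrow> 'h \<Rightarrow> 'h"
  assumes "is_kgraph G"
    and "finite (vertices G)"
    and "\<And>i. n $ i \<noteq> 0"
    and "strong_double_cycle_property (vertices G) (paths_of_degree G n) (src G) (rng G)"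
    and "product_system_isos G t"
    and "system_rep G t UNIV S \<rho>"
    and "isometric_rep G UNIV S \<rho>"
    and "fully_coisometric_rep G UNIV S \<rho>"
    and "finitely_correlated G t S \<rho>"
  shows "(\<exists>!M. minimal_cyclic_coinvariant (rep_wot_algebra G S \<rho>) M) \<and>
    (\<forall>M. minimal_cyclic_coinvariant (rep_wot_algebra G S \<rho>) M \<longrightarrow>
       orth_proj M \<in> rep_wot_algebra G S \<rho>)"
proof -
  interpret coisometric_system_rep G t S \<rho> by unfold_locales (fact assms)+
  obtain W where "coinvariant W" "finite_dim W" "orbit_span W = UNIV"
    using finitely_correlated_coinvariant[OF assms(9)] by blast
  then obtain M where "least_cyclic M" using least_cyclic_exists by blast
  thus ?thesis using minimal_cyclic_coinvariant_iff orth_proj_in_SS by auto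
qed

end
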